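(* Let $\mu,\nu>0$, let $t_*\ge 0$, and let $\mathbf p(t)=\{p_n(t)\}_{n\in\mathbb Z}$, $t\ge t_*$, be the unique solution of the Phase II system $\frac{\mathrm d}{\mathrm dt}\mathbf p(t)=Q_2[\mathbf p(t)]$ with $\mathbf p(t_* )\in\mathcal S_{\mu,\nu}$. Let $r=r(t)=\sum_{n\ge1}p_n(t)$, $d=d(t)=\sum_{n\le-1}p_n(t)$, and let $\mathbf p^*$ be the two-sided geometric distribution with parameters determined by $(\mu,\nu)$. Then for all $t\ge t_*$, $$\frac{\mathrm d}{\mathrm dt}\,\mathrm D_{\mathrm{KL}}\left(\mathbf p(t)\,\|\,\mathbf p^*\right)=-\sum_{n\ge0} r\left(\frac{p_{n+1}}{r}-\frac{p_n}{r+p_0}\right)\log\frac{p_{n+1}/r}{p_n/(r+p_0)}-\sum_{n\le-1}\frac{r\,d}{r+p_0}\left(\frac{p_{n+1}}{d+p_0}-\frac{p_n}{d}\right)\log\frac{p_{n+1}/(d+p_0)}{p_n/d}\ \le\ 0 .$$ Consequently, if $\sum_{n\ge0}p_n(t_* )\,c^n+\sum_{n\le0}p_n(t_* )\,c^{-n}<\infty$ for some $c>1$, then for every $1<s<\infty$ the solution $\mathbf p(t)$ converges strongly in $\ell^s(\mathbb Z)$ to $\mathbf p^*$ as $t\to\infty$.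
   Context: For $\mu,\nu>0$, $\mathcal S_{\mu,\nu}$ is the set of sequences $\mathbf p=\{p_n\}_{n\in\mathbb Z}$ with $p_n\ge0$, $\sum_{n\in\mathbb Z}p_n=1$, $\sum_{n\in\mathbb Z}n\,p_n=\mu$, and $-\sum_{n\le0}n\,p_n=\mu\nu$. For $\mathbf p$ in this set put $r=\sum_{n\ge1}p_n$ and $d=\sum_{n\le-1}p_n$ (both are positive). The Phase II operator is $$Q_2[\mathbf p]_n=\begin{cases}\frac{rd}{(r+p_0)(d+p_0)}\,p_{n+1}+\frac{r}{r+p_0}\,p_{n-1}-\left(\frac{rd}{(r+p_0)(d+p_0)}+\frac{r}{r+p_0}\right)p_n, & n\le-1,\\[4pt] p_1+\frac{r}{r+p_0}\,p_{-1}-\left(\frac{rd}{(r+p_0)(d+p_0)}+\frac{r}{r+p_0}\right)p_0, & n=0,\\[4pt] p_{n+1}+\frac{r}{r+p_0}\,p_{n-1}-\left(1+\frac{r}{r+p_0}\right)p_n, & n\ge1.\end{cases}$$ Solutions starting in $\mathcal S_{\mu,\nu}$ at the initial time $t_*$ of Phase II remain in $\mathcal S_{\mu,\nu}$ for all $t\ge t_*$. The distribution $\mathbf p^*=\{p_n^*\}_{n\in\mathbb Z}$ is $$p_n^*=\left(\frac{r^*}{r^*+p_0^*}\right)^n p_0^*\ (n\ge0),\qquad p_n^*=\left(\frac{d^*}{d^*+p_0^*}\right)^{-n}p_0^*\ (n\le0),$$ where $p_0^*=\frac{1}{4\nu+2}$ if $\mu=1$ and $p_0^*=\frac{\mu(\nu+\frac12)-\sqrt{\mu^2\nu^2+\mu^2\nu+\frac14}}{(\mu^2-1)/2}$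 if $\mu\ne1$, and $r^*=\frac{(\mu-1)p_0^*+1}{2}$, $d^*=1-p_0^*-r^*$. The relative entropy is $\mathrm D_{\mathrm{KL}}(\mathbf p\,\|\,\mathbf q)=\sum_{n\in\mathbb Z}p_n\log(p_n/q_n)$, with $0\log0=0$. Convention: a term of the form $(x-y)\log(x/y)$ with $x,y\ge0$ is $0$ if $x=y=0$ and $+\infty$ if exactly one of $x,y$ is $0$; the derivative at the endpoint $t=t_*$ is the right derivative and may take the value $-\infty$. *)

theory Defs
  imports "HOL-Analysis.Analysis"
begin

definition prob_seq :: "(int \<Rightarrow> real) \<Rightarrow> bool" where
  "prob_seq p \<longleftrightarrow> (\<forall>n. 0 \<le> p n) \<and> (p has_sum 1) UNIV"

definition wealth_class :: "real \<Rightarrow> real \<Rightarrow> (int \<Rightarrow> real) set" where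
  "wealth_class \<mu> \<nu> =
    {p. prob_seq p \<and>
        ((\<lambda>n. of_int n * p n) has_sum \<mu>) UNIV \<and>
        ((\<lambda>n. - (of_int n * p n)) has_sum (\<mu> * \<nu>)) {..0}}"

definition rich :: "(int \<Rightarrow> real) \<Rightarrow> real" where
  "rich p = (\<Sum>\<^sub>\<infinity>n\<in>{1..}. p n)"

definition debt :: "(int \<Rightarrow> real) \<Rightarrow> real" where
  "debt p = (\<Sum>\<^sub>\<infinity>n\<in>{..-1}. p n)"

definition Q2 :: "(int \<Rightarrow> real) \<Rightarrow> int \<Rightarrow> real" where
  "Q2 p n =
    (let r = rich p; d = debt p;
         a = r * d / ((r + p 0) * (d + p 0));
         b = r / (r + p 0)
     in if n \<le> -1 then a * p (n + 1) + b * p (n - 1) - (a + b) * p n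
        else if n = 0 then p 1 + b * p (-1) - (a + b) * p 0
        else p (n + 1) + b * p (n - 1) - (1 + b) * p n)"

text \<open>
  A solution is a curve of probability distributions solving the system componentwise,
  with a one-sided derivative at the initial time. Membership in the class with
  prescribed mean and prescribed debt is required of the initial datum only.
\<close>
definition phase2_solution :: "real \<Rightarrow> (real \<Rightarrow> int \<Rightarrow> real) \<Rightarrow> bool" where
  "phase2_solution t0 p \<longleftrightarrow>
    (\<forall>t\<ge>t0. prob_seq (p t) \<and>
      (\<forall>n. ((\<lambda>s. p s n) has_real_derivative Q2 (p t) n) (at t within {t0..})))"

definition p0_star :: "real \<Rightarrow> real \<Rightarrow> real" where
  "p0_star \<mu> \<nu> =
    (if \<mu> = 1 then 1 / (4 * \<nu> + 2)
     else (\<mu> * (\<nu> + 1 / 2) - sqrt (\<mu>\<^sup>2 * \<nu>\<^sup>2 + \<mu>\<^sup>2 * \<nu> + 1 / 4)) / ((\<mu>\<^sup>2 - 1) / 2))"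

definition r_star :: "real \<Rightarrow> real \<Rightarrow> real" where
  "r_star \<mu> \<nu> = ((\<mu> - 1) * p0_star \<mu> \<nu> + 1) / 2"

definition d_star :: "real \<Rightarrow> real \<Rightarrow> real" where
  "d_star \<mu> \<nu> = 1 - p0_star \<mu> \<nu> - r_star \<mu> \<nu>"

definition p_star :: "real \<Rightarrow> real \<Rightarrow> int \<Rightarrow> real" where
  "p_star \<mu> \<nu> n =
    (if 0 \<le> n
     then (r_star \<mu> \<nu> / (r_star \<mu> \<nu> + p0_star \<mu> \<nu>)) ^ nat n * p0_star \<mu> \<nu>
     else (d_star \<mu> \<nu> / (d_star \<mu> \<nu> + p0_star \<mu> \<nu>)) ^ nat (- n) * p0_star \<mu> \<nu>)"

text \<open>
  The convention \<open>0 log 0 = 0\<close> is built in, since the factor \<open>p n\<close> vanishes. As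
  \<open>infsum\<close> is \<open>0\<close> on families that are not summable, results about \<open>rel_entropy\<close>
  should also state summability of \<open>rel_entropy_term\<close>.
\<close>
definition rel_entropy_term :: "(int \<Rightarrow> real) \<Rightarrow> (int \<Rightarrow> real) \<Rightarrow> int \<Rightarrow> real" where
  "rel_entropy_term p q n = p n * ln (p n / q n)"

definition rel_entropy :: "(int \<Rightarrow> real) \<Rightarrow> (int \<Rightarrow> real) \<Rightarrow> real" where
  "rel_entropy p q = (\<Sum>\<^sub>\<infinity>n. rel_entropy_term p q n)"

text \<open>The expression \<open>(x - y) log (x / y)\<close> for \<open>x, y \<ge> 0\<close>, with values in \<open>[0, \<infinity>]\<close>.\<close>
definition log_gap :: "real \<Rightarrow> real \<Rightarrow> ereal" where
  "log_gap x y =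
    (if x = 0 \<and> y = 0 then 0
     else if x = 0 \<or> y = 0 then \<infinity>
     else ereal ((x - y) * ln (x / y)))"

text \<open>
  Both series have terms in \<open>[0, \<infinity>]\<close> when \<open>p\<close> is nonnegative, so they are always
  summable in \<open>ereal\<close>.
\<close>
definition dissipation :: "(int \<Rightarrow> real) \<Rightarrow> ereal" where
  "dissipation p =
    (let r = rich p; d = debt p
     in (\<Sum>\<^sub>\<infinity>n\<in>{0..}. ereal r * log_gap (p (n + 1) / r) (p n / (r + p 0)))
      + (\<Sum>\<^sub>\<infinity>n\<in>{..-1}. ereal (r * d / (r + p 0)) * log_gap (p (n + 1) / (d + p 0)) (p n / d)))"

definition lp_space :: "real \<Rightarrow> (int \<Rightarrow> real) set" where
  "lp_space s = {x. (\<lambda>n. \<bar>x n\<bar> powr s) summable_on UNIV}"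

definition lp_norm :: "real \<Rightarrow> (int \<Rightarrow> real) \<Rightarrow> real" where
  "lp_norm s x = (\<Sum>\<^sub>\<infinity>n. \<bar>x n\<bar> powr s) powr (1 / s)"

end

theory Submission
  imports Defs
begin

text \<open>
  The Phase II system is a birth-death chain whose rates depend on time. Because the fluxes over the
  nonnegative and over the negative edges sum to zero, the pairing of \<open>p\<close> with the logarithm of the
  equilibrium is conserved, and the entropy identity is a summation by parts. To justify it one needs
  the series of \<open>(p (n + 1) - p n) * ln (p (n + 1) / p n)\<close> to have a majorant that is locally uniform
  in time. The summand is convex and homogeneous, so the series satisfies a Gronwall inequality, first
  for \<open>p + e\<close> and then for \<open>e \<rightarrow> 0\<close>; the entropy balance gives the starting value at
  positive times. If the dissipation is infinite at the initial time, lower semicontinuity and the mean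
  value theorem yield the right derivative.

  For the convergence, the bounded Laplace transforms at 1/2 of the two halves of \<open>p\<close> force \<open>p 0\<close> to be
  bounded below on average, which makes small exponential moments bounded uniformly in time. Along times
  where the dissipation tends to zero all net fluxes tend to zero; the conserved moments then
  identify the limit, and the relative entropy, being monotone, tends to zero.
\<close>

section \<open>Series over the integers and differential inequalities\<close>

text \<open>The obstacle is that the logarithm of \<open>p\<close> is unbounded in space: in the
  derivative of the entropy, \<open>ln (p n)\<close> meets the masses at \<open>n - 1\<close> and
  \<open>n + 1\<close>, and no moment of \<open>p\<close> controls such products. The gaps do, since
  \<open>u * \<bar>ln u - ln v\<bar>\<close> is at most \<open>2 * gap u v + u\<close>; this is why
  the gap series is the quantity to bound. With \<open>e > 0\<close> all logarithms are bounded and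
  sums may be differentiated term by term, whereas the Gronwall rate and constant involve only a
  lower bound for \<open>p\<close> at the sites -1, 0 and 1, so that \<open>e\<close> can be removed
  at the end. A solution is only known to consist of probability sequences, so finiteness and
  conservation of the first moments along the flow have to be proved as well, by truncating the
  weight. The exponential moment serves the passage to the limit in the first moments: these are
  conserved at every time, but without uniform tails the limit could lose part of them to infinity
  and would no longer be identified by \<mu> and \<nu>.\<close>

lemma summable_on_dominated:
  fixes f g :: "'a \<Rightarrow> real"
  assumes "g summable_on A" "\<And>x. x \<in> A \<Longrightarrow> \<bar>f x\<bar> \<le> g x"
  shows "f summable_on A"
proof -
  have "(\<lambda>x. norm (f x)) summable_on A"
    by (rule Infinite_Sum.abs_summable_on_comparison_test'[OF assms(1)]) (use assms(2) in auto)
  then show ?thesis by (rule abs_summable_summable)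
qed

lemma infsum_abs_le:
  fixes f g :: "'a \<Rightarrow> real"
  assumes "g summable_on A" "\<And>x. x \<in> A \<Longrightarrow> \<bar>f x\<bar> \<le> g x"
  shows "\<bar>infsum f A\<bar> \<le> infsum g A"
proof -
  have f: "f summable_on A" by (rule summable_on_dominated[OF assms])
  have "infsum f A \<le> infsum g A"
    by (rule infsum_mono[OF f assms(1)]) (use assms(2) in force)
  moreover have "infsum (\<lambda>x. - f x) A \<le> infsum g A"
    by (rule infsum_mono[OF summable_on_uminus[THEN iffD2, OF f] assms(1)]) (use assms(2) in force)
  ultimately show ?thesis by (simp add: infsum_uminus abs_le_iff)
qed

lemma infsum_real_diff:
  fixes f g :: "'a \<Rightarrow> real"
  assumes "f summable_on A" "g summable_on A"
  shows "infsum (\<lambda>x. f x - g x) A = infsum f A - infsum g A"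
  using infsum_add[OF assms(1) summable_on_uminus[THEN iffD2, OF assms(2)]] by (simp add: infsum_uminus)

lemma summable_on_real_diff:
  fixes f g :: "'a \<Rightarrow> real"
  assumes "f summable_on A" "g summable_on A"
  shows "(\<lambda>x. f x - g x) summable_on A"
  using summable_on_add[OF assms(1) summable_on_uminus[THEN iffD2, OF assms(2)]] by simp

text \<open>A finite set carries the majorant up to \<open>e / 8\<close>, so only finitely many
  limits matter. The filter is arbitrary because the lemma serves sequences of times as well as
  limits in time within a half line.\<close>

lemma tendsto_infsum_dominated:
  fixes f :: "'b \<Rightarrow> 'a \<Rightarrow> real"
  assumes lim: "\<And>n. n \<in> A \<Longrightarrow> ((\<lambda>s. f s n) \<longlongrightarrow> g n) F"
    and dom: "eventually (\<lambda>s. \<forall>n\<in>A. \<bar>f s n\<bar> \<le> M n) F"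
    and M: "M summable_on A"
  shows "((\<lambda>s. infsum (f s) A) \<longlongrightarrow> infsum g A) F"
proof (cases "F = bot")
  case False
  have gM: "\<bar>g n\<bar> \<le> M n" if "n \<in> A" for n
  proof (rule tendsto_upperbound[OF tendsto_rabs[OF lim[OF that]] _ False])
    show "\<forall>\<^sub>F s in F. \<bar>f s n\<bar> \<le> M n"
      using dom by eventually_elim (use that in auto)
  qed
  have g: "g summable_on A" by (rule summable_on_dominated[OF M gM])
  show ?thesis
  proof (rule tendstoI)
    fix e :: real assume e: "e > 0"
    obtain K where K: "finite K" "K \<subseteq> A" "dist (sum M K) (infsum M A) \<le> e / 8"
      using infsum_finite_approximation[OF M, of "e / 8"] e by auto
    have tailx: "\<bar>sum M K - infsum M A\<bar> \<le> e / 8"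
      using K(3) by (simp add: dist_real_def)
    have tail: "infsum M (A - K) \<le> e / 8"
      using tailx infsum_Diff[OF M summable_on_finite[OF K(1), of M] K(2)]
      unfolding infsum_finite[OF K(1)] by linarith
    have MT: "M summable_on (A - K)" by (rule summable_on_subset[OF M]) auto
    have "((\<lambda>s. \<Sum>n\<in>K. f s n) \<longlongrightarrow> (\<Sum>n\<in>K. g n)) F"
      by (intro tendsto_sum lim) (use K in auto)
    then have ev: "\<forall>\<^sub>F s in F. dist (\<Sum>n\<in>K. f s n) (\<Sum>n\<in>K. g n) < e / 2"
      using e by (intro tendstoD) auto
    show "\<forall>\<^sub>F s in F. dist (infsum (f s) A) (infsum g A) < e"
      using ev dom
    proof eventually_elim
      case (elim s)
      have fs: "f s summable_on A" by (rule summable_on_dominated[OF M]) (use elim in auto)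
      have "\<bar>infsum (f s) (A - K)\<bar> \<le> infsum M (A - K)"
        by (rule infsum_abs_le[OF MT]) (use elim in auto)
      moreover have "\<bar>infsum g (A - K)\<bar> \<le> infsum M (A - K)"
        by (rule infsum_abs_le[OF MT]) (use gM in auto)
      moreover have "infsum (f s) A = sum (f s) K + infsum (f s) (A - K)"
        using infsum_Diff[OF fs summable_on_finite[OF K(1)] K(2)] K(1) by simp
      moreover have "infsum g A = sum g K + infsum g (A - K)"
        using infsum_Diff[OF g summable_on_finite[OF K(1)] K(2)] K(1) by simp
      ultimately show ?case using elim(1) tail e unfolding dist_real_def by linarith
    qed
  qed
qed simp

lemma has_derivative_within_mono:
  fixes f :: "real \<Rightarrow> real"
  assumes "a \<le> b" "\<And>x. a \<le> x \<Longrightarrow> x \<le> b \<Longrightarrow> (f has_real_derivative f' x) (at x within S)"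
    and "{a..b} \<subseteq> S" "\<And>x. a \<le> x \<Longrightarrow> x \<le> b \<Longrightarrow> f' x \<ge> 0"
  shows "f a \<le> f b"
proof -
  have "\<exists>x\<in>{a..b}. f b - f a = (*) (f' x) (b - a)"
    by (rule mvt_very_simple[OF assms(1)])
      (use assms(2,3) in \<open>auto simp: has_field_derivative_def intro: has_derivative_subset\<close>)
  with assms(1,4) show ?thesis
    by (metis atLeastAtMost_iff diff_ge_0_iff_ge mult_nonneg_nonneg)
qed

lemma has_derivative_within_antimono:
  fixes f :: "real \<Rightarrow> real"
  assumes "a \<le> b" "\<And>x. a \<le> x \<Longrightarrow> x \<le> b \<Longrightarrow> (f has_real_derivative f' x) (at x within S)"
    and "{a..b} \<subseteq> S" "\<And>x. a \<le> x \<Longrightarrow> x \<le> b \<Longrightarrow> f' x \<le> 0"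
  shows "f b \<le> f a"
  using has_derivative_within_mono[of a b "\<lambda>x. - f x" "\<lambda>x. - f' x" S] assms
  by (simp add: DERIV_minus)

lemma has_derivative_within_bound:
  fixes f :: "real \<Rightarrow> real"
  assumes "a \<le> b" "\<And>x. a \<le> x \<Longrightarrow> x \<le> b \<Longrightarrow> (f has_real_derivative f' x) (at x within S)"
    and "{a..b} \<subseteq> S" "\<And>x. a \<le> x \<Longrightarrow> x \<le> b \<Longrightarrow> \<bar>f' x\<bar> \<le> K"
  shows "\<bar>f b - f a\<bar> \<le> K * (b - a)"
proof -
  have "\<exists>x\<in>{a..b}. f b - f a = (*) (f' x) (b - a)"
    by (rule mvt_very_simple[OF assms(1)])
      (use assms(2,3) in \<open>auto simp: has_field_derivative_def intro: has_derivative_subset\<close>)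
  then obtain x where "x \<in> {a..b}" "f b - f a = f' x * (b - a)" by blast
  then show ?thesis using assms(1) assms(4)[of x]
    by (auto simp: abs_mult intro!: mult_right_mono)
qed

text \<open>The integrating factor \<open>exp (- K * x)\<close> turns the hypothesis into
  monotonicity. The signs of \<open>f\<close> and \<open>K\<close> are free, which lets the lower
  version be this one for \<open>- f\<close>.\<close>

lemma gronwall_deriv:
  fixes f :: "real \<Rightarrow> real"
  assumes "a \<le> b" "\<And>x. a \<le> x \<Longrightarrow> x \<le> b \<Longrightarrow> (f has_real_derivative f' x) (at x within S)"
    and "{a..b} \<subseteq> S" "\<And>x. a \<le> x \<Longrightarrow> x \<le> b \<Longrightarrow> f' x \<le> K * f x"
  shows "f b \<le> exp (K * (b - a)) * f a"
proof -
  have "exp (- K * b) * f b \<le> exp (- K * a) * f a"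
  proof (rule has_derivative_within_antimono[OF assms(1) _ assms(3),
          where f' = "\<lambda>x. exp (- K * x) * (f' x - K * f x)"])
    fix x assume x: "a \<le> x" "x \<le> b"
    show "((\<lambda>x. exp (- K * x) * f x) has_real_derivative exp (- K * x) * (f' x - K * f x)) (at x within S)"
      by (rule derivative_eq_intros assms(2)[OF x] refl | simp)+ (simp add: algebra_simps)
    show "exp (- K * x) * (f' x - K * f x) \<le> 0"
      using assms(4)[OF x] by (simp add: mult_le_0_iff)
  qed
  then have "exp (K * b) * (exp (- K * b) * f b) \<le> exp (K * b) * (exp (- K * a) * f a)"
    by simp
  moreover have "exp (K * b) * (exp (- K * b) * f b) = f b"
    by (simp add: exp_minus)
  moreover have "exp (K * b) * (exp (- K * a) * f a) = exp (K * (b - a)) * f a"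
    by (simp add: exp_diff exp_minus divide_inverse right_diff_distrib)
  ultimately show ?thesis by argo
qed

lemma gronwall_deriv_lower:
  fixes f :: "real \<Rightarrow> real"
  assumes "a \<le> b" "\<And>x. a \<le> x \<Longrightarrow> x \<le> b \<Longrightarrow> (f has_real_derivative f' x) (at x within S)"
    and "{a..b} \<subseteq> S" "\<And>x. a \<le> x \<Longrightarrow> x \<le> b \<Longrightarrow> f' x \<ge> K * f x"
  shows "f b \<ge> exp (K * (b - a)) * f a"
  using gronwall_deriv[of a b "\<lambda>x. - f x" "\<lambda>x. - f' x" S K] assms
  by (simp add: DERIV_minus)

text \<open>By the mean value theorem the majorant of the derivatives also bounds the difference
  quotients, so dominated convergence applies. The majorant is local in time:
  \<open>t < \<beta>\<close> keeps all times near \<open>t\<close> inside its range.\<close>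

lemma has_real_derivative_infsum:
  fixes G g :: "real \<Rightarrow> 'a \<Rightarrow> real"
  assumes der: "\<And>s n. s \<ge> \<alpha> \<Longrightarrow> ((\<lambda>u. G u n) has_real_derivative g s n) (at s within {\<alpha>..})"
    and dom: "\<And>s n. \<alpha> \<le> s \<Longrightarrow> s \<le> \<beta> \<Longrightarrow> \<bar>g s n\<bar> \<le> M n" and M: "M summable_on UNIV"
    and sm: "\<And>s. \<alpha> \<le> s \<Longrightarrow> s \<le> \<beta> \<Longrightarrow> G s summable_on UNIV"
    and t: "\<alpha> \<le> t" "t < \<beta>"
  shows "((\<lambda>s. \<Sum>\<^sub>\<infinity>n. G s n) has_real_derivative (\<Sum>\<^sub>\<infinity>n. g t n)) (at t within {\<alpha>..})"
proof -
  have near: "\<forall>\<^sub>F s in at t within {\<alpha>..}. s \<in> {\<alpha>..} - {t} \<and> s < \<beta>"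
    using t by (auto simp: eventually_at intro!: exI[of _ "\<beta> - t"] simp: dist_real_def)
  have "((\<lambda>s. \<Sum>\<^sub>\<infinity>n. (G s n - G t n) / (s - t)) \<longlongrightarrow> (\<Sum>\<^sub>\<infinity>n. g t n)) (at t within {\<alpha>..})"
  proof (rule tendsto_infsum_dominated[OF _ _ M])
    show "((\<lambda>s. (G s n - G t n) / (s - t)) \<longlongrightarrow> g t n) (at t within {\<alpha>..})" for n
      using der[OF t(1), of n] by (simp add: has_field_derivative_iff)
    show "\<forall>\<^sub>F s in at t within {\<alpha>..}. \<forall>n\<in>UNIV. \<bar>(G s n - G t n) / (s - t)\<bar> \<le> M n"
      using near
    proof eventually_elim
      case (elim s)
      show ?case
      proof
        fix n
        have "\<bar>G s n - G t n\<bar> \<le> M n * \<bar>s - t\<bar>"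
        proof (cases "t \<le> s")
          case True
          then show ?thesis
            using has_derivative_within_bound[of t s "\<lambda>u. G u n" "\<lambda>u. g u n" "{\<alpha>..}" "M n"] der dom t elim
            by auto
        next
          case False
          then show ?thesis
            using has_derivative_within_bound[of s t "\<lambda>u. G u n" "\<lambda>u. g u n" "{\<alpha>..}" "M n"] der dom t elim
            by (auto simp: abs_minus_commute)
        qed
        then show "\<bar>(G s n - G t n) / (s - t)\<bar> \<le> M n"
          using elim by (auto simp: abs_divide pos_divide_le_eq)
      qed
    qed
  qed
  moreover have "\<forall>\<^sub>F s in at t within {\<alpha>..}.
      (\<Sum>\<^sub>\<infinity>n. (G s n - G t n) / (s - t)) = ((\<Sum>\<^sub>\<infinity>n. G s n) - (\<Sum>\<^sub>\<infinity>n. G t n)) / (s - t)"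
    using near
  proof eventually_elim
    case (elim s)
    have "(\<Sum>\<^sub>\<infinity>n. (G s n - G t n) / (s - t)) = (\<Sum>\<^sub>\<infinity>n. (G s n - G t n) * inverse (s - t))"
      by (simp add: divide_inverse)
    also have "\<dots> = (\<Sum>\<^sub>\<infinity>n. G s n - G t n) * inverse (s - t)"
      by (rule infsum_cmult_left')
    also have "(\<Sum>\<^sub>\<infinity>n. G s n - G t n) = (\<Sum>\<^sub>\<infinity>n. G s n) - (\<Sum>\<^sub>\<infinity>n. G t n)"
      by (rule infsum_real_diff) (use elim t in \<open>auto intro!: sm\<close>)
    finally show ?case by (simp add: divide_inverse)
  qed
  ultimately show ?thesis
    by (simp add: has_field_derivative_iff tendsto_cong)
qed

lemma summable_on_int_shift_iff:
  fixes f :: "int \<Rightarrow> real"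
  shows "(\<lambda>n. f (n + k)) summable_on UNIV \<longleftrightarrow> f summable_on UNIV"
  by (rule summable_on_reindex_bij_witness[where i = "\<lambda>n. n - k" and j = "\<lambda>n. n + k"]) auto

lemma infsum_int_shift:
  fixes f :: "int \<Rightarrow> real"
  shows "(\<Sum>\<^sub>\<infinity>n. f (n + k)) = (\<Sum>\<^sub>\<infinity>n. f n)"
  by (rule infsum_reindex_bij_witness[where i = "\<lambda>n. n - k" and j = "\<lambda>n. n + k"]) auto

lemma summable_on_int_shift:
  fixes f :: "int \<Rightarrow> real"
  assumes "f summable_on UNIV"
  shows "(\<lambda>n. f (n + k)) summable_on UNIV" "(\<lambda>n. f (n - k)) summable_on UNIV"
  using assms summable_on_int_shift_iff[of f k] summable_on_int_shift_iff[of f "- k"] by auto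

lemma summable_on_int_half:
  fixes f :: "int \<Rightarrow> real"
  assumes "f summable_on {0..}" "f summable_on {..0}"
  shows "f summable_on UNIV"
proof -
  have "{0..} \<union> {..0} = (UNIV :: int set)" by auto
  then show ?thesis using summable_on_union[OF assms] by simp
qed

lemma has_sum_int_nat:
  fixes f :: "int \<Rightarrow> real"
  shows "(f has_sum S) {0..} \<longleftrightarrow> ((\<lambda>n. f (int n)) has_sum S) UNIV"
    and "(f has_sum S) {..0} \<longleftrightarrow> ((\<lambda>n. f (- int n)) has_sum S) UNIV"
proof -
  show "(f has_sum S) {0..} \<longleftrightarrow> ((\<lambda>n. f (int n)) has_sum S) UNIV"
    by (rule has_sum_reindex_bij_witness[where i = int and j = nat]) auto
  show "(f has_sum S) {..0} \<longleftrightarrow> ((\<lambda>n. f (- int n)) has_sum S) UNIV"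
    by (rule has_sum_reindex_bij_witness[where i = "\<lambda>n. - int n" and j = "\<lambda>n. nat (- n)"]) auto
qed

lemma summable_on_int_nat:
  fixes f :: "int \<Rightarrow> real"
  shows "f summable_on {0..} \<longleftrightarrow> (\<lambda>n. f (int n)) summable_on UNIV"
    and "f summable_on {..0} \<longleftrightarrow> (\<lambda>n. f (- int n)) summable_on UNIV"
  by (simp_all add: summable_on_def has_sum_int_nat)

lemma summable_on_int_symmetric:
  fixes f :: "nat \<Rightarrow> real"
  assumes "summable f" "\<And>n. f n \<ge> 0"
  shows "(\<lambda>n::int. f (nat \<bar>n\<bar>)) summable_on UNIV"
proof -
  have "f summable_on UNIV"
    using assms by (simp add: summable_on_UNIV_nonneg_real_iff)
  then show ?thesis
    by (intro summable_on_int_half) (simp_all add: summable_on_int_nat)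
qed

lemma summable_on_int_geometric:
  fixes q :: real
  assumes "0 \<le> q" "q < 1"
  shows "(\<lambda>n::int. q ^ nat \<bar>n\<bar>) summable_on UNIV"
    and "(\<lambda>n::int. (1 + real_of_int \<bar>n\<bar>) * q ^ nat \<bar>n\<bar>) summable_on UNIV"
proof -
  show "(\<lambda>n::int. q ^ nat \<bar>n\<bar>) summable_on UNIV"
    by (rule summable_on_int_symmetric) (use assms in \<open>auto intro: summable_geometric\<close>)
  have "(\<lambda>n::int. (\<lambda>k. real (Suc k) * q ^ k) (nat \<bar>n\<bar>)) summable_on UNIV"
    by (rule summable_on_int_symmetric)
      (use assms geometric_deriv_sums[of q] in \<open>auto simp: sums_iff\<close>)
  then show "(\<lambda>n::int. (1 + real_of_int \<bar>n\<bar>) * q ^ nat \<bar>n\<bar>) summable_on UNIV"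
    by (simp add: add.commute)
qed

section \<open>The Phase II flow\<close>

text \<open>Neighbouring values are comparable up to \<open>K\<close>, which is what it takes to
  move a weight across one jump of the chain. Constant, linear and exponential weights
  qualify.\<close>

definition tame :: "real \<Rightarrow> (int \<Rightarrow> real) \<Rightarrow> bool" where
  "tame K W \<longleftrightarrow> K \<ge> 1 \<and> (\<forall>n. 0 \<le> W n \<and> W (n + 1) \<le> K * W n \<and> W (n - 1) \<le> K * W n)"

lemma tame_const: "c \<ge> 0 \<Longrightarrow> tame 1 (\<lambda>_. c)"
  by (simp add: tame_def)

lemma tame_linear: "tame 2 (\<lambda>n. 1 + real_of_int \<bar>n\<bar>)"
  by (auto simp: tame_def)

lemma tame_exp:
  assumes "z \<ge> 1"
  shows "tame z (\<lambda>n. z ^ nat \<bar>n\<bar>)"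
  unfolding tame_def
proof (intro conjI allI)
  fix n :: int
  have *: "z ^ k \<le> z * z ^ nat \<bar>n\<bar>" if "k \<le> Suc (nat \<bar>n\<bar>)" for k
    using power_increasing[OF that assms] by simp
  show "z ^ nat \<bar>n + 1\<bar> \<le> z * z ^ nat \<bar>n\<bar>" "z ^ nat \<bar>n - 1\<bar> \<le> z * z ^ nat \<bar>n\<bar>"
    by (rule *; linarith)+
qed (use assms in auto)

text \<open>The factor \<open>K\<close> survives truncation, so Gronwall bounds for the truncated
  weights do not depend on the level \<open>N\<close>.\<close>

lemma tame_min:
  assumes "tame K W" "N \<ge> 0"
  shows "tame K (\<lambda>n. min (W n) N)"
proof -
  have K: "K \<ge> 1" "N \<le> K * N" using assms mult_right_mono[of 1 K N] by (auto simp: tame_def)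
  have "min (W m) N \<le> K * min (W n) N" if "W m \<le> K * W n" for m n
    using that K by (cases "W n \<le> N") (auto simp: min_def)
  then show ?thesis using assms unfolding tame_def by auto
qed

lemma ratio_bounds:
  fixes x y :: real
  assumes "x \<ge> 0" "y \<ge> 0"
  shows "0 \<le> x / (x + y)" "x / (x + y) \<le> 1"
  using assms by (auto simp: divide_le_eq_1)

text \<open>Moving the shift from \<open>q\<close> to \<open>W\<close> costs the factor
  \<open>K\<close>; afterwards the sum is a translate of the original one.\<close>

lemma shifted_weight_summable:
  assumes "tame K W" "\<And>n. q n \<ge> 0" "(\<lambda>n. W n * q n) summable_on UNIV"
  shows "(\<lambda>n. W n * q (n - 1)) summable_on UNIV" "(\<lambda>n. W n * q (n + 1)) summable_on UNIV"
    "(\<Sum>\<^sub>\<infinity>n. W n * q (n - 1)) \<le> K * (\<Sum>\<^sub>\<infinity>n. W n * q n)"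
    "(\<Sum>\<^sub>\<infinity>n. W n * q (n + 1)) \<le> K * (\<Sum>\<^sub>\<infinity>n. W n * q n)"
proof -
  have W: "0 \<le> W n" "W (n + 1) \<le> K * W n" "W (n - 1) \<le> K * W n" for n
    using assms(1) unfolding tame_def by blast+
  define h where "h n = K * (W n * q n)" for n
  have h: "h summable_on UNIV" unfolding h_def by (rule summable_on_cmult_right[OF assms(3)])
  have h_inf: "infsum h UNIV = K * (\<Sum>\<^sub>\<infinity>n. W n * q n)"
    unfolding h_def by (rule infsum_cmult_right')
  have 1: "W n * q (n - 1) \<le> h (n - 1)" "W n * q (n + 1) \<le> h (n + 1)" for n
    using mult_right_mono[OF W(2)[of "n - 1"] assms(2)[of "n - 1"]]
      mult_right_mono[OF W(3)[of "n + 1"] assms(2)[of "n + 1"]]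
    by (simp_all add: h_def mult.assoc)
  note hs = summable_on_int_shift[OF h, of 1]
  show s1: "(\<lambda>n. W n * q (n - 1)) summable_on UNIV"
    by (rule summable_on_dominated[OF hs(2)]) (use 1 W assms(2) in auto)
  show s2: "(\<lambda>n. W n * q (n + 1)) summable_on UNIV"
    by (rule summable_on_dominated[OF hs(1)]) (use 1 W assms(2) in auto)
  show "(\<Sum>\<^sub>\<infinity>n. W n * q (n - 1)) \<le> K * (\<Sum>\<^sub>\<infinity>n. W n * q n)"
    using infsum_mono[OF s1 hs(2) 1(1)] infsum_int_shift[of h "-1"] h_inf by simp
  show "(\<Sum>\<^sub>\<infinity>n. W n * q (n + 1)) \<le> K * (\<Sum>\<^sub>\<infinity>n. W n * q n)"
    using infsum_mono[OF s2 hs(1) 1(2)] infsum_int_shift[of h "1"] h_inf by simp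
qed

section \<open>Rates, net fluxes and elementary bounds\<close>

locale phase2 =
  fixes \<mu> \<nu> t0 :: real and p :: "real \<Rightarrow> int \<Rightarrow> real"
  assumes mu_pos: "\<mu> > 0" and nu_pos: "\<nu> > 0"
    and sol: "phase2_solution t0 p" and init: "p t0 \<in> wealth_class \<mu> \<nu>"
begin

definition r :: "real \<Rightarrow> real" where "r t = rich (p t)"
definition d :: "real \<Rightarrow> real" where "d t = debt (p t)"
definition b :: "real \<Rightarrow> real" where "b t = r t / (r t + p t 0)"
definition a :: "real \<Rightarrow> real" where "a t = b t * (d t / (d t + p t 0))"

text \<open>\<open>dr t n\<close> is the rate of jumps from \<open>n\<close> to \<open>n - 1\<close>, and \<open>b t\<close> the rate of jumps
  from \<open>n\<close> to \<open>n + 1\<close>, so \<open>J t n\<close> is the net flux across the edge from \<open>n\<close> to \<open>n + 1\<close>.\<close>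

definition dr :: "real \<Rightarrow> int \<Rightarrow> real" where "dr t n = (if n \<le> 0 then a t else 1)"

definition J :: "real \<Rightarrow> int \<Rightarrow> real" where
  "J t n = b t * p t n - dr t (n + 1) * p t (n + 1)"

lemma Q2_flux: "Q2 (p t) n = J t (n - 1) - J t n"
  unfolding Q2_def Let_def J_def dr_def a_def b_def r_def d_def by (auto simp: algebra_simps)

lemma p_nonneg: "t \<ge> t0 \<Longrightarrow> p t n \<ge> 0"
  and p_has_sum: "t \<ge> t0 \<Longrightarrow> (p t has_sum 1) UNIV"
  and p_deriv: "t \<ge> t0 \<Longrightarrow> ((\<lambda>s. p s n) has_real_derivative (J t (n - 1) - J t n)) (at t within {t0..})"
  using sol by (auto simp: phase2_solution_def prob_seq_def Q2_flux)

lemma p_summable: "t \<ge> t0 \<Longrightarrow> p t summable_on A"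
  using p_has_sum has_sum_imp_summable summable_on_subset by (metis subset_UNIV)

lemma p_infsum: "t \<ge> t0 \<Longrightarrow> infsum (p t) UNIV = 1"
  using p_has_sum infsumI by blast

lemma p_le_infsum: "t \<ge> t0 \<Longrightarrow> n \<in> A \<Longrightarrow> p t n \<le> infsum (p t) A"
  using finite_sum_le_infsum[OF p_summable, of t "{n}" A] p_nonneg by auto

lemma p_le_1: "t \<ge> t0 \<Longrightarrow> p t n \<le> 1"
  using p_le_infsum[of t n UNIV] p_infsum by simp

lemma r_nonneg: "t \<ge> t0 \<Longrightarrow> r t \<ge> 0" and d_nonneg: "t \<ge> t0 \<Longrightarrow> d t \<ge> 0"
  unfolding r_def d_def rich_def debt_def by (auto intro!: infsum_nonneg p_nonneg)

lemma R_infsum: "t \<ge> t0 \<Longrightarrow> infsum (p t) {0..} = r t + p t 0"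
proof -
  assume t: "t \<ge> t0"
  have "{0..} = {1..} \<union> {0::int}" by auto
  then show ?thesis
    using infsum_Un_disjoint[OF p_summable[OF t] p_summable[OF t], of "{1..}" "{0}"]
    by (simp add: r_def rich_def)
qed

lemma D_infsum: "t \<ge> t0 \<Longrightarrow> infsum (p t) {..0} = d t + p t 0"
proof -
  assume t: "t \<ge> t0"
  have "{..0} = {..-1} \<union> {0::int}" by auto
  then show ?thesis
    using infsum_Un_disjoint[OF p_summable[OF t] p_summable[OF t], of "{..-1}" "{0}"]
    by (simp add: d_def debt_def)
qed

lemma total: "t \<ge> t0 \<Longrightarrow> r t + p t 0 + d t = 1"
proof -
  assume t: "t \<ge> t0"
  have "UNIV = {0..} \<union> {..-1::int}" by auto
  moreover have "{0..} \<inter> {..-1::int} = {}" by auto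
  ultimately have "infsum (p t) UNIV = infsum (p t) {0..} + infsum (p t) {..-1}"
    using infsum_Un_disjoint[OF p_summable[OF t] p_summable[OF t], of "{0..}" "{..-1}"] by metis
  then show ?thesis using R_infsum[OF t] p_infsum[OF t] by (simp add: d_def debt_def)
qed

lemma b_bounds: "t \<ge> t0 \<Longrightarrow> 0 \<le> b t" "t \<ge> t0 \<Longrightarrow> b t \<le> 1"
  unfolding b_def by (rule ratio_bounds; simp add: r_nonneg p_nonneg)+

lemma a_bounds: assumes "t \<ge> t0" shows "0 \<le> a t" "a t \<le> b t" "a t \<le> 1"
proof -
  have *: "0 \<le> d t / (d t + p t 0)" "d t / (d t + p t 0) \<le> 1"
    using ratio_bounds[OF d_nonneg[OF assms] p_nonneg[OF assms]] by simp_all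
  show "0 \<le> a t" unfolding a_def by (rule mult_nonneg_nonneg[OF b_bounds(1)[OF assms] *(1)])
  show "a t \<le> b t" unfolding a_def
    using mult_left_mono[OF *(2) b_bounds(1)[OF assms]] by simp
  then show "a t \<le> 1" using b_bounds[OF assms] by linarith
qed

lemma dr_bounds: "t \<ge> t0 \<Longrightarrow> 0 \<le> dr t n" "t \<ge> t0 \<Longrightarrow> dr t n \<le> 1"
  using a_bounds by (auto simp: dr_def)

lemma rate_bounds:
  assumes "t \<ge> t0"
  shows "0 \<le> b t * p t m" "b t * p t m \<le> p t m" "0 \<le> dr t k * p t m" "dr t k * p t m \<le> p t m"
  using mult_right_mono[OF b_bounds(2)[OF assms] p_nonneg[OF assms, of m]]
    mult_right_mono[OF dr_bounds(2)[OF assms, of k] p_nonneg[OF assms, of m]]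
    b_bounds(1)[OF assms] dr_bounds(1)[OF assms, of k] p_nonneg[OF assms, of m]
  by auto

lemma J_abs: assumes "t \<ge> t0" shows "\<bar>J t n\<bar> \<le> p t n + p t (n + 1)"
  using rate_bounds[OF assms, of n] rate_bounds(3,4)[OF assms, of "n + 1" "n + 1"]
  unfolding J_def by linarith

lemma Q_bounds:
  assumes "t \<ge> t0"
  shows "J t (n - 1) - J t n \<ge> b t * p t (n - 1) + dr t (n + 1) * p t (n + 1) - 2 * p t n"
    and "J t (n - 1) - J t n \<le> p t (n - 1) + p t (n + 1)"
    and "\<bar>J t (n - 1) - J t n\<bar> \<le> p t (n - 1) + 2 * p t n + p t (n + 1)"
proof -
  note * = rate_bounds[OF assms]
  have J1: "J t (n - 1) = b t * p t (n - 1) - dr t n * p t n" by (simp add: J_def)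
  show "J t (n - 1) - J t n \<ge> b t * p t (n - 1) + dr t (n + 1) * p t (n + 1) - 2 * p t n"
    "J t (n - 1) - J t n \<le> p t (n - 1) + p t (n + 1)"
    unfolding J1 unfolding J_def
    using *(1,2)[of n] *(3,4)[of n n] *(2)[of "n-1"] *(4)[of "n + 1" "n + 1"] by linarith+
  show "\<bar>J t (n - 1) - J t n\<bar> \<le> p t (n - 1) + 2 * p t n + p t (n + 1)"
    using J_abs[OF assms, of n] J_abs[OF assms, of "n - 1"] by auto
qed

text \<open>Mass leaves a site at total rate at most 2, and the inflow is nonnegative.\<close>

lemma p_decay:
  assumes "t0 \<le> s" "s \<le> t"
  shows "p t n \<ge> exp (- 2 * (t - s)) * p s n"
proof (rule gronwall_deriv_lower[OF assms(2), where S = "{t0..}" and f' = "\<lambda>t. J t (n - 1) - J t n"])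
  fix x assume "s \<le> x" "x \<le> t"
  then have x: "x \<ge> t0" using assms by simp
  show "((\<lambda>s. p s n) has_real_derivative J x (n - 1) - J x n) (at x within {t0..})"
    by (rule p_deriv[OF x])
  show "- 2 * p x n \<le> J x (n - 1) - J x n"
    using Q_bounds(1)[OF x, of n] rate_bounds(1)[OF x, of "n - 1"] rate_bounds(3)[OF x, of "n + 1" "n + 1"]
    by linarith
qed (use assms in auto)

text \<open>As every rate is at most one, mass decays at most exponentially; hence the profile at the
  final time dominates the whole trajectory and is a summable majorant.\<close>

lemma p_majorant:
  assumes "t0 \<le> t" "t \<le> T"
  shows "p t n \<le> exp (2 * (T - t0)) * p T n"
proof -
  have "exp (2 * (T - t)) * (exp (- 2 * (T - t)) * p t n) \<le> exp (2 * (T - t)) * p T n"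
    using p_decay[OF assms] by simp
  then have "p t n \<le> exp (2 * (T - t)) * p T n"
    unfolding mult.assoc[symmetric] mult_exp_exp by simp
  also have "\<dots> \<le> exp (2 * (T - t0)) * p T n"
    by (rule mult_right_mono) (use assms p_nonneg[of T n] in simp_all)
  finally show ?thesis .
qed

section \<open>Weighted sums along the flow and propagation of moments\<close>

lemma weighted_summable:
  assumes "\<And>n. \<bar>w n\<bar> \<le> W n" "t0 \<le> t" "(\<lambda>n. W n * p t n) summable_on UNIV"
  shows "(\<lambda>n. w n * p t n) summable_on UNIV"
  by (rule summable_on_dominated[OF assms(3)])
    (use assms p_nonneg in \<open>auto simp: abs_mult intro!: mult_right_mono\<close>)

text \<open>The profile at the later time \<open>t + 1\<close> dominates the trajectory up to then,
  so summability at that single time yields the majorant for differentiating under the sum. The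
  weight \<open>w\<close> may change sign; its bound \<open>W\<close> is the tame one.\<close>

lemma weighted_sum_deriv_raw:
  assumes "tame K W" "\<And>n. \<bar>w n\<bar> \<le> W n" "t0 \<le> t"
    and "(\<lambda>n. W n * p (t + 1) n) summable_on UNIV"
  shows "((\<lambda>s. \<Sum>\<^sub>\<infinity>n. w n * p s n) has_real_derivative (\<Sum>\<^sub>\<infinity>n. w n * (J t (n - 1) - J t n)))
    (at t within {t0..})"
proof -
  define C where "C = exp (2 * (t + 1 - t0))"
  define q where "q n = C * p (t + 1) n" for n
  define M where "M n = W n * q (n - 1) + 2 * (W n * q n) + W n * q (n + 1)" for n
  have q0: "q n \<ge> 0" for n using assms p_nonneg by (simp add: q_def C_def)
  have sq: "(\<lambda>n. W n * q n) summable_on UNIV"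
    using summable_on_cmult_right[OF assms(4), of C] by (simp add: q_def mult.left_commute)
  have M: "M summable_on UNIV" unfolding M_def
    by (intro summable_on_add summable_on_cmult_right sq shifted_weight_summable[OF assms(1) q0])
  have pq: "p s n \<le> q n" if "t0 \<le> s" "s \<le> t + 1" for s n
    using p_majorant[OF that] by (simp add: q_def C_def)
  have W0: "W n \<ge> 0" for n using assms(1) unfolding tame_def by blast
  show ?thesis
  proof (rule has_real_derivative_infsum[where M = M and \<beta> = "t + 1", OF _ _ M _ assms(3)])
    fix s n assume s: "t0 \<le> s" "s \<le> t + 1"
    have "\<bar>w n * (J s (n - 1) - J s n)\<bar> \<le> W n * (p s (n - 1) + 2 * p s n + p s (n + 1))"
      unfolding abs_mult by (intro mult_mono assms(2) Q_bounds(3) s W0) auto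
    also have "\<dots> \<le> W n * (q (n - 1) + 2 * q n + q (n + 1))"
      using pq[OF s] by (intro mult_left_mono add_mono W0) auto
    finally show "\<bar>w n * (J s (n - 1) - J s n)\<bar> \<le> M n"
      by (simp add: M_def algebra_simps)
  next
    fix s assume s: "t0 \<le> s" "s \<le> t + 1"
    show "(\<lambda>n. w n * p s n) summable_on UNIV"
      by (rule summable_on_dominated[OF sq], unfold abs_mult, rule mult_mono)
        (use assms(2) W0 pq[OF s] p_nonneg[OF s(1)] in auto)
  qed (auto intro!: derivative_eq_intros p_deriv)
qed

lemma weighted_sum_by_parts:
  assumes "tame K W" "\<And>n. \<bar>w n\<bar> \<le> W n" "t0 \<le> t" "(\<lambda>n. W n * p t n) summable_on UNIV"
  shows "(\<Sum>\<^sub>\<infinity>n. w n * (J t (n - 1) - J t n)) = (\<Sum>\<^sub>\<infinity>n. (w (n + 1) - w n) * J t n)"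
    and "(\<lambda>n. w n * (J t (n - 1) - J t n)) summable_on UNIV"
    and "(\<lambda>n. w n * J t n) summable_on UNIV"
    and "(\<lambda>n. w (n + 1) * J t n) summable_on UNIV"
proof -
  have W0: "W n \<ge> 0" for n using assms(1) unfolding tame_def by blast
  note sh = shifted_weight_summable[OF assms(1) p_nonneg[OF assms(3)] assms(4)]
  show 1: "(\<lambda>n. w n * J t n) summable_on UNIV"
  proof (rule summable_on_dominated[OF summable_on_add[OF assms(4) sh(2)]])
    fix n
    have "\<bar>w n * J t n\<bar> \<le> W n * (p t n + p t (n + 1))"
      unfolding abs_mult by (intro mult_mono assms J_abs W0) auto
    then show "\<bar>w n * J t n\<bar> \<le> W n * p t n + W n * p t (n + 1)" by (simp add: algebra_simps)
  qed
  have 2: "(\<lambda>n. w n * J t (n - 1)) summable_on UNIV"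
  proof (rule summable_on_dominated[OF summable_on_add[OF assms(4) sh(1)]])
    fix n
    have "\<bar>w n * J t (n - 1)\<bar> \<le> W n * (p t (n - 1) + p t n)"
      unfolding abs_mult using J_abs[OF assms(3), of "n - 1"] by (intro mult_mono assms W0) auto
    then show "\<bar>w n * J t (n - 1)\<bar> \<le> W n * p t n + W n * p t (n - 1)" by (simp add: algebra_simps)
  qed
  show 3: "(\<lambda>n. w (n + 1) * J t n) summable_on UNIV"
    using summable_on_int_shift(1)[OF 2, of 1] by simp
  have eq: "(\<Sum>\<^sub>\<infinity>n. w (n + 1) * J t n) = (\<Sum>\<^sub>\<infinity>n. w n * J t (n - 1))"
    using infsum_int_shift[of "\<lambda>n. w n * J t (n - 1)" 1] by simp
  show "(\<lambda>n. w n * (J t (n - 1) - J t n)) summable_on UNIV"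
    using summable_on_real_diff[OF 2 1] by (simp add: algebra_simps)
  show "(\<Sum>\<^sub>\<infinity>n. w n * (J t (n - 1) - J t n)) = (\<Sum>\<^sub>\<infinity>n. (w (n + 1) - w n) * J t n)"
    using infsum_real_diff[OF 2 1] infsum_real_diff[OF 3 1] eq by (simp add: algebra_simps)
qed

text \<open>Truncated weights have finite sums from the outset, so Gronwall applies to them. The
  rate \<open>2 * K\<close>, one \<open>K\<close> for each neighbour feeding a site, is free of the
  truncation level, and a finite partial sum does not see a sufficiently high truncation.\<close>

lemma moment_propagation:
  assumes W: "tame K W" and s0: "(\<lambda>n. W n * p t0 n) summable_on UNIV" and t: "t0 \<le> t"
  shows "(\<lambda>n. W n * p t n) summable_on UNIV"
proof (rule nonneg_bdd_above_summable_on)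
  have W0: "W n \<ge> 0" for n using W unfolding tame_def by blast
  define B where "B = exp (2 * K * (t - t0)) * (\<Sum>\<^sub>\<infinity>n. W n * p t0 n)"
  have trunc: "(\<Sum>\<^sub>\<infinity>n. min (W n) N * p t n) \<le> B" and truncs: "(\<lambda>n. min (W n) N * p t n) summable_on UNIV"
    if N: "N \<ge> 0" for N
  proof -
    define w where "w n = min (W n) N" for n
    have tw: "tame K w" unfolding w_def by (rule tame_min[OF W N])
    have w0: "0 \<le> w n" "\<bar>w n\<bar> \<le> N" "w n \<le> W n" for n using W0 N by (auto simp: w_def)
    have ts: "(\<lambda>n. N * p s n) summable_on UNIV" if "t0 \<le> s" for s
      by (intro summable_on_cmult_right p_summable that)
    have ws: "(\<lambda>n. w n * p s n) summable_on UNIV" if "t0 \<le> s" for s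
      by (rule weighted_summable[OF w0(2) that ts[OF that]])
    have "(\<Sum>\<^sub>\<infinity>n. w n * p t n) \<le> exp (2 * K * (t - t0)) * (\<Sum>\<^sub>\<infinity>n. w n * p t0 n)"
    proof (rule gronwall_deriv[OF t, where S = "{t0..}" and f' = "\<lambda>s. \<Sum>\<^sub>\<infinity>n. w n * (J s (n - 1) - J s n)"])
      fix s assume "t0 \<le> s" "s \<le> t"
      then have s: "t0 \<le> s" by simp
      show "((\<lambda>s. \<Sum>\<^sub>\<infinity>n. w n * p s n) has_real_derivative (\<Sum>\<^sub>\<infinity>n. w n * (J s (n - 1) - J s n)))
        (at s within {t0..})"
        by (rule weighted_sum_deriv_raw[OF tame_const[OF N] w0(2) s ts]) (use s in auto)
      note sh = shifted_weight_summable[OF tw p_nonneg[OF s] ws[OF s]]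
      have "(\<Sum>\<^sub>\<infinity>n. w n * (J s (n - 1) - J s n)) \<le> (\<Sum>\<^sub>\<infinity>n. w n * p s (n - 1) + w n * p s (n + 1))"
      proof (rule infsum_mono)
        show "(\<lambda>n. w n * (J s (n - 1) - J s n)) summable_on UNIV"
          by (rule weighted_sum_by_parts(2)[OF tame_const[OF N] w0(2) s ts[OF s]])
        show "(\<lambda>n. w n * p s (n - 1) + w n * p s (n + 1)) summable_on UNIV"
          by (intro summable_on_add sh)
        show "w n * (J s (n - 1) - J s n) \<le> w n * p s (n - 1) + w n * p s (n + 1)" for n
          using mult_left_mono[OF Q_bounds(2)[OF s] w0(1)] by (simp add: distrib_left)
      qed
      also have "\<dots> \<le> 2 * K * (\<Sum>\<^sub>\<infinity>n. w n * p s n)"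
        using infsum_add[OF sh(1,2)] sh(3,4) by simp
      finally show "(\<Sum>\<^sub>\<infinity>n. w n * (J s (n - 1) - J s n)) \<le> 2 * K * (\<Sum>\<^sub>\<infinity>n. w n * p s n)" .
    qed auto
    also have "\<dots> \<le> B" unfolding B_def
      by (intro mult_left_mono infsum_mono ws s0) (use w0 p_nonneg in \<open>auto intro!: mult_right_mono\<close>)
    finally show "(\<Sum>\<^sub>\<infinity>n. min (W n) N * p t n) \<le> B" by (simp add: w_def)
    show "(\<lambda>n. min (W n) N * p t n) summable_on UNIV" using ws[OF t] by (simp add: w_def)
  qed
  show "bdd_above (sum (\<lambda>n. W n * p t n) ` {F. F \<subseteq> UNIV \<and> finite F})"
  proof (rule bdd_aboveI2)
    fix F :: "int set" assume "F \<in> {F. F \<subseteq> UNIV \<and> finite F}"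
    then have F: "finite F" by simp
    \<comment> \<open>As the weights are nonnegative, their sum is a level that truncation at sites
      of \<open>F\<close> does not touch.\<close>
    define N where "N = sum W F"
    have N: "N \<ge> 0" "\<And>n. n \<in> F \<Longrightarrow> W n \<le> N"
      using F W0 by (auto simp: N_def intro: sum_nonneg member_le_sum)
    have "(\<Sum>n\<in>F. W n * p t n) = (\<Sum>n\<in>F. min (W n) N * p t n)"
      using N by (intro sum.cong) auto
    also have "\<dots> \<le> (\<Sum>\<^sub>\<infinity>n. min (W n) N * p t n)"
      by (rule finite_sum_le_infsum[OF truncs[OF N(1)] F]) (use W0 N p_nonneg t in auto)
    also have "\<dots> \<le> B" by (rule trunc[OF N(1)])
    finally show "(\<Sum>n\<in>F. W n * p t n) \<le> B" .
  qed
qed (use W t p_nonneg in \<open>simp add: tame_def\<close>)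

lemma weighted_sum_deriv:
  assumes "tame K W" "\<And>n. \<bar>w n\<bar> \<le> W n" "t0 \<le> t" "(\<lambda>n. W n * p t0 n) summable_on UNIV"
  shows "((\<lambda>s. \<Sum>\<^sub>\<infinity>n. w n * p s n) has_real_derivative (\<Sum>\<^sub>\<infinity>n. (w (n + 1) - w n) * J t n))
    (at t within {t0..})"
  using weighted_sum_deriv_raw[OF assms(1-3) moment_propagation[OF assms(1,4)]]
    weighted_sum_by_parts(1)[OF assms(1-3) moment_propagation[OF assms(1,4,3)]] assms(3)
  by simp

lemma bounded_sum_deriv:
  assumes "\<And>n. \<bar>w n\<bar> \<le> C" "t0 \<le> t"
  shows "((\<lambda>s. \<Sum>\<^sub>\<infinity>n. w n * p s n) has_real_derivative (\<Sum>\<^sub>\<infinity>n. (w (n + 1) - w n) * J t n))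
    (at t within {t0..})"
proof -
  have C: "C \<ge> 0" using assms(1)[of 0] by linarith
  show ?thesis
    by (rule weighted_sum_deriv[OF tame_const[OF C] assms])
      (intro summable_on_cmult_right p_summable order_refl)
qed

end

section \<open>Positivity and conserved moments\<close>

lemma infsum_single:
  fixes f :: "'a \<Rightarrow> real"
  assumes "\<And>n. n \<noteq> k \<Longrightarrow> f n = 0"
  shows "infsum f UNIV = f k"
proof -
  have "infsum f UNIV = infsum f {k}"
    by (rule infsum_cong_neutral) (use assms in auto)
  then show ?thesis by simp
qed

lemma infsum_indicator_mult:
  fixes f :: "'a \<Rightarrow> real"
  shows "(\<Sum>\<^sub>\<infinity>n. (if n \<in> A then 1 else 0) * f n) = infsum f A"
    and "(\<lambda>n. (if n \<in> A then 1 else 0) * f n) summable_on UNIV \<longleftrightarrow> f summable_on A"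
  by (rule infsum_cong_neutral; auto) (rule summable_on_cong_neutral; auto)

lemma tame_scale:
  assumes "tame K W" "c \<ge> 0"
  shows "tame K (\<lambda>n. c * W n)"
  unfolding tame_def
proof (intro conjI allI)
  fix n
  have W: "K \<ge> 1" "0 \<le> W n" "W (n + 1) \<le> K * W n" "W (n - 1) \<le> K * W n"
    using assms(1) unfolding tame_def by blast+
  show "K \<ge> 1" by (rule W)
  show "0 \<le> c * W n" using W(2) assms(2) by simp
  show "c * W (n + 1) \<le> K * (c * W n)" "c * W (n - 1) \<le> K * (c * W n)"
    using mult_left_mono[OF W(3) assms(2)] mult_left_mono[OF W(4) assms(2)]
    by (simp_all add: mult.left_commute)
qed

context phase2
begin

text \<open>Without mass above the origin the mean would be at most 0; without mass below it the
  debt would vanish.\<close>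

lemma ex_rich: "\<exists>n\<ge>1. p t0 n > 0" and ex_debt: "\<exists>n\<le>-1. p t0 n > 0"
proof -
  have p0: "p t0 n \<ge> 0" for n by (rule p_nonneg) simp
  have s1: "((\<lambda>n. of_int n * p t0 n) has_sum \<mu>) UNIV"
    and s2: "((\<lambda>n. - (of_int n * p t0 n)) has_sum (\<mu> * \<nu>)) {..0}"
    using init by (auto simp: wealth_class_def)
  show "\<exists>n\<ge>1. p t0 n > 0"
  proof (rule ccontr)
    assume "\<not> ?thesis"
    then have "p t0 n = 0" if "n \<ge> 1" for n using p0[of n] that by force
    then have neg: "0 \<le> - (of_int n * p t0 n)" for n
      using p0[of n] by (cases "n \<ge> 1") (auto simp: mult_le_0_iff)
    have "0 \<le> - \<mu>" by (rule has_sum_nonneg[OF has_sum_uminusI[OF s1] neg])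
    then show False using mu_pos by simp
  qed
  show "\<exists>n\<le>-1. p t0 n > 0"
  proof (rule ccontr)
    assume "\<not> ?thesis"
    then have "p t0 n = 0" if "n \<le> -1" for n using p0[of n] that by force
    then have "- (of_int n * p t0 n) = 0" if "n \<in> {..0}" for n
      using that by (cases "n = 0") auto
    then have "((\<lambda>n. - (of_int n * p t0 n)) has_sum 0) {..0}" by (rule has_sum_0)
    then have "\<mu> * \<nu> = 0" using s2 has_sum_unique by blast
    then show False using mu_pos nu_pos by simp
  qed
qed

lemma r_pos: "t \<ge> t0 \<Longrightarrow> r t > 0" and d_pos: "t \<ge> t0 \<Longrightarrow> d t > 0"
proof -
  assume t: "t \<ge> t0"
  have *: "p t n > 0" if "p t0 n > 0" for n
    using p_decay[OF order_refl t, of n] that by (smt (verit) exp_gt_zero mult_pos_pos)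
  obtain n m where "n \<ge> 1" "p t0 n > 0" "m \<le> -1" "p t0 m > 0" using ex_rich ex_debt by blast
  then show "r t > 0" "d t > 0"
    using p_le_infsum[OF t, of n "{1..}"] p_le_infsum[OF t, of m "{..-1}"] *[of n] *[of m]
    by (auto simp: r_def rich_def d_def debt_def)
qed

lemma R_pos: "t \<ge> t0 \<Longrightarrow> r t + p t 0 > 0" and D_pos: "t \<ge> t0 \<Longrightarrow> d t + p t 0 > 0"
  using r_pos[of t] d_pos[of t] p_nonneg[of t 0] by auto

lemma b_pos: "t \<ge> t0 \<Longrightarrow> b t > 0" and a_pos: "t \<ge> t0 \<Longrightarrow> a t > 0"
  using r_pos[of t] d_pos[of t] R_pos[of t] D_pos[of t] by (auto simp: a_def b_def)

lemma dr_pos: "t \<ge> t0 \<Longrightarrow> dr t n > 0"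
  using a_pos by (auto simp: dr_def)

lemma b_ge_r: assumes "t \<ge> t0" shows "b t \<ge> r t"
proof -
  have "r t * (r t + p t 0) \<le> r t * 1"
    using total[OF assms] d_pos[OF assms] r_pos[OF assms] by (intro mult_left_mono) auto
  then show ?thesis using R_pos[OF assms] by (simp add: b_def pos_le_divide_eq)
qed

lemma a_ge: assumes "t \<ge> t0" shows "a t \<ge> r t * d t"
proof -
  have "d t * (d t + p t 0) \<le> d t * 1"
    using total[OF assms] d_pos[OF assms] r_pos[OF assms] by (intro mult_left_mono) auto
  then have "d t \<le> d t / (d t + p t 0)" using D_pos[OF assms] by (simp add: pos_le_divide_eq)
  then show ?thesis unfolding a_def
    using b_ge_r[OF assms] r_pos[OF assms] d_pos[OF assms] by (intro mult_mono) auto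
qed

text \<open>A zero at time \<open>t\<close> propagates backwards by \<open>p_decay\<close>, so the
  mass at \<open>m\<close> vanishes on a whole time interval. Its derivative then vanishes somewhere
  in it, which contradicts the inflow from the positive neighbour.\<close>

lemma p_pos_step:
  assumes "\<And>t. t > t0 \<Longrightarrow> p t n > 0" "t > t0" "m = n + 1 \<or> m = n - 1"
  shows "p t m > 0"
proof (rule ccontr)
  assume "\<not> p t m > 0"
  then have z: "p t m = 0" using p_nonneg[of t m] assms(2) by force
  define s where "s = (t0 + t) / 2"
  have s: "t0 < s" "s < t" using assms(2) by (auto simp: s_def)
  have zero: "p u m = 0" if "s \<le> u" "u \<le> t" for u
  proof -
    have "exp (- 2 * (t - u)) * p u m \<le> 0" using p_decay[of u t m] z that s by auto
    then show ?thesis using p_nonneg[of u m] that s by (auto simp: mult_le_0_iff)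
  qed
  have "\<exists>x\<in>{s..t}. p t m - p s m = (*) (J x (m - 1) - J x m) (t - s)"
  proof (rule mvt_very_simple)
    fix x assume "s \<le> x" "x \<le> t"
    then show "((\<lambda>u. p u m) has_derivative (*) (J x (m - 1) - J x m)) (at x within {s..t})"
      using p_deriv[of x m] s by (auto simp: has_field_derivative_def intro: has_derivative_subset)
  qed (use s in auto)
  then obtain x where x: "s \<le> x" "x \<le> t" "0 = (J x (m - 1) - J x m) * (t - s)"
    using zero[of s] zero[of t] s by auto
  then have Q0: "J x (m - 1) - J x m = 0" and xt: "x > t0" using s by auto
  have "b x * p x (m - 1) + dr x (m + 1) * p x (m + 1) > 0"
    using assms(3)
  proof
    assume "m = n + 1"
    then have "b x * p x (m - 1) > 0" using assms(1)[OF xt] b_pos xt by auto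
    then show ?thesis using rate_bounds(3)[of x "m + 1" "m + 1"] xt by auto
  next
    assume "m = n - 1"
    then have "dr x (m + 1) * p x (m + 1) > 0" using assms(1)[OF xt] dr_pos xt by auto
    then show ?thesis using rate_bounds(1)[of x "m - 1"] xt by auto
  qed
  then show False using Q_bounds(1)[of x m] Q0 zero[of x] x xt by auto
qed

text \<open>Positivity spreads instantly from one occupied site in both directions. This is why the
  step lemma assumes positivity of the neighbour at every time after \<open>t0\<close>, not only at
  \<open>t\<close>.\<close>

lemma p_pos: assumes "t > t0" shows "p t n > 0"
proof -
  obtain m where m: "p t0 m > 0" using ex_rich by blast
  have pm: "p t m > 0" if "t > t0" for t
    using p_decay[of t0 t m] m that by (smt (verit) exp_gt_zero mult_pos_pos)
  have "\<forall>t>t0. p t n > 0"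
  proof (induction n rule: int_induct[where k = m])
    case base
    show ?case using pm by simp
  next
    case (step1 i)
    show ?case
    proof (intro allI impI)
      fix t assume "t0 < t"
      then show "p t (i + 1) > 0" by (rule p_pos_step[of i, rotated]) (use step1 in auto)
    qed
  next
    case (step2 i)
    show ?case
    proof (intro allI impI)
      fix t assume "t0 < t"
      then show "p t (i - 1) > 0" by (rule p_pos_step[of i, rotated]) (use step2 in auto)
    qed
  qed
  then show ?thesis using assms by blast
qed

section \<open>Vanishing flux sums and conserved first moments\<close>

lemma J_summable: "t \<ge> t0 \<Longrightarrow> J t summable_on A"
proof -
  assume t: "t \<ge> t0"
  have "(\<lambda>n. p t n + p t (n + 1)) summable_on UNIV"
    using t by (intro summable_on_add p_summable summable_on_int_shift(1)) auto
  then show ?thesis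
    using summable_on_dominated[of _ UNIV "J t"] J_abs[OF t] summable_on_subset[of "J t" UNIV A] by auto
qed

text \<open>The upward jumps across these edges add up to \<open>b * (r + p 0)\<close> and the
  downward ones to \<open>r\<close>; the rate \<open>b\<close> is normalised to make the two
  equal.\<close>

lemma J_sum_pos: assumes t: "t \<ge> t0" shows "infsum (J t) {0..} = 0"
proof -
  have "(\<Sum>\<^sub>\<infinity>n\<in>{0..}. p t (n + 1)) = infsum (p t) {1..}"
    by (rule infsum_reindex_bij_witness[where i = "\<lambda>n. n - 1" and j = "\<lambda>n. n + 1"]) auto
  moreover have "(\<lambda>n. p t (n + 1)) summable_on {0..}"
    using summable_on_int_shift(1)[OF p_summable[OF t], of 1] summable_on_subset by blast
  moreover have "infsum (J t) {0..} = (\<Sum>\<^sub>\<infinity>n\<in>{0..}. b t * p t n - p t (n + 1))"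
    by (rule infsum_cong) (auto simp: J_def dr_def)
  ultimately have "infsum (J t) {0..} = b t * (r t + p t 0) - r t"
    by (simp add: infsum_real_diff p_summable[OF t] summable_on_cmult_right infsum_cmult_right'
        R_infsum[OF t] r_def rich_def)
  then show ?thesis using R_pos[OF t] by (simp add: b_def)
qed

text \<open>Here the balance is \<open>b * d = a * (d + p 0)\<close>, which is the normalisation of
  \<open>a\<close>.\<close>

lemma J_sum_neg: assumes t: "t \<ge> t0" shows "infsum (J t) {..-1} = 0"
proof -
  have "(\<Sum>\<^sub>\<infinity>n\<in>{..-1}. p t (n + 1)) = infsum (p t) {..0}"
    by (rule infsum_reindex_bij_witness[where i = "\<lambda>n. n - 1" and j = "\<lambda>n. n + 1"]) auto
  moreover have "(\<lambda>n. p t (n + 1)) summable_on {..-1}"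
    using summable_on_int_shift(1)[OF p_summable[OF t], of 1] summable_on_subset by blast
  moreover have "infsum (J t) {..-1} = (\<Sum>\<^sub>\<infinity>n\<in>{..-1}. b t * p t n - a t * p t (n + 1))"
    by (rule infsum_cong) (auto simp: J_def dr_def)
  ultimately have "infsum (J t) {..-1} = b t * d t - a t * (d t + p t 0)"
    by (simp add: infsum_real_diff p_summable[OF t] summable_on_cmult_right infsum_cmult_right'
        D_infsum[OF t] d_def debt_def)
  then show ?thesis using D_pos[OF t] by (simp add: a_def)
qed

lemma r_deriv: assumes t: "t \<ge> t0" shows "(r has_real_derivative J t 0) (at t within {t0..})"
proof -
  let ?w = "\<lambda>n::int. (if n \<in> {1..} then 1 else 0::real)"
  have "((\<lambda>s. \<Sum>\<^sub>\<infinity>n. ?w n * p s n) has_real_derivative (\<Sum>\<^sub>\<infinity>n. (?w (n + 1) - ?w n) * J t n)) (at t within {t0..})"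
    by (rule bounded_sum_deriv[where C = 1]) (use t in auto)
  moreover have "(\<lambda>s. \<Sum>\<^sub>\<infinity>n. ?w n * p s n) = r"
    unfolding infsum_indicator_mult by (simp add: fun_eq_iff r_def rich_def)
  moreover have "(\<Sum>\<^sub>\<infinity>n. (?w (n + 1) - ?w n) * J t n) = J t 0"
    by (subst infsum_single[where k = 0]) auto
  ultimately show ?thesis by simp
qed

lemma d_deriv: assumes t: "t \<ge> t0" shows "(d has_real_derivative - J t (-1)) (at t within {t0..})"
proof -
  let ?w = "\<lambda>n::int. (if n \<in> {..-1} then 1 else 0::real)"
  have "((\<lambda>s. \<Sum>\<^sub>\<infinity>n. ?w n * p s n) has_real_derivative (\<Sum>\<^sub>\<infinity>n. (?w (n + 1) - ?w n) * J t n)) (at t within {t0..})"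
    by (rule bounded_sum_deriv[where C = 1]) (use t in auto)
  moreover have "(\<lambda>s. \<Sum>\<^sub>\<infinity>n. ?w n * p s n) = d"
    unfolding infsum_indicator_mult by (simp add: fun_eq_iff d_def debt_def)
  moreover have "(\<Sum>\<^sub>\<infinity>n. (?w (n + 1) - ?w n) * J t n) = - J t (-1)"
    by (subst infsum_single[where k = "-1"]) auto
  ultimately show ?thesis by simp
qed

lemma first_moment_init: "(\<lambda>n. (1 + real_of_int \<bar>n\<bar>) * p t0 n) summable_on UNIV"
proof -
  have "((\<lambda>n. of_int n * p t0 n) has_sum \<mu>) UNIV"
    using init by (simp add: wealth_class_def)
  then have "(\<lambda>n. of_int n * p t0 n) summable_on UNIV" by (rule has_sum_imp_summable)
  then have "(\<lambda>n. norm (of_int n * p t0 n)) summable_on UNIV"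
    by (rule summable_on_iff_abs_summable_on_real[THEN iffD1])
  then have "(\<lambda>n. p t0 n + norm (of_int n * p t0 n)) summable_on UNIV"
    by (intro summable_on_add p_summable) auto
  then show ?thesis by (simp add: abs_mult p_nonneg distrib_right)
qed

lemma first_moment: "t \<ge> t0 \<Longrightarrow> (\<lambda>n. (1 + real_of_int \<bar>n\<bar>) * p t n) summable_on UNIV"
  by (rule moment_propagation[OF tame_linear first_moment_init])

lemma constant_on_half_line:
  fixes f :: "real \<Rightarrow> real"
  assumes "\<And>t. t \<ge> t0 \<Longrightarrow> (f has_real_derivative 0) (at t within {t0..})" "t \<ge> t0"
  shows "f t = f t0"
  using has_derivative_within_bound[of t0 t f "\<lambda>_. 0" "{t0..}" 0] assms by auto

lemma weighted_moment_deriv: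
  assumes "\<And>n. \<bar>w n\<bar> \<le> C * (1 + real_of_int \<bar>n\<bar>)" "t0 \<le> t"
  shows "((\<lambda>s. \<Sum>\<^sub>\<infinity>n. w n * p s n) has_real_derivative (\<Sum>\<^sub>\<infinity>n. (w (n + 1) - w n) * J t n))
    (at t within {t0..})"
proof (rule weighted_sum_deriv[OF _ assms])
  have "C \<ge> 0" using assms(1)[of 0] by simp
  then show "tame 2 (\<lambda>n. C * (1 + real_of_int \<bar>n\<bar>))"
    by (rule tame_scale[OF tame_linear])
  show "(\<lambda>n. C * (1 + real_of_int \<bar>n\<bar>) * p t0 n) summable_on UNIV"
    using summable_on_cmult_right[OF first_moment_init, of C] by (simp add: mult.assoc)
qed

text \<open>Such \<open>w\<close> are the discrete slopes of functions that are affine on each half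
  line. This covers both conserved moments and the logarithm of \<open>p_star\<close>.\<close>

lemma flux_weight_split:
  assumes "t \<ge> t0" "\<And>n. n \<ge> 0 \<Longrightarrow> w n = x" "\<And>n. n < 0 \<Longrightarrow> w n = y"
  shows "(\<Sum>\<^sub>\<infinity>n. w n * J t n) = 0"
proof -
  have U: "UNIV = {0..} \<union> {..-1::int}" "{0..} \<inter> {..-1::int} = {}" by auto
  have s: "(\<lambda>n. x * J t n) summable_on {0..}" "(\<lambda>n. y * J t n) summable_on {..-1}"
    by (intro summable_on_cmult_right J_summable assms(1))+
  have e: "(\<lambda>n. w n * J t n) summable_on {0..} \<longleftrightarrow> (\<lambda>n. x * J t n) summable_on {0..}"
    "(\<lambda>n. w n * J t n) summable_on {..-1} \<longleftrightarrow> (\<lambda>n. y * J t n) summable_on {..-1}"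
    by (rule summable_on_cong; use assms in auto)+
  have "(\<Sum>\<^sub>\<infinity>n. w n * J t n) = (\<Sum>\<^sub>\<infinity>n\<in>{0..}. w n * J t n) + (\<Sum>\<^sub>\<infinity>n\<in>{..-1}. w n * J t n)"
    unfolding U(1) by (rule infsum_Un_disjoint[OF e(1)[THEN iffD2, OF s(1)] e(2)[THEN iffD2, OF s(2)] U(2)])
  also have "(\<Sum>\<^sub>\<infinity>n\<in>{0..}. w n * J t n) = (\<Sum>\<^sub>\<infinity>n\<in>{0..}. x * J t n)"
    by (rule infsum_cong) (use assms in auto)
  also have "\<dots> = 0" using J_sum_pos[OF assms(1)] by (simp add: infsum_cmult_right')
  also have "(\<Sum>\<^sub>\<infinity>n\<in>{..-1}. w n * J t n) = (\<Sum>\<^sub>\<infinity>n\<in>{..-1}. y * J t n)"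
    by (rule infsum_cong) (use assms in auto)
  also have "\<dots> = 0" using J_sum_neg[OF assms(1)] by (simp add: infsum_cmult_right')
  finally show ?thesis by simp
qed

text \<open>The conserved first moments of the positive and the negative part of \<open>p\<close>;
  the mean \<mu> is their difference.\<close>

definition mplus :: real where "mplus = \<mu> * (1 + \<nu>)"
definition mminus :: real where "mminus = \<mu> * \<nu>"

text \<open>The positive part of \<open>n\<close> has slope 1 on the edges \<open>n \<ge> 0\<close>
  and 0 elsewhere, so its moment changes at the rate of the flux sum over that half line, which is
  0. The negative part is treated alike.\<close>

lemma moments:
  assumes "t \<ge> t0"
  shows "(\<Sum>\<^sub>\<infinity>n. of_int (max n 0) * p t n) = mplus"
    and "(\<Sum>\<^sub>\<infinity>n. of_int (max (- n) 0) * p t n) = mminus"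
proof -
  have s1: "((\<lambda>n. of_int n * p t0 n) has_sum \<mu>) UNIV"
    and s2: "((\<lambda>n. - (of_int n * p t0 n)) has_sum (\<mu> * \<nu>)) {..0}"
    using init by (auto simp: wealth_class_def)
  have s3: "((\<lambda>n. of_int (max (- n) 0) * p t0 n) has_sum (\<mu> * \<nu>)) UNIV"
    by (subst has_sum_cong_neutral[where T = "{..0}" and g = "\<lambda>n. - (of_int n * p t0 n)"])
      (use s2 in \<open>auto simp: max_def\<close>)
  have s4: "((\<lambda>n. of_int (max n 0) * p t0 n) has_sum (\<mu> + \<mu> * \<nu>)) UNIV"
  proof (rule has_sum_cong[THEN iffD1, OF _ has_sum_add[OF s1 s3]])
    show "of_int x * p t0 x + of_int (max (- x) 0) * p t0 x = of_int (max x 0) * p t0 x" for x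
      by (cases "x \<ge> 0") (auto simp: max_def)
  qed
  have "(\<Sum>\<^sub>\<infinity>n. of_int (max n 0) * p t n) = (\<Sum>\<^sub>\<infinity>n. of_int (max n 0) * p t0 n)"
  proof (rule constant_on_half_line[OF _ assms])
    fix t assume t: "t0 \<le> t"
    have z: "(\<Sum>\<^sub>\<infinity>n. (of_int (max (n + 1) 0) - of_int (max n 0)) * J t n) = 0"
      by (rule flux_weight_split[OF t, of _ 1 0]) (auto simp: max_def)
    show "((\<lambda>a. \<Sum>\<^sub>\<infinity>n. of_int (max n 0) * p a n) has_real_derivative 0) (at t within {t0..})"
      using weighted_moment_deriv[of "\<lambda>n. of_int (max n 0)" 1, OF _ t] unfolding z by auto
  qed
  then show "(\<Sum>\<^sub>\<infinity>n. of_int (max n 0) * p t n) = mplus"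
    using infsumI[OF s4] by (simp add: mplus_def algebra_simps)
  have "(\<Sum>\<^sub>\<infinity>n. of_int (max (- n) 0) * p t n) = (\<Sum>\<^sub>\<infinity>n. of_int (max (- n) 0) * p t0 n)"
  proof (rule constant_on_half_line[OF _ assms])
    fix t assume t: "t0 \<le> t"
    have z: "(\<Sum>\<^sub>\<infinity>n. (of_int (max (- (n + 1)) 0) - of_int (max (- n) 0)) * J t n) = 0"
      by (rule flux_weight_split[OF t, of _ 0 "-1"]) (auto simp: max_def)
    show "((\<lambda>a. \<Sum>\<^sub>\<infinity>n. of_int (max (- n) 0) * p a n) has_real_derivative 0) (at t within {t0..})"
      using weighted_moment_deriv[of "\<lambda>n. of_int (max (- n) 0)" 1, OF _ t] unfolding z by auto
  qed
  then show "(\<Sum>\<^sub>\<infinity>n. of_int (max (- n) 0) * p t n) = mminus"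
    using infsumI[OF s3] by (simp add: mminus_def)
qed

end

section \<open>The logarithmic gap\<close>

text \<open>The integrand of the symmetrised Kullback-Leibler divergence; jointly convex and
  homogeneous of degree one.\<close>

definition gap :: "real \<Rightarrow> real \<Rightarrow> real" where
  "gap x y = (x - y) * (ln x - ln y)"

lemma gap_nonneg: "x > 0 \<Longrightarrow> y > 0 \<Longrightarrow> gap x y \<ge> 0"
  unfolding gap_def by (cases "x \<ge> y") (auto intro: mult_nonneg_nonneg mult_nonpos_nonpos)

lemma gap_commute: "gap x y = gap y x"
  by (simp add: gap_def algebra_simps)

lemma ln_diff_le:
  fixes x y :: real
  assumes "x > 0" "y > 0"
  shows "ln x - ln y \<le> (x - y) / y"
  using ln_le_minus_one[of "x / y"] assms by (simp add: ln_div diff_divide_distrib)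

text \<open>The brackets are the partial derivatives of \<open>gap\<close> at \<open>(x, y)\<close>.
  For a convex function that is homogeneous of degree one, every tangent plane passes through the
  origin and lies below the graph. Here this amounts to two instances of
  \<open>ln s \<le> s - 1\<close>.\<close>

lemma gap_gradient:
  fixes x y u v :: real
  assumes "x > 0" "y > 0" "u > 0" "v > 0"
  shows "u * (ln x - ln y + 1 - y / x) + v * (- (ln x - ln y) + 1 - x / y) \<le> gap u v"
proof -
  have "ln (v * x) - ln (y * u) \<le> (v * x - y * u) / (y * u)"
    by (rule ln_diff_le) (use assms in auto)
  from mult_left_mono[OF this, of u] have 1: "u * (ln v + ln x - (ln y + ln u)) \<le> v * x / y - u"
    using assms by (simp add: ln_mult diff_divide_distrib right_diff_distrib)
  have "ln (u * y) - ln (x * v) \<le> (u * y - x * v) / (x * v)"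
    by (rule ln_diff_le) (use assms in auto)
  from mult_left_mono[OF this, of v] have 2: "v * (ln u + ln y - (ln x + ln v)) \<le> u * y / x - v"
    using assms by (simp add: ln_mult diff_divide_distrib right_diff_distrib)
  show ?thesis using add_mono[OF 1 2] unfolding gap_def by (simp add: algebra_simps)
qed

text \<open>The shift keeps the difference and moves the ratio towards 1.\<close>

lemma gap_shift_le:
  fixes x y e :: real
  assumes "x > 0" "y > 0" "e \<ge> 0"
  shows "gap (x + e) (y + e) \<le> gap x y"
proof -
  have *: "gap (x + e) (y + e) \<le> gap x y" if xy: "x > 0" "y > 0" "x \<ge> y" for x y :: real
  proof -
    have "(x + e) / (y + e) \<le> x / y" using xy assms(3) by (simp add: field_simps mult_left_mono)
    then have "ln ((x + e) / (y + e)) \<le> ln (x / y)" using xy assms(3) by (intro ln_mono) auto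
    then have "ln (x + e) - ln (y + e) \<le> ln x - ln y" using xy assms(3) by (simp add: ln_div)
    then show ?thesis using xy unfolding gap_def by (simp add: mult_left_mono)
  qed
  show ?thesis
    using *[of x y] *[of y x] assms gap_commute[of x y] gap_commute[of "x + e"] by (cases "x \<ge> y") auto
qed

text \<open>On \<open>(0, 1]\<close> the logarithm has slope at least 1. This later turns small
  dissipation into small fluxes.\<close>

lemma gap_ge_square:
  fixes x y :: real
  assumes "0 < x" "x \<le> 1" "0 < y" "y \<le> 1"
  shows "(x - y)\<^sup>2 \<le> gap x y"
proof -
  have *: "(x - y)\<^sup>2 \<le> gap x y" if xy: "0 < y" "y \<le> x" "x \<le> 1" for x y :: real
  proof -
    have "ln y - ln x \<le> (y - x) / x" by (rule ln_diff_le) (use xy in auto)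
    also have "\<dots> \<le> y - x" using xy by (simp add: divide_le_eq mult_left_le_one_le mult_le_cancel_left1)
    finally have "x - y \<le> ln x - ln y" by simp
    then show ?thesis using xy unfolding gap_def power2_eq_square by (intro mult_left_mono) auto
  qed
  show ?thesis
    using *[of y x] *[of x y] assms gap_commute[of x y] by (cases "y \<le> x") (auto simp: power2_commute)
qed

text \<open>If one argument is at least twice the other, \<open>u\<close> is at most twice the
  difference and the term is absorbed by the gap; otherwise the logarithms differ by at most
  1.\<close>

lemma mult_ln_diff_le:
  fixes u v :: real
  assumes "u > 0" "v > 0"
  shows "u * \<bar>ln u - ln v\<bar> \<le> 2 * gap u v + u"
proof -
  consider "2 * v \<le> u" | "u < 2 * v" "v \<le> 2 * u" | "2 * u < v" by linarith
  then show ?thesis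
  proof cases
    case 1
    then have l: "ln u - ln v \<ge> 0" using assms by simp
    then have "u * (ln u - ln v) \<le> (2 * (u - v)) * (ln u - ln v)"
      using 1 by (intro mult_right_mono) auto
    also have "\<dots> = 2 * gap u v" by (simp add: gap_def)
    finally show ?thesis using l assms by simp
  next
    case 2
    have "ln u - ln v \<le> (u - v) / v" by (rule ln_diff_le[OF assms])
    also have "\<dots> \<le> 1" using 2 assms by (simp add: divide_le_eq)
    finally have 3: "ln u - ln v \<le> 1" .
    have "ln v - ln u \<le> (v - u) / u" by (rule ln_diff_le[OF assms(2,1)])
    also have "\<dots> \<le> 1" using 2 assms by (simp add: divide_le_eq)
    finally have "\<bar>ln u - ln v\<bar> \<le> 1" using 3 by simp
    then have "u * \<bar>ln u - ln v\<bar> \<le> u" using assms by (simp add: mult_left_le)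
    then show ?thesis using gap_nonneg[OF assms] by linarith
  next
    case 3
    then have l: "ln v - ln u \<ge> 0" using assms by simp
    then have "u * (ln v - ln u) \<le> (v - u) * (ln v - ln u)"
      using 3 by (intro mult_right_mono) auto
    also have "\<dots> = gap u v" by (simp add: gap_def algebra_simps)
    finally show ?thesis using l assms gap_nonneg[OF assms] by simp
  qed
qed

lemma mult_ln_diff_le':
  fixes u v :: real
  assumes "u > 0" "v > 0"
  shows "v * \<bar>ln u - ln v\<bar> \<le> 2 * gap u v + v"
  using mult_ln_diff_le[OF assms(2,1)] by (simp add: gap_commute abs_minus_commute)

text \<open>Split off the smaller of the two rates. The common rate produces the gap, because
  \<open>e\<close> cancels in the difference of the arguments; the surplus rate leaves a term that
  \<open>aux\<close> bounds independently of \<open>e\<close>.\<close>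

lemma flux_gap_bound:
  fixes u v e m \<beta> \<delta> :: real
  assumes "0 \<le> m" "m \<le> \<beta>" "m \<le> \<delta>" "\<beta> \<le> 1" "\<delta> \<le> 1" "0 \<le> u" "0 \<le> v" "0 < e"
  shows "(\<beta> * v - \<delta> * u) * (ln (u + e) - ln (v + e)) \<le> - m * gap (u + e) (v + e) + (u + v)"
proof -
  define l where "l = ln (u + e) - ln (v + e)"
  have g: "gap (u + e) (v + e) = (u - v) * l" by (simp add: gap_def l_def)
  have g0: "(u - v) * l \<ge> 0" using gap_nonneg[of "u + e" "v + e"] assms g by auto
  have aux: "y * (ln (x + e) - ln (y + e)) \<le> x" if "0 \<le> x" "0 \<le> y" for x y :: real
  proof -
    have "y * (ln (x + e) - ln (y + e)) \<le> y * ((x + e - (y + e)) / (y + e))"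
      by (intro mult_left_mono ln_diff_le) (use that assms in auto)
    also have "\<dots> \<le> y * (x / (y + e))"
      by (intro mult_left_mono divide_right_mono) (use that assms in auto)
    also have "\<dots> = (y / (y + e)) * x" by simp
    also have "\<dots> \<le> 1 * x" by (intro mult_right_mono) (use that assms in auto)
    finally show ?thesis by simp
  qed
  show ?thesis
  proof (cases "\<delta> \<le> \<beta>")
    case True
    have "(\<beta> * v - \<delta> * u) * l = - \<delta> * ((u - v) * l) + (\<beta> - \<delta>) * (v * l)" by (simp add: algebra_simps)
    moreover have "(\<beta> - \<delta>) * (v * l) \<le> (\<beta> - \<delta>) * u"
      using True aux[of u v] assms by (intro mult_left_mono) (auto simp: l_def)
    moreover have "(\<beta> - \<delta>) * u \<le> 1 * u" using assms by (intro mult_right_mono) auto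
    moreover have "m * ((u - v) * l) \<le> \<delta> * ((u - v) * l)" using g0 assms by (intro mult_right_mono) auto
    ultimately show ?thesis using assms unfolding g l_def[symmetric] by simp
  next
    case False
    have "(\<beta> * v - \<delta> * u) * l = - \<beta> * ((u - v) * l) + (\<delta> - \<beta>) * (u * (- l))" by (simp add: algebra_simps)
    moreover have "(\<delta> - \<beta>) * (u * (- l)) \<le> (\<delta> - \<beta>) * v"
      using False aux[of v u] assms by (intro mult_left_mono) (auto simp: l_def)
    moreover have "(\<delta> - \<beta>) * v \<le> 1 * v" using assms by (intro mult_right_mono) auto
    moreover have "m * ((u - v) * l) \<le> \<beta> * ((u - v) * l)" using g0 assms by (intro mult_right_mono) auto
    ultimately show ?thesis using assms unfolding g l_def[symmetric] by simp
  qed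
qed

lemma gap_deriv:
  assumes "(X has_real_derivative X') (at t within S)" "(Y has_real_derivative Y') (at t within S)"
    and "X t > 0" "Y t > 0"
  shows "((\<lambda>s. gap (X s) (Y s)) has_real_derivative
      X' * (ln (X t) - ln (Y t) + 1 - Y t / X t) + Y' * (- (ln (X t) - ln (Y t)) + 1 - X t / Y t))
    (at t within S)"
proof -
  have lnX: "((\<lambda>s. ln (X s)) has_real_derivative X' / X t) (at t within S)"
    by (rule derivative_eq_intros assms(1,3) refl | simp)+
  have lnY: "((\<lambda>s. ln (Y s)) has_real_derivative Y' / Y t) (at t within S)"
    by (rule derivative_eq_intros assms(2,4) refl | simp)+
  have "((\<lambda>s. gap (X s) (Y s)) has_real_derivative
      (X t - Y t) * (X' / X t - Y' / Y t) + (X' - Y') * (ln (X t) - ln (Y t))) (at t within S)"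
    unfolding gap_def
    using DERIV_mult[OF DERIV_diff[OF assms(1,2)] DERIV_diff[OF lnX lnY]] by (simp add: algebra_simps)
  moreover have "(X t - Y t) * (X' / X t - Y' / Y t) + (X' - Y') * (ln (X t) - ln (Y t)) =
     X' * (ln (X t) - ln (Y t) + 1 - Y t / X t) + Y' * (- (ln (X t) - ln (Y t)) + 1 - X t / Y t)"
    using assms(3,4) by (simp add: field_simps)
  ultimately show ?thesis by simp
qed

lemma abs_ln_bound:
  fixes x c :: real
  assumes "0 < c" "c \<le> x" "x \<le> 2"
  shows "\<bar>ln x\<bar> \<le> \<bar>ln c\<bar> + 1"
proof -
  have "ln x \<le> x - 1" by (rule ln_le_minus_one) (use assms in simp)
  moreover have "ln c \<le> ln x" using assms by simp
  ultimately show ?thesis using assms by linarith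
qed

text \<open>Integrating over all of \<open>[a, b]\<close> instead of stopping at \<open>t\<close>
  makes the bound independent of \<open>t\<close>.\<close>

lemma le_integral_majorant:
  fixes f h :: "real \<Rightarrow> real"
  assumes "a \<le> t" "t \<le> b" "\<And>x. a \<le> x \<Longrightarrow> x \<le> b \<Longrightarrow> (f has_real_derivative f' x) (at x within {a..b})"
    and "\<And>x. a \<le> x \<Longrightarrow> x \<le> b \<Longrightarrow> f' x \<le> h x" "\<And>x. a \<le> x \<Longrightarrow> x \<le> b \<Longrightarrow> 0 \<le> h x"
    and "continuous_on {a..b} h"
  shows "f t \<le> f a + integral {a..b} h"
proof -
  have int: "h integrable_on {a..b}" by (rule integrable_continuous_real[OF assms(6)])
  have "f t - integral {a..t} h \<le> f a - integral {a..a} h"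
  proof (rule has_derivative_within_antimono[OF assms(1), where S = "{a..b}" and f' = "\<lambda>x. f' x - h x"])
    fix x assume x: "a \<le> x" "x \<le> t"
    then have xb: "x \<in> {a..b}" using assms(2) by simp
    show "((\<lambda>x. f x - integral {a..x} h) has_real_derivative f' x - h x) (at x within {a..b})"
      by (intro DERIV_diff assms(3) integral_has_real_derivative[OF assms(6) xb]) (use xb in auto)
    show "f' x - h x \<le> 0" using assms(4)[of x] xb by simp
  qed (use assms(2) in auto)
  moreover have "integral {a..t} h \<le> integral {a..b} h"
    by (rule integral_subset_le) (use assms int in \<open>auto intro: integrable_on_subinterval\<close>)
  ultimately show ?thesis by simp
qed

section \<open>Evolution of the gaps across the edges\<close>

context phase2
begin

definition G :: "real \<Rightarrow> real \<Rightarrow> int \<Rightarrow> real" where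
  "G e t n = gap (p t (n + 1) + e) (p t n + e)"

definition dG :: "real \<Rightarrow> real \<Rightarrow> int \<Rightarrow> real" where
  "dG e t n =
    (let X = p t (n + 1) + e; Y = p t n + e; l = ln X - ln Y
     in (J t n - J t (n + 1)) * (l + 1 - Y / X) + (J t (n - 1) - J t n) * (- l + 1 - X / Y))"

lemma G_deriv:
  assumes "t \<ge> t0" "p t n + e > 0" "p t (n + 1) + e > 0"
  shows "((\<lambda>s. G e s n) has_real_derivative dG e t n) (at t within {t0..})"
proof -
  have "((\<lambda>s. p s (n + 1) + e) has_real_derivative (J t n - J t (n + 1))) (at t within {t0..})"
    "((\<lambda>s. p s n + e) has_real_derivative (J t (n - 1) - J t n)) (at t within {t0..})"
    using p_deriv[OF assms(1), of "n + 1"] p_deriv[OF assms(1), of n]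
    by (auto intro!: derivative_eq_intros)
  from gap_deriv[OF this assms(3,2)] show ?thesis unfolding G_def dG_def Let_def .
qed

text \<open>The gap is convex and homogeneous, so along a linear evolution its derivative is at most the
  same evolution applied to the gaps. Adding the constant \<open>e\<close> is harmless, as constants are
  stationary away from the origin. Only the two edges next to the origin, where the downward rate
  changes from \<open>a\<close> to 1, produce an error term.\<close>

lemma dG_le:
  assumes t: "t \<ge> t0" and P: "\<And>n. p t n + e > 0" and e: "0 \<le> e" "e \<le> 1"
    and c: "0 < c" "\<And>k. k \<in> {-1, 0, 1} \<Longrightarrow> c \<le> p t k"
  shows "dG e t n \<le> G e t (n + 1) + G e t (n - 1) + (if n \<in> {-1, 0} then 2 * \<bar>ln c\<bar> + 3 else 0)"
proof -
  define P where "P k = p t k + e" for k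
  have P0: "P k > 0" for k using assms(2) by (simp add: P_def)
  define l where "l = ln (P (n + 1)) - ln (P n)"
  define \<alpha> where "\<alpha> = l + 1 - P n / P (n + 1)"
  define \<beta> where "\<beta> = - l + 1 - P (n + 1) / P n"
  have dG: "dG e t n = (J t n - J t (n + 1)) * \<alpha> + (J t (n - 1) - J t n) * \<beta>"
    by (simp add: dG_def Let_def \<alpha>_def \<beta>_def l_def P_def)
  have grad: "u * \<alpha> + v * \<beta> \<le> gap u v" if "u > 0" "v > 0" for u v
    unfolding \<alpha>_def \<beta>_def l_def by (rule gap_gradient[OF P0 P0 that])
  \<comment> \<open>Euler's identity for a function homogeneous of degree one.\<close>
  have grad_eq: "P (n + 1) * \<alpha> + P n * \<beta> = gap (P (n + 1)) (P n)"
    using P0[of n] P0[of "n + 1"] by (simp add: \<alpha>_def \<beta>_def gap_def l_def algebra_simps)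
  \<comment> \<open>Both ends of the edge are given one common downward rate, so that the constant
    \<open>e\<close> cancels in \<open>Q1\<close> and \<open>Q0\<close>. Where the true rates
    differ, the excess goes into \<open>x\<close> (edge from -1 to 0) or into \<open>y\<close> (edge
    from 0 to 1).\<close>
  define \<delta> where "\<delta> = dr t (n + 1 + (if n = -1 then -1 else 0))"
  define x where "x = (if n = -1 then (1 - a t) * p t 1 else 0)"
  define y where "y = (if n = 0 then (1 - a t) * p t 0 else 0)"
  have \<delta>: "0 \<le> \<delta>" "\<delta> \<le> 1" using dr_bounds[OF t] by (auto simp: \<delta>_def)
  have b: "0 \<le> b t" "b t \<le> 1" using b_bounds[OF t] by auto
  have cases: "n = -1 \<or> n = 0 \<or> n \<ge> 1 \<or> n \<le> -2" by linarith
  have Q1: "J t n - J t (n + 1) = \<delta> * P (n + 2) + b t * P n - (\<delta> + b t) * P (n + 1) + x"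
    using cases by (auto simp: J_def P_def \<delta>_def x_def dr_def algebra_simps)
  have Q0: "J t (n - 1) - J t n = \<delta> * P (n + 1) + b t * P (n - 1) - (\<delta> + b t) * P n + y"
    using cases by (auto simp: J_def P_def \<delta>_def y_def dr_def algebra_simps)
  define z where "z = x * \<alpha> + y * \<beta>"
  have "dG e t n = \<delta> * (P (n + 2) * \<alpha> + P (n + 1) * \<beta>) + b t * (P n * \<alpha> + P (n - 1) * \<beta>)
      - (\<delta> + b t) * (P (n + 1) * \<alpha> + P n * \<beta>) + z"
    unfolding dG Q1 Q0 z_def by (simp add: algebra_simps)
  \<comment> \<open>The outflow contributes a nonpositive multiple of the gap itself, which is
    replaced by 0.\<close>
  also have "\<dots> \<le> \<delta> * gap (P (n + 2)) (P (n + 1)) + b t * gap (P n) (P (n - 1))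
      - 0 + z"
    using \<delta> b P0 gap_nonneg[of "P (n + 1)" "P n"] unfolding grad_eq
    by (intro add_mono diff_mono mult_left_mono grad) auto
  also have "\<dots> \<le> 1 * gap (P (n + 2)) (P (n + 1)) + 1 * gap (P n) (P (n - 1)) - 0 + z"
    using \<delta> b P0 gap_nonneg by (intro add_mono diff_mono mult_right_mono) auto
  also have "\<dots> = G e t (n + 1) + G e t (n - 1) + z"
    by (simp add: G_def P_def add.commute)
  also have "z \<le> (if n \<in> {-1, 0} then 2 * \<bar>ln c\<bar> + 3 else 0)"
  proof -
    have ab: "0 \<le> 1 - a t" "1 - a t \<le> 1" using a_bounds[OF t] by auto
    have L: "\<bar>ln (P k)\<bar> \<le> \<bar>ln c\<bar> + 1" if "k \<in> {-1, 0, 1}" for k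
      using c(2)[OF that] e p_le_1[OF t, of k] c(1) by (intro abs_ln_bound) (auto simp: P_def)
    have pr: "0 \<le> (1 - a t) * p t k" "(1 - a t) * p t k \<le> 1" for k
      using ab p_nonneg[OF t, of k] p_le_1[OF t, of k] by (auto intro!: mult_le_one)
    have fin: "q * z \<le> 2 * \<bar>ln c\<bar> + 3" if "0 \<le> q" "q \<le> 1" "z \<le> 2 * \<bar>ln c\<bar> + 3" for q z :: real
    proof -
      have "q * z \<le> q * (2 * \<bar>ln c\<bar> + 3)" using that by (intro mult_left_mono) auto
      also have "\<dots> \<le> 1 * (2 * \<bar>ln c\<bar> + 3)" using that by (intro mult_right_mono) auto
      finally show ?thesis by simp
    qed
    have pos: "P n / P (n + 1) > 0" "P (n + 1) / P n > 0" using P0 by auto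
    consider "n = -1" | "n = 0" | "n \<notin> {-1, 0}" by blast
    then show ?thesis
    proof cases
      case 1
      \<comment> \<open>Each of the two logarithms costs \<open>\<bar>ln c\<bar> + 1\<close>; the
        quotient enters with a minus sign and is discarded.\<close>
      have "\<alpha> \<le> 2 * \<bar>ln c\<bar> + 3"
        using L[of 0] L[of "-1"] pos 1 unfolding \<alpha>_def l_def by simp
      then show ?thesis using fin[OF pr[of 1]] 1 by (simp add: x_def y_def z_def)
    next
      case 2
      have "\<beta> \<le> 2 * \<bar>ln c\<bar> + 3"
        using L[of 0] L[of "1"] pos 2 unfolding \<beta>_def l_def by simp
      then show ?thesis using fin[OF pr[of 0]] 2 by (simp add: x_def y_def z_def)
    next
      case 3
      then show ?thesis by (simp add: x_def y_def z_def)
    qed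
  qed
  finally show ?thesis by simp
qed

end

section \<open>Regularised entropy and summability of the gaps\<close>

definition xlnx :: "real \<Rightarrow> real" where "xlnx x = x * ln x"

text \<open>Subtracting \<open>xlnx e\<close> makes the shifted term vanish at \<open>x = 0\<close>,
  as summability over all sites demands. Both bounds are free of \<open>e\<close>, so the entropy
  available for dissipation does not depend on the regularisation.\<close>

lemma xlnx_shift_bounds:
  assumes "0 \<le> x" "x \<le> 1" "0 < e" "e \<le> 1"
  shows "xlnx x \<le> xlnx (x + e) - xlnx e" "xlnx (x + e) - xlnx e \<le> 2 * x"
proof -
  have "x * ln x \<le> x * ln (x + e)"
    using assms by (cases "x = 0") (auto intro!: mult_left_mono)
  moreover have "e * ln e \<le> e * ln (x + e)" using assms by (auto intro!: mult_left_mono)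
  ultimately show "xlnx x \<le> xlnx (x + e) - xlnx e" by (simp add: xlnx_def algebra_simps)
  have "e * (ln (x + e) - ln e) \<le> e * ((x + e - e) / e)"
    using assms by (intro mult_left_mono ln_diff_le) auto
  then have 1: "e * ln (x + e) - e * ln e \<le> x" using assms by (simp add: algebra_simps)
  have "ln (x + e) \<le> x + e - 1" using assms by (intro ln_le_minus_one) auto
  then have "x * ln (x + e) \<le> x * 1" using assms by (intro mult_left_mono) auto
  then show "xlnx (x + e) - xlnx e \<le> 2 * x" using 1 by (simp add: xlnx_def algebra_simps)
qed

text \<open>A form of Young's inequality with a free slope \<open>k\<close>. For
  \<open>k = \<bar>n\<bar>\<close> the first moment and a geometric series together dominate the
  entropy terms.\<close>

lemma xlnx_abs_bound:
  assumes "0 \<le> x" "x \<le> 1"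
  shows "\<bar>xlnx x\<bar> \<le> k * x + exp (- k)"
proof (cases "x = 0")
  case False
  then have x: "x > 0" using assms by simp
  have "ln (exp (- k)) - ln x \<le> (exp (- k) - x) / x" by (rule ln_diff_le) (use x in auto)
  then have "x * (- k - ln x) \<le> x * ((exp (- k) - x) / x)" using x by (intro mult_left_mono) auto
  also have "x * ((exp (- k) - x) / x) = exp (- k) - x" using x by simp
  finally have "- xlnx x \<le> k * x + exp (- k) - x" by (simp add: xlnx_def algebra_simps)
  moreover have "xlnx x \<le> 0" using assms x by (simp add: xlnx_def mult_le_0_iff)
  ultimately show ?thesis using x by simp
qed (simp add: xlnx_def)

lemma summable_exp_abs: "(\<lambda>n::int. exp (- real_of_int \<bar>n\<bar>)) summable_on UNIV"
proof -
  have "exp (- real_of_int \<bar>n\<bar>) = exp (-1) ^ nat \<bar>n\<bar>" for n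
    by (simp flip: exp_of_nat_mult)
  then show ?thesis using summable_on_int_geometric(1)[of "exp (-1)"] by simp
qed

context phase2
begin

lemma P_range:
  assumes "t \<ge> t0" "0 < e" "e \<le> 1"
  shows "e \<le> p t n + e" "0 < p t n + e" "p t n + e \<le> 2"
  using p_nonneg[OF assms(1), of n] p_le_1[OF assms(1), of n] assms by auto

lemma ln_P_bound:
  assumes "t \<ge> t0" "0 < e" "e \<le> 1"
  shows "\<bar>ln (p t n + e)\<bar> \<le> \<bar>ln e\<bar> + 1"
  by (rule abs_ln_bound) (use P_range[OF assms] assms in auto)

lemma G_nonneg: "p t n + e > 0 \<Longrightarrow> p t (n + 1) + e > 0 \<Longrightarrow> G e t n \<ge> 0"
  unfolding G_def by (rule gap_nonneg)

lemma G_summable: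
  assumes "t \<ge> t0" "0 < e" "e \<le> 1"
  shows "G e t summable_on UNIV"
proof (rule summable_on_dominated)
  show "(\<lambda>n. (p t (n + 1) + p t n) * (2 * (\<bar>ln e\<bar> + 1))) summable_on UNIV"
    using assms(1) by (intro summable_on_cmult_left summable_on_add summable_on_int_shift(1) p_summable) auto
  fix n
  have "\<bar>G e t n\<bar> = \<bar>p t (n + 1) - p t n\<bar> * \<bar>ln (p t (n + 1) + e) - ln (p t n + e)\<bar>"
    by (simp add: G_def gap_def abs_mult)
  also have "\<dots> \<le> (p t (n + 1) + p t n) * (2 * (\<bar>ln e\<bar> + 1))"
    using ln_P_bound[OF assms, of n] ln_P_bound[OF assms, of "n + 1"]
      p_nonneg[OF assms(1), of n] p_nonneg[OF assms(1), of "n + 1"]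
    by (intro mult_mono) auto
  finally show "\<bar>G e t n\<bar> \<le> (p t (n + 1) + p t n) * (2 * (\<bar>ln e\<bar> + 1))" .
qed

lemma Q_majorant:
  "\<exists>M. M summable_on UNIV \<and> (\<forall>n. M n \<ge> 0) \<and>
     (\<forall>t n. t0 \<le> t \<longrightarrow> t \<le> T \<longrightarrow> \<bar>J t (n - 1) - J t n\<bar> \<le> M n \<and> p t n \<le> M n)"
proof (cases "t0 \<le> T")
  case True
  define q where "q n = exp (2 * (T - t0)) * p T n" for n
  have q: "q summable_on UNIV" "\<And>n. q n \<ge> 0"
    unfolding q_def using True p_nonneg by (auto intro!: summable_on_cmult_right p_summable)
  let ?M = "\<lambda>n. q (n - 1) + 2 * q n + q (n + 1)"
  have "?M summable_on UNIV"
    by (intro summable_on_add summable_on_cmult_right q summable_on_int_shift)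
  moreover have "\<bar>J t (n - 1) - J t n\<bar> \<le> ?M n \<and> p t n \<le> ?M n" if "t0 \<le> t" "t \<le> T" for t n
    using Q_bounds(3)[OF that(1), of n] p_majorant[OF that] q(2)[of n] q(2)[of "n - 1"] q(2)[of "n + 1"]
      p_majorant[OF that, of n] p_majorant[OF that, of "n - 1"] p_majorant[OF that, of "n + 1"]
    unfolding q_def[symmetric] by linarith
  ultimately show ?thesis using q(2) by (intro exI[of _ ?M]) (auto intro!: add_nonneg_nonneg)
next
  case False
  then show ?thesis by (intro exI[of _ "\<lambda>_. 0"]) auto
qed

text \<open>For fixed \<open>e\<close> the logarithms and quotients in \<open>dG\<close> are
  bounded, since the arguments lie between \<open>e\<close> and 2, so the majorant of the velocities
  suffices. The constant \<open>K\<close> blows up as \<open>e\<close> tends to 0, but it serves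
  only to justify the differentiation.\<close>

lemma G_sum_deriv:
  assumes t: "t0 \<le> t" and e: "0 < e" "e \<le> 1"
  shows "((\<lambda>s. \<Sum>\<^sub>\<infinity>n. G e s n) has_real_derivative (\<Sum>\<^sub>\<infinity>n. dG e t n)) (at t within {t0..})"
    and "dG e t summable_on UNIV"
proof -
  obtain M where M: "M summable_on UNIV" "\<And>n. M n \<ge> 0"
    "\<And>s n. t0 \<le> s \<Longrightarrow> s \<le> t + 1 \<Longrightarrow> \<bar>J s (n - 1) - J s n\<bar> \<le> M n"
    using Q_majorant[of "t + 1"] by blast
  define K where "K = 2 * (\<bar>ln e\<bar> + 1) + 1 + 2 / e"
  have K: "\<bar>(ln (p s n + e) - ln (p s m + e)) + 1 - (p s m + e) / (p s n + e)\<bar> \<le> K"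
    if s: "t0 \<le> s" for s n m
  proof -
    define q where "q = (p s m + e) / (p s n + e)"
    define c where "c = 2 / e"
    have "q \<le> c" unfolding q_def c_def
      using P_range[OF s e] e by (intro frac_le) auto
    moreover have "0 \<le> q"
      using P_range(2)[OF s e] by (simp add: less_imp_le q_def)
    moreover have "\<bar>x - y + 1 - q\<bar> \<le> 2 * L + 1 + c"
      if "\<bar>x\<bar> \<le> L" "\<bar>y\<bar> \<le> L" "q \<le> c" "0 \<le> q" for x y L q c :: real
      using that by linarith
    ultimately show ?thesis
      using ln_P_bound[OF s e, of n] ln_P_bound[OF s e, of m]
      unfolding K_def q_def[symmetric] c_def[symmetric] by blast
  qed
  define B where "B n = M (n + 1) * K + M n * K" for n
  have B: "B summable_on UNIV" unfolding B_def
    by (intro summable_on_add summable_on_cmult_left summable_on_int_shift(1)[OF M(1)] M(1))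
  have bnd: "\<bar>dG e s n\<bar> \<le> B n" if s: "t0 \<le> s" "s \<le> t + 1" for s n
  proof -
    let ?l = "ln (p s (n + 1) + e) - ln (p s n + e)"
    have "\<bar>dG e s n\<bar> \<le> \<bar>J s n - J s (n + 1)\<bar> * \<bar>?l + 1 - (p s n + e) / (p s (n + 1) + e)\<bar>
      + \<bar>J s (n - 1) - J s n\<bar> * \<bar>- ?l + 1 - (p s (n + 1) + e) / (p s n + e)\<bar>"
      unfolding dG_def Let_def abs_mult[symmetric] by (rule abs_triangle_ineq)
    also have "\<dots> \<le> B n" unfolding B_def
      using M(3)[OF s, of n] M(3)[OF s, of "n + 1"] K[OF s(1), of "n + 1" n] K[OF s(1), of n "n + 1"] M(2)
      by (intro add_mono mult_mono) auto
    finally show ?thesis .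
  qed
  show "((\<lambda>s. \<Sum>\<^sub>\<infinity>n. G e s n) has_real_derivative (\<Sum>\<^sub>\<infinity>n. dG e t n)) (at t within {t0..})"
  proof (rule has_real_derivative_infsum[where M = B and \<beta> = "t + 1", OF _ bnd B _ t])
    show "\<And>s n. t0 \<le> s \<Longrightarrow> ((\<lambda>s. G e s n) has_real_derivative dG e s n) (at s within {t0..})"
      using P_range(2)[OF _ e] by (intro G_deriv) auto
    show "\<And>s. t0 \<le> s \<Longrightarrow> s \<le> t + 1 \<Longrightarrow> G e s summable_on UNIV"
      by (rule G_summable) (use e in auto)
  qed auto
  show "dG e t summable_on UNIV"
    by (rule summable_on_dominated[OF B]) (use bnd[of t] t in auto)
qed

text \<open>When \<open>dG_le\<close> is summed, each gap is counted twice and the error occurs on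
  two edges. Adding the error constant to the sum therefore gives a homogeneous inequality with rate
  2, in which \<open>e\<close> no longer appears.\<close>

lemma G_gronwall:
  assumes e: "0 < e" "e \<le> 1" and c: "0 < c"
    and st: "t0 \<le> s" "s \<le> t"
    and pc: "\<And>u k. s \<le> u \<Longrightarrow> u \<le> t \<Longrightarrow> k \<in> {-1, 0, 1} \<Longrightarrow> c \<le> p u k"
  shows "(\<Sum>\<^sub>\<infinity>n. G e t n) + (2 * \<bar>ln c\<bar> + 3)
    \<le> exp (2 * (t - s)) * ((\<Sum>\<^sub>\<infinity>n. G e s n) + (2 * \<bar>ln c\<bar> + 3))"
proof (rule gronwall_deriv[OF st(2), where S = "{t0..}" and f' = "\<lambda>u. \<Sum>\<^sub>\<infinity>n. dG e u n"])
  fix u assume u: "s \<le> u" "u \<le> t"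
  then have u0: "t0 \<le> u" using st by simp
  define C where "C = 2 * \<bar>ln c\<bar> + 3"
  show "((\<lambda>t. (\<Sum>\<^sub>\<infinity>n. G e t n) + (2 * \<bar>ln c\<bar> + 3)) has_real_derivative (\<Sum>\<^sub>\<infinity>n. dG e u n)) (at u within {t0..})"
    using DERIV_add[OF G_sum_deriv(1)[OF u0 e] DERIV_const] by simp
  let ?i = "\<lambda>n::int. if n \<in> {-1, 0} then C else 0"
  have i: "?i summable_on UNIV" "infsum ?i UNIV = 2 * C"
  proof -
    have "(?i has_sum (sum ?i {-1, 0})) UNIV"
      by (rule has_sum_finite_neutralI[where B = "{-1, 0}"]) auto
    then show "?i summable_on UNIV" "infsum ?i UNIV = 2 * C"
      by (auto dest: has_sum_imp_summable infsumI)
  qed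
  note g = summable_on_int_shift[OF G_summable[OF u0 e], of 1]
  have "(\<Sum>\<^sub>\<infinity>n. dG e u n) \<le> (\<Sum>\<^sub>\<infinity>n. G e u (n + 1) + G e u (n - 1) + ?i n)"
  proof (rule infsum_mono)
    show "dG e u summable_on UNIV" by (rule G_sum_deriv(2)[OF u0 e])
    show "(\<lambda>n. G e u (n + 1) + G e u (n - 1) + ?i n) summable_on UNIV"
      by (intro summable_on_add g i(1))
    show "dG e u n \<le> G e u (n + 1) + G e u (n - 1) + ?i n" for n
      unfolding C_def by (rule dG_le[OF u0 _ _ _ c pc]) (use P_range[OF u0 e] e u in auto)
  qed
  also have "\<dots> = 2 * ((\<Sum>\<^sub>\<infinity>n. G e u n) + C)"
    using infsum_int_shift[of "G e u" 1] infsum_int_shift[of "G e u" "-1"]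
    unfolding infsum_add[OF summable_on_add[OF g] i(1)] infsum_add[OF g] i(2) by simp
  finally show "(\<Sum>\<^sub>\<infinity>n. dG e u n) \<le> 2 * ((\<Sum>\<^sub>\<infinity>n. G e u n) + (2 * \<bar>ln c\<bar> + 3))"
    by (simp add: C_def)
qed (use st in auto)

definition Ent :: "real \<Rightarrow> real \<Rightarrow> real" where
  "Ent e t = (\<Sum>\<^sub>\<infinity>n. xlnx (p t n + e) - xlnx e)"

lemma xlnx_summable:
  assumes t: "t0 \<le> t"
  shows "(\<lambda>n. xlnx (p t n)) summable_on UNIV"
proof (rule summable_on_dominated)
  show "(\<lambda>n. (1 + real_of_int \<bar>n\<bar>) * p t n + exp (- real_of_int \<bar>n\<bar>)) summable_on UNIV"
    by (intro summable_on_add first_moment t summable_exp_abs)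
  show "\<bar>xlnx (p t n)\<bar> \<le> (1 + real_of_int \<bar>n\<bar>) * p t n + exp (- real_of_int \<bar>n\<bar>)" for n
    using xlnx_abs_bound[OF p_nonneg[OF t] p_le_1[OF t], of n "real_of_int \<bar>n\<bar>"] p_nonneg[OF t, of n]
    by (simp add: distrib_right)
qed

lemma Ent_term_summable:
  assumes t: "t0 \<le> t" and e: "0 < e" "e \<le> 1"
  shows "(\<lambda>n. xlnx (p t n + e) - xlnx e) summable_on UNIV"
proof (rule summable_on_dominated)
  show "(\<lambda>n. \<bar>xlnx (p t n)\<bar> + 2 * p t n) summable_on UNIV"
    using xlnx_summable[OF t] summable_on_iff_abs_summable_on_real[of "\<lambda>n. xlnx (p t n)" UNIV]
    by (intro summable_on_add summable_on_cmult_right p_summable[OF t]) simp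
  show "\<bar>xlnx (p t n + e) - xlnx e\<bar> \<le> \<bar>xlnx (p t n)\<bar> + 2 * p t n" for n
    using xlnx_shift_bounds[OF p_nonneg[OF t] p_le_1[OF t] e, of n] p_nonneg[OF t, of n] by linarith
qed

lemma Ent_bounds:
  assumes t: "t0 \<le> t" and e: "0 < e" "e \<le> 1"
  shows "(\<Sum>\<^sub>\<infinity>n. xlnx (p t n)) \<le> Ent e t" "Ent e t \<le> 2"
proof -
  note b = xlnx_shift_bounds[OF p_nonneg[OF t] p_le_1[OF t] e]
  show "(\<Sum>\<^sub>\<infinity>n. xlnx (p t n)) \<le> Ent e t" unfolding Ent_def
    by (intro infsum_mono xlnx_summable Ent_term_summable t e b)
  have "Ent e t \<le> (\<Sum>\<^sub>\<infinity>n. 2 * p t n)" unfolding Ent_def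
    by (intro infsum_mono summable_on_cmult_right p_summable Ent_term_summable t e b)
  then show "Ent e t \<le> 2" using p_infsum[OF t] by (simp add: infsum_cmult_right')
qed

text \<open>Summation by parts pairs the flux with the increments of \<open>ln (p + e)\<close>, and
  \<open>flux_gap_bound\<close> applies edge by edge. The 2 is the total of the errors
  \<open>p (n + 1) + p n\<close>.\<close>

lemma Ent_deriv:
  assumes t: "t0 \<le> t" and e: "0 < e" "e \<le> 1" and m: "0 \<le> m" "m \<le> a t"
  shows "\<exists>D. (Ent e has_real_derivative D) (at t within {t0..}) \<and> D \<le> - m * (\<Sum>\<^sub>\<infinity>n. G e t n) + 2"
proof -
  obtain M where M: "M summable_on UNIV" "\<And>n. M n \<ge> 0"
    "\<And>s n. t0 \<le> s \<Longrightarrow> s \<le> t + 1 \<Longrightarrow> \<bar>J s (n - 1) - J s n\<bar> \<le> M n"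
    using Q_majorant[of "t + 1"] by blast
  define K where "K = \<bar>ln e\<bar> + 2"
  define w where "w s n = ln (p s n + e) + 1" for s n
  have K: "\<bar>w s n\<bar> \<le> K" if "t0 \<le> s" for s n
    using ln_P_bound[OF that e, of n] unfolding K_def w_def by linarith
  have K0: "K \<ge> 0" by (simp add: K_def)
  have der: "(Ent e has_real_derivative (\<Sum>\<^sub>\<infinity>n. w t n * (J t (n - 1) - J t n))) (at t within {t0..})"
    unfolding Ent_def
  proof (rule has_real_derivative_infsum[where M = "\<lambda>n. K * M n" and \<beta> = "t + 1", OF _ _ _ _ t])
    fix s n assume s: "t0 \<le> s"
    have P: "((\<lambda>u. p u n + e) has_real_derivative J s (n - 1) - J s n) (at s within {t0..})"
      using DERIV_add[OF p_deriv[OF s] DERIV_const] by simp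
    have lnP: "((\<lambda>u. ln (p u n + e)) has_real_derivative (J s (n - 1) - J s n) / (p s n + e)) (at s within {t0..})"
      by (rule derivative_eq_intros P P_range(2)[OF s e] refl | simp)+
    have "((\<lambda>u. xlnx (p u n + e) - xlnx e) has_real_derivative
        (J s (n - 1) - J s n) * ln (p s n + e) + (J s (n - 1) - J s n) / (p s n + e) * (p s n + e) - 0)
        (at s within {t0..})"
      unfolding xlnx_def by (intro DERIV_diff DERIV_const DERIV_mult P lnP)
    also have "(J s (n - 1) - J s n) * ln (p s n + e) + (J s (n - 1) - J s n) / (p s n + e) * (p s n + e) - 0
        = w s n * (J s (n - 1) - J s n)"
    proof -
      have "(J s (n - 1) - J s n) / (p s n + e) * (p s n + e) = J s (n - 1) - J s n"
        using P_range(2)[OF s e, of n] by simp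
      then show ?thesis by (simp add: w_def algebra_simps)
    qed
    finally show "((\<lambda>u. xlnx (p u n + e) - xlnx e) has_real_derivative w s n * (J s (n - 1) - J s n))
        (at s within {t0..})" .
  next
    fix s n assume s: "t0 \<le> s" "s \<le> t + 1"
    show "\<bar>w s n * (J s (n - 1) - J s n)\<bar> \<le> K * M n"
      unfolding abs_mult by (intro mult_mono K M s) (use K0 in auto)
  next
    show "\<And>s. t0 \<le> s \<Longrightarrow> s \<le> t + 1 \<Longrightarrow> (\<lambda>n. xlnx (p s n + e) - xlnx e) summable_on UNIV"
      by (rule Ent_term_summable) (use e in auto)
  qed (use M in \<open>auto intro: summable_on_cmult_right\<close>)
  have ps: "(\<lambda>n. K * p t n) summable_on UNIV" by (intro summable_on_cmult_right p_summable t)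
  note parts = weighted_sum_by_parts[where w = "w t", OF tame_const[OF K0] K[OF t] t ps]
  have "(\<Sum>\<^sub>\<infinity>n. w t n * (J t (n - 1) - J t n)) = (\<Sum>\<^sub>\<infinity>n. (w t (n + 1) - w t n) * J t n)"
    by (rule parts(1))
  also have "\<dots> \<le> (\<Sum>\<^sub>\<infinity>n. - m * G e t n + (p t (n + 1) + p t n))"
  proof (rule infsum_mono)
    show "(\<lambda>n. (w t (n + 1) - w t n) * J t n) summable_on UNIV"
      using summable_on_real_diff[OF parts(4,3)] by (simp add: algebra_simps)
    show "(\<lambda>n. - m * G e t n + (p t (n + 1) + p t n)) summable_on UNIV"
      by (intro summable_on_add summable_on_cmult_right G_summable t e p_summable summable_on_int_shift(1))
    fix n
    have "(b t * p t n - dr t (n + 1) * p t (n + 1)) * (ln (p t (n + 1) + e) - ln (p t n + e))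
      \<le> - m * gap (p t (n + 1) + e) (p t n + e) + (p t (n + 1) + p t n)"
      by (rule flux_gap_bound)
        (use m a_bounds[OF t] b_bounds[OF t] p_nonneg[OF t] e in \<open>auto simp: dr_def\<close>)
    then show "(w t (n + 1) - w t n) * J t n \<le> - m * G e t n + (p t (n + 1) + p t n)"
      by (simp add: w_def G_def J_def mult.commute)
  qed
  also have "\<dots> = - m * (\<Sum>\<^sub>\<infinity>n. G e t n) + 2"
    using infsum_int_shift[of "p t" 1]
    by (simp only: infsum_add infsum_cmult_right' summable_on_add summable_on_cmult_right G_summable t e
        p_summable summable_on_int_shift(1) p_infsum)
  finally show ?thesis using der by blast
qed

lemma p_lower_bound:
  assumes "t0 \<le> s" "\<And>k. k \<in> {-1, 0, 1} \<Longrightarrow> p s k > 0" "s \<le> T"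
  shows "\<exists>c>0. \<forall>u k. s \<le> u \<longrightarrow> u \<le> T \<longrightarrow> k \<in> {-1, 0, 1} \<longrightarrow> c \<le> p u k"
proof -
  define q where "q = min (p s (-1)) (min (p s 0) (p s 1))"
  have q: "q > 0" "\<And>k. k \<in> {-1, 0, 1} \<Longrightarrow> q \<le> p s k" using assms(2) by (auto simp: q_def)
  have "exp (- 2 * (T - s)) * q \<le> p u k" if u: "s \<le> u" "u \<le> T" "k \<in> {-1, 0, 1}" for u k
  proof -
    have "exp (- 2 * (T - s)) * q \<le> exp (- 2 * (u - s)) * p s k"
      using u q by (intro mult_mono) auto
    also have "\<dots> \<le> p u k" by (rule p_decay) (use u assms in auto)
    finally show ?thesis .
  qed
  then show ?thesis using q(1) by (intro exI[of _ "exp (- 2 * (T - s)) * q"]) auto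
qed

text \<open>If the regularised sum were large at time \<open>t\<close>, then by Gronwall it would be large on a whole
  interval before \<open>t\<close>, and the regularised entropy would drop by more than its bounds, which do
  not depend on \<open>e\<close>, permit.\<close>

lemma G_sum_bounded:
  assumes t: "t > t0"
  shows "\<exists>B. \<forall>e. 0 < e \<longrightarrow> e \<le> 1 \<longrightarrow> (\<Sum>\<^sub>\<infinity>n. G e t n) \<le> B"
proof -
  define s where "s = (t0 + t) / 2"
  have s: "t0 < s" "s < t" using t by (auto simp: s_def)
  obtain c where c: "c > 0" "\<And>u k. s \<le> u \<Longrightarrow> u \<le> t \<Longrightarrow> k \<in> {-1, 0, 1} \<Longrightarrow> c \<le> p u k"
    using p_lower_bound[of s t] p_pos[OF s(1)] s by auto
  define C where "C = 2 * \<bar>ln c\<bar> + 3"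
  define E where "E = exp (2 * (t - s))"
  have E0: "E > 0" by (simp add: E_def)
  define H where "H = (\<Sum>\<^sub>\<infinity>n. xlnx (p t n))"
  \<comment> \<open>A lower bound for \<open>a \<ge> r * d\<close>: the sites 1 and -1 alone give
    both factors at least the mass \<open>c\<close>.\<close>
  define m where "m = c * c"
  have m: "m > 0" using c(1) by (simp add: m_def)
  have am: "m \<le> a u" if "s \<le> u" "u \<le> t" for u
  proof -
    have u: "t0 \<le> u" using that s by simp
    have "c \<le> r u" "c \<le> d u"
      using c(2)[OF that, of 1] c(2)[OF that, of "-1"] p_le_infsum[OF u, of 1 "{1..}"] p_le_infsum[OF u, of "-1" "{..-1}"]
      by (auto simp: r_def rich_def d_def debt_def)
    then have "c * c \<le> r u * d u" using c(1) by (intro mult_mono) auto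
    then show ?thesis using a_ge[OF u] by (simp add: m_def)
  qed
  have "(\<Sum>\<^sub>\<infinity>n. G e t n) \<le> E * ((2 * (t - s) + 2 - H) / (m * (t - s)) + C)" if e: "0 < e" "e \<le> 1" for e
  proof -
    \<comment> \<open>Gronwall read backwards: \<open>A\<close> is a lower bound for the regularised
      sum at every time in \<open>[s, t]\<close>, so the entropy falls there at rate at least
      \<open>m * A - 2\<close>.\<close>
    define A where "A = inverse E * ((\<Sum>\<^sub>\<infinity>n. G e t n) + C) - C"
    have A: "A \<le> (\<Sum>\<^sub>\<infinity>n. G e u n)" if u: "s \<le> u" "u \<le> t" for u
    proof -
      have u0: "t0 \<le> u" using u s by simp
      have G0: "(\<Sum>\<^sub>\<infinity>n. G e u n) + C \<ge> 0"
        using P_range(2)[OF u0 e] by (auto intro!: add_nonneg_nonneg infsum_nonneg G_nonneg simp: C_def)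
      have "(\<Sum>\<^sub>\<infinity>n. G e t n) + C \<le> exp (2 * (t - u)) * ((\<Sum>\<^sub>\<infinity>n. G e u n) + C)"
        unfolding C_def by (rule G_gronwall[OF e c(1) u0 u(2) c(2)]) (use u in auto)
      also have "\<dots> \<le> E * ((\<Sum>\<^sub>\<infinity>n. G e u n) + C)"
        unfolding E_def using u by (intro mult_right_mono G0) auto
      finally have "inverse E * ((\<Sum>\<^sub>\<infinity>n. G e t n) + C) \<le> inverse E * (E * ((\<Sum>\<^sub>\<infinity>n. G e u n) + C))"
        using E0 by (intro mult_left_mono) auto
      also have "\<dots> = (\<Sum>\<^sub>\<infinity>n. G e u n) + C" using E0 by simp
      finally show ?thesis unfolding A_def by simp
    qed
    \<comment> \<open>\<open>Ent_deriv\<close> only asserts that a suitable derivative exists, while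
      the monotonicity lemma takes it as a function of time.\<close>
    define D where "D u = (SOME D. (Ent e has_real_derivative D) (at u within {t0..}) \<and> D \<le> - m * (\<Sum>\<^sub>\<infinity>n. G e u n) + 2)" for u
    have D: "(Ent e has_real_derivative D u) (at u within {t0..})" "D u \<le> - m * (\<Sum>\<^sub>\<infinity>n. G e u n) + 2"
      if "s \<le> u" "u \<le> t" for u
      using someI_ex[OF Ent_deriv[OF _ e _ am[OF that]]] that s m unfolding D_def by auto
    have "Ent e t + (m * A - 2) * t \<le> Ent e s + (m * A - 2) * s"
    proof (rule has_derivative_within_antimono[where S = "{t0..}" and f' = "\<lambda>u. D u + (m * A - 2)"
          and f = "\<lambda>u. Ent e u + (m * A - 2) * u"])
      fix u assume u: "s \<le> u" "u \<le> t"
      show "((\<lambda>u. Ent e u + (m * A - 2) * u) has_real_derivative D u + (m * A - 2)) (at u within {t0..})"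
        by (intro DERIV_add D(1)[OF u] DERIV_cmult_Id)
      have "m * A \<le> m * (\<Sum>\<^sub>\<infinity>n. G e u n)" using A[OF u] m by simp
      then show "D u + (m * A - 2) \<le> 0" using D(2)[OF u] by simp
    qed (use s in auto)
    moreover have "H \<le> Ent e t" "Ent e s \<le> 2"
      using Ent_bounds[of t e] Ent_bounds[of s e] s e by (auto simp: H_def)
    ultimately have "A * (m * (t - s)) \<le> 2 * (t - s) + 2 - H" by (simp add: algebra_simps)
    then have "A \<le> (2 * (t - s) + 2 - H) / (m * (t - s))"
      using m s by (simp add: pos_le_divide_eq)
    then have "E * (A + C) \<le> E * ((2 * (t - s) + 2 - H) / (m * (t - s)) + C)"
      by (intro mult_left_mono) (auto simp: E_def)
    moreover have "E * (A + C) = (\<Sum>\<^sub>\<infinity>n. G e t n) + C" using E0 by (simp add: A_def)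
    ultimately show ?thesis by (simp add: C_def)
  qed
  then show ?thesis by blast
qed

text \<open>Fatou's lemma by hand: a finite partial sum is the limit of its regularisations, each of
  which is below the uniform bound.\<close>

lemma G_zero_summable:
  assumes t: "t0 \<le> t" and pos: "\<And>n. p t n > 0"
    and B: "\<And>e. 0 < e \<Longrightarrow> e \<le> 1 \<Longrightarrow> (\<Sum>\<^sub>\<infinity>n. G e t n) \<le> B"
  shows "finite F \<Longrightarrow> sum (G 0 t) F \<le> B" "G 0 t summable_on UNIV"
proof -
  have fin: "sum (G 0 t) F \<le> B" if F: "finite F" for F
  proof (rule tendsto_upperbound)
    have "((\<lambda>e. G e t n) \<longlongrightarrow> G 0 t n) (at_right 0)" for n
    proof -
      have id: "((\<lambda>e. p t k + e) \<longlongrightarrow> p t k) (at_right 0)" for k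
        by (auto intro!: tendsto_eq_intros)
      have ln: "((\<lambda>e. ln (p t k + e)) \<longlongrightarrow> ln (p t k)) (at_right 0)" for k
        by (rule tendsto_ln[OF id]) (use pos[of k] in simp)
      have "((\<lambda>e. G e t n) \<longlongrightarrow> (p t (n + 1) - p t n) * (ln (p t (n + 1)) - ln (p t n))) (at_right 0)"
        unfolding G_def gap_def by (intro tendsto_mult tendsto_diff id ln)
      then show ?thesis by (simp add: G_def gap_def)
    qed
    then show "((\<lambda>e. sum (G e t) F) \<longlongrightarrow> sum (G 0 t) F) (at_right 0)"
      by (intro tendsto_sum)
    have "\<forall>\<^sub>F e in at_right (0::real). 0 < e \<and> e < 1"
      by (auto simp: eventually_at_right_field intro!: exI[of _ 1])
    then show "\<forall>\<^sub>F e in at_right 0. sum (G e t) F \<le> B"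
    proof eventually_elim
      case (elim e)
      then have "sum (G e t) F \<le> infsum (G e t) UNIV"
        using P_range(2)[OF t, of e] by (intro finite_sum_le_infsum G_summable t F G_nonneg) auto
      then show ?case using B[of e] elim by simp
    qed
  qed simp
  then show "finite F \<Longrightarrow> sum (G 0 t) F \<le> B" .
  show "G 0 t summable_on UNIV"
    by (rule nonneg_bdd_above_summable_on) (use pos fin in \<open>auto intro!: G_nonneg bdd_aboveI2\<close>)
qed

lemma gap_summable: assumes "t > t0" shows "G 0 t summable_on UNIV"
proof -
  obtain B where "\<And>e. 0 < e \<Longrightarrow> e \<le> 1 \<Longrightarrow> (\<Sum>\<^sub>\<infinity>n. G e t n) \<le> B"
    using G_sum_bounded[OF assms] by blast
  then show ?thesis using G_zero_summable(2)[of t B] p_pos[OF assms] assms by auto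
qed

text \<open>A bound on the sums that is uniform in time does not yet give one majorant for all
  times. Integrating \<open>dG_le\<close> does: each gap is at most its value at \<open>s\<close>
  plus the time integral of \<open>h n\<close>, and finite sums of these integrals are controlled by
  the uniform bound under the integral sign. \<open>gap_shift_le\<close> compares the regularised
  sum at time \<open>s\<close> with the plain one.\<close>

lemma gap_majorant:
  assumes s: "t0 \<le> s" "s < T" and pos: "\<And>n. p s n > 0" and sm: "G 0 s summable_on UNIV"
  shows "\<exists>M. M summable_on UNIV \<and> (\<forall>t n. s \<le> t \<longrightarrow> t \<le> T \<longrightarrow> G 0 t n \<le> M n)"
proof -
  have post: "p t n > 0" if "s \<le> t" for t n
    using p_pos[of t n] pos[of n] s that by (cases "s = t") auto
  obtain c0 where c0: "c0 > 0" "\<And>u k. s \<le> u \<Longrightarrow> u \<le> T \<Longrightarrow> k \<in> {-1, 0, 1} \<Longrightarrow> c0 \<le> p u k"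
    using p_lower_bound[of s T] pos s by auto
  define C where "C = 2 * \<bar>ln c0\<bar> + 3"
  define B where "B = exp (2 * (T - s)) * (infsum (G 0 s) UNIV + C)"
  have GB: "(\<Sum>\<^sub>\<infinity>n. G e t n) \<le> B" if t: "s \<le> t" "t \<le> T" and e: "0 < e" "e \<le> 1" for e t
  proof -
    have "(\<Sum>\<^sub>\<infinity>n. G e s n) \<le> infsum (G 0 s) UNIV"
    proof (rule infsum_mono[OF G_summable[OF s(1) e] sm])
      show "G e s n \<le> G 0 s n" for n
        using gap_shift_le[OF pos[of "n + 1"] pos[of n], of e] e by (simp add: G_def)
    qed
    moreover have "0 \<le> (\<Sum>\<^sub>\<infinity>n. G e s n)"
      by (intro infsum_nonneg G_nonneg) (use P_range(2)[OF s(1) e] in auto)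
    moreover have "C \<ge> 0" by (simp add: C_def)
    ultimately have "exp (2 * (t - s)) * ((\<Sum>\<^sub>\<infinity>n. G e s n) + C) \<le> B"
      unfolding B_def using t by (intro mult_mono) auto
    moreover have "(\<Sum>\<^sub>\<infinity>n. G e t n) + C \<le> exp (2 * (t - s)) * ((\<Sum>\<^sub>\<infinity>n. G e s n) + C)"
      unfolding C_def by (rule G_gronwall[OF e c0(1) s(1) t(1) c0(2)]) (use t in auto)
    ultimately show ?thesis using \<open>C \<ge> 0\<close> by simp
  qed
  have fin: "sum (G 0 t) F \<le> B" if "s \<le> t" "t \<le> T" "finite F" for t F
    by (rule G_zero_summable(1)[OF _ _ GB]) (use that s post in auto)
  define h where "h n t = G 0 t (n + 1) + G 0 t (n - 1) + (if n \<in> {-1, 0} then C else 0)" for n t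
  have derG: "((\<lambda>u. G 0 u n) has_real_derivative dG 0 t n) (at t within {s..T})" if "s \<le> t" for t n
    by (rule DERIV_subset[OF G_deriv[of t n 0]]) (use that s post[OF that] in auto)
  have contG: "continuous_on {s..T} (\<lambda>t. G 0 t n)" for n
    by (rule DERIV_continuous_on[where D = "\<lambda>t. dG 0 t n"]) (use derG in auto)
  have conth: "continuous_on {s..T} (h n)" for n
    unfolding h_def by (intro continuous_intros contG)
  have G0: "G 0 t n \<ge> 0" if "s \<le> t" for t n
    by (rule G_nonneg) (use post[OF that] in auto)
  have h0: "h n t \<ge> 0" if "s \<le> t" for n t
    unfolding h_def using G0[OF that] by (auto intro!: add_nonneg_nonneg simp: C_def)
  define M where "M n = G 0 s n + integral {s..T} (h n)" for n
  have inth: "h n integrable_on {s..T}" for n by (rule integrable_continuous_real[OF conth])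
  have M0: "M n \<ge> 0" for n
    unfolding M_def using G0[of s n] h0 inth by (intro add_nonneg_nonneg integral_nonneg) auto
  have dom: "G 0 t n \<le> M n" if t: "s \<le> t" "t \<le> T" for t n
    unfolding M_def
  proof (rule le_integral_majorant[OF t derG])
    fix x assume x: "s \<le> x" "x \<le> T"
    show "dG 0 x n \<le> h n x" unfolding h_def C_def
      by (rule dG_le[OF _ _ _ _ c0(1) c0(2)]) (use x s post[OF x(1)] in auto)
    show "0 \<le> h n x" by (rule h0[OF x(1)])
  qed (use conth in auto)
  have "M summable_on UNIV"
  proof (rule nonneg_bdd_above_summable_on)
    show "bdd_above (sum M ` {F. F \<subseteq> UNIV \<and> finite F})"
    proof (rule bdd_aboveI2)
      fix F :: "int set" assume "F \<in> {F. F \<subseteq> UNIV \<and> finite F}"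
      then have F: "finite F" by simp
      have hs: "(\<Sum>n\<in>F. h n t) \<le> 2 * B + 2 * C" if t: "s \<le> t" "t \<le> T" for t
      proof -
        have "(\<Sum>n\<in>F. G 0 t (n + 1)) = sum (G 0 t) ((\<lambda>n. n + 1) ` F)"
          by (subst sum.reindex) auto
        also have "\<dots> \<le> B" by (rule fin[OF t]) (use F in auto)
        finally have 1: "(\<Sum>n\<in>F. G 0 t (n + 1)) \<le> B" .
        have "(\<Sum>n\<in>F. G 0 t (n - 1)) = sum (G 0 t) ((\<lambda>n. n - 1) ` F)"
          by (subst sum.reindex) auto
        also have "\<dots> \<le> B" by (rule fin[OF t]) (use F in auto)
        finally have 2: "(\<Sum>n\<in>F. G 0 t (n - 1)) \<le> B" .
        have "(\<Sum>n\<in>F. if n \<in> {-1, 0} then C else 0) = (\<Sum>n\<in>F \<inter> {-1, 0}. C)"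
          by (rule sum.inter_restrict[symmetric]) (rule F)
        also have "\<dots> \<le> (\<Sum>n\<in>{-1, 0::int}. C)"
          by (rule sum_mono2) (auto simp: C_def)
        finally have 3: "(\<Sum>n\<in>F. if n \<in> {-1, 0} then C else 0) \<le> 2 * C" by simp
        show ?thesis using 1 2 3 by (simp add: h_def sum.distrib)
      qed
      have "(\<Sum>n\<in>F. integral {s..T} (h n)) = integral {s..T} (\<lambda>t. \<Sum>n\<in>F. h n t)"
        by (rule integral_sum[symmetric]) (use F inth in auto)
      also have "\<dots> \<le> integral {s..T} (\<lambda>_. 2 * B + 2 * C)"
        by (rule integral_le) (use hs F inth in \<open>auto intro!: integrable_sum\<close>)
      also have "\<dots> = (2 * B + 2 * C) * (T - s)" using s by simp
      finally show "sum M F \<le> B + (2 * B + 2 * C) * (T - s)"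
        using fin[of s F] F s by (simp add: M_def sum.distrib)
    qed
  qed (rule M0)
  then show ?thesis using dom by blast
qed

end

section \<open>The equilibrium\<close>

text \<open>Multiplying numerator and denominator by the conjugate of the square root removes the
  case distinction at \<mu> = 1.\<close>

lemma p0_star_altdef:
  assumes "\<mu> > 0" "\<nu> > 0"
  shows "p0_star \<mu> \<nu> = 1 / (2 * (\<mu> * (\<nu> + 1 / 2) + sqrt (\<mu>\<^sup>2 * \<nu>\<^sup>2 + \<mu>\<^sup>2 * \<nu> + 1 / 4)))"
proof -
  define A where "A = \<mu> * (\<nu> + 1 / 2)"
  define S where "S = sqrt (\<mu>\<^sup>2 * \<nu>\<^sup>2 + \<mu>\<^sup>2 * \<nu> + 1 / 4)"
  have S2: "S * S = A * A - (\<mu>\<^sup>2 - 1) / 4"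
    using assms by (simp add: S_def A_def power2_eq_square algebra_simps) (simp add: field_simps)
  have AS: "A > 0" "S \<ge> 0" using assms by (auto simp: A_def S_def)
  show ?thesis
  proof (cases "\<mu> = 1")
    case True
    then have "S * S = A * A" using S2 by simp
    then have "S = A" using AS by (metis abs_of_nonneg abs_of_pos power2_eq_iff power2_eq_square real_sqrt_abs)
    then have "2 * (A + S) = 4 * \<nu> + 2" using True by (simp add: A_def)
    moreover have "p0_star \<mu> \<nu> = 1 / (4 * \<nu> + 2)" using True by (simp add: p0_star_def)
    ultimately show ?thesis unfolding A_def[symmetric] S_def[symmetric] by simp
  next
    case False
    then have m: "\<mu>\<^sup>2 - 1 \<noteq> 0" using assms by (simp add: power2_eq_1_iff)
    have "(A - S) * (2 * (A + S)) = 2 * (A * A - S * S)" by (simp add: algebra_simps)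
    also have "\<dots> = 1 * ((\<mu>\<^sup>2 - 1) / 2)" unfolding S2 by simp
    finally have "(A - S) * (2 * (A + S)) = 1 * ((\<mu>\<^sup>2 - 1) / 2)" .
    then have "(A - S) / ((\<mu>\<^sup>2 - 1) / 2) = 1 / (2 * (A + S))"
      using m AS by (subst frac_eq_eq) auto
    then show ?thesis using False by (simp add: p0_star_def A_def[symmetric] S_def[symmetric])
  qed
qed

text \<open>The quadratic results from the equilibrium relations by eliminating \<open>r\<close> and
  \<open>d\<close>. The two bounds single out its root \<open>p0_star\<close>; the second one says
  that \<open>d_star\<close> is positive.\<close>

lemma p0_star_props:
  assumes "\<mu> > 0" "\<nu> > 0"
  shows "p0_star \<mu> \<nu> > 0" "(1 + \<mu>) * p0_star \<mu> \<nu> < 1"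
    "(\<mu>\<^sup>2 - 1) * (p0_star \<mu> \<nu>)\<^sup>2 - 4 * \<mu> * (\<nu> + 1 / 2) * p0_star \<mu> \<nu> + 1 = 0"
proof -
  define A where "A = \<mu> * (\<nu> + 1 / 2)"
  define S where "S = sqrt (\<mu>\<^sup>2 * \<nu>\<^sup>2 + \<mu>\<^sup>2 * \<nu> + 1 / 4)"
  define u where "u = A + S"
  have S2: "S * S = A * A - (\<mu>\<^sup>2 - 1) / 4"
    using assms by (simp add: S_def A_def power2_eq_square algebra_simps) (simp add: field_simps)
  have "sqrt (1 / 4) \<le> S" unfolding S_def using assms by (intro real_sqrt_le_mono) auto
  then have S: "S \<ge> 1 / 2" by (simp add: real_sqrt_divide)
  have Agt: "2 * A > \<mu>" using assms by (simp add: A_def algebra_simps)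
  then have u: "2 * u > 1 + \<mu>" "u > 0" using S assms by (auto simp: u_def)
  have q: "p0_star \<mu> \<nu> = 1 / (2 * u)"
    using p0_star_altdef[OF assms] by (simp add: u_def A_def S_def)
  show "p0_star \<mu> \<nu> > 0" using q u by simp
  show "(1 + \<mu>) * p0_star \<mu> \<nu> < 1" using q u by simp
  have "(\<mu>\<^sup>2 - 1) / 4 - 2 * A * u + u * u = 0"
    using S2 by (simp add: u_def algebra_simps)
  then have "0 = ((\<mu>\<^sup>2 - 1) / 4 - 2 * A * u + u * u) / (u * u)" by simp
  also have "((\<mu>\<^sup>2 - 1) / 4 - 2 * A * u + u * u) / (u * u)
      = (\<mu>\<^sup>2 - 1) * (1 / (2 * u))\<^sup>2 - 4 * A * (1 / (2 * u)) + 1"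
    using u by (simp add: field_simps power2_eq_square)
  finally show "(\<mu>\<^sup>2 - 1) * (p0_star \<mu> \<nu>)\<^sup>2 - 4 * \<mu> * (\<nu> + 1 / 2) * p0_star \<mu> \<nu> + 1 = 0"
    unfolding q A_def mult.assoc by (rule sym)
qed

lemma rd_star_props:
  assumes "\<mu> > 0" "\<nu> > 0"
  shows "r_star \<mu> \<nu> > 0" "d_star \<mu> \<nu> > 0" "r_star \<mu> \<nu> + p0_star \<mu> \<nu> + d_star \<mu> \<nu> = 1"
proof -
  note q = p0_star_props[OF assms]
  have "\<mu> * p0_star \<mu> \<nu> > 0" using q assms by simp
  moreover define X where "X = \<mu> * p0_star \<mu> \<nu>"
  moreover have "r_star \<mu> \<nu> = (X - p0_star \<mu> \<nu> + 1) / 2" "d_star \<mu> \<nu> = (1 - p0_star \<mu> \<nu> - X) / 2"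
    by (simp_all add: r_star_def d_star_def X_def field_simps)
  moreover have "p0_star \<mu> \<nu> + X < 1" using q(2) by (simp add: X_def distrib_right)
  ultimately show "r_star \<mu> \<nu> > 0" "d_star \<mu> \<nu> > 0"
    using q(1) by auto
qed (simp add: d_star_def)

definition rho_star :: "real \<Rightarrow> real \<Rightarrow> real" where
  "rho_star \<mu> \<nu> = r_star \<mu> \<nu> / (r_star \<mu> \<nu> + p0_star \<mu> \<nu>)"
definition delta_star :: "real \<Rightarrow> real \<Rightarrow> real" where
  "delta_star \<mu> \<nu> = d_star \<mu> \<nu> / (d_star \<mu> \<nu> + p0_star \<mu> \<nu>)"

lemma rho_delta_star:
  assumes "\<mu> > 0" "\<nu> > 0"
  shows "0 < rho_star \<mu> \<nu>" "rho_star \<mu> \<nu> < 1" "0 < delta_star \<mu> \<nu>" "delta_star \<mu> \<nu> < 1"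
  using p0_star_props[OF assms] rd_star_props[OF assms] by (auto simp: rho_star_def delta_star_def)

text \<open>At each site at least one exponent is 0, so a single product covers both halves and its
  logarithm is piecewise linear.\<close>

lemma p_star_altdef:
  "p_star \<mu> \<nu> n = rho_star \<mu> \<nu> ^ nat (max n 0) * delta_star \<mu> \<nu> ^ nat (max (- n) 0) * p0_star \<mu> \<nu>"
  by (auto simp: p_star_def rho_star_def delta_star_def max_def)

lemma p_star_pos: "\<mu> > 0 \<Longrightarrow> \<nu> > 0 \<Longrightarrow> p_star \<mu> \<nu> n > 0"
  unfolding p_star_altdef using p0_star_props rho_delta_star by (intro mult_pos_pos zero_less_power) auto

lemma ln_p_star:
  assumes "\<mu> > 0" "\<nu> > 0"
  shows "ln (p_star \<mu> \<nu> n) = of_int (max n 0) * ln (rho_star \<mu> \<nu>)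
    + of_int (max (- n) 0) * ln (delta_star \<mu> \<nu>) + ln (p0_star \<mu> \<nu>)"
  unfolding p_star_altdef
  using p0_star_props[OF assms] rho_delta_star[OF assms] by (simp add: ln_mult ln_realpow)

lemma p_star_has_sum:
  assumes "\<mu> > 0" "\<nu> > 0"
  shows "(p_star \<mu> \<nu> has_sum 1) UNIV"
proof -
  define q x y where "q = p0_star \<mu> \<nu>" and "x = rho_star \<mu> \<nu>" and "y = delta_star \<mu> \<nu>"
  have xy: "0 < x" "x < 1" "0 < y" "y < 1" using rho_delta_star[OF assms] by (auto simp: x_def y_def)
  have geo: "((\<lambda>n::nat. z ^ n * q) has_sum (q / (1 - z))) UNIV" if "0 < z" "z < 1" for z
  proof (rule sums_nonneg_imp_has_sum)
    show "(\<lambda>n. z ^ n * q) sums (q / (1 - z))"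
      using sums_mult2[OF geometric_sums[of z], of q] that by simp
    show "\<And>n. 0 \<le> z ^ n * q" using that p0_star_props(1)[OF assms] by (simp add: q_def)
  qed
  have 1: "(p_star \<mu> \<nu> has_sum (q / (1 - x))) {0..}"
    unfolding has_sum_int_nat using geo[OF xy(1,2)]
    by (simp add: p_star_altdef x_def q_def)
  have 2: "(p_star \<mu> \<nu> has_sum (q / (1 - y))) {..0}"
    unfolding has_sum_int_nat using geo[OF xy(3,4)]
    by (simp add: p_star_altdef y_def q_def)
  have "(p_star \<mu> \<nu> has_sum q) {0}"
    by (rule has_sum_finiteI) (auto simp: p_star_altdef q_def)
  then have "(p_star \<mu> \<nu> has_sum (q / (1 - y) - q)) ({..0} - {0})"
    by (intro has_sum_Diff[OF 2]) auto
  moreover have "({..0::int} - {0}) = {..-1}" by auto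
  ultimately have 3: "(p_star \<mu> \<nu> has_sum (q / (1 - y) - q)) {..-1}" by simp
  have "(p_star \<mu> \<nu> has_sum (q / (1 - x) + (q / (1 - y) - q))) ({0..} \<union> {..-1})"
    by (rule has_sum_Un_disjoint[OF 1 3]) auto
  moreover have "{0..} \<union> {..-1::int} = UNIV" by auto
  moreover have "q / (1 - x) + (q / (1 - y) - q) = 1"
  proof -
    note P = p0_star_props(1)[OF assms] rd_star_props[OF assms]
    have "1 - x = q / (r_star \<mu> \<nu> + q)" "1 - y = q / (d_star \<mu> \<nu> + q)"
      using P by (simp_all add: x_def y_def rho_star_def delta_star_def q_def field_simps)
    then have "q / (1 - x) = r_star \<mu> \<nu> + q" "q / (1 - y) = d_star \<mu> \<nu> + q"
      using P(1) by (simp_all add: q_def)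
    then show ?thesis using P(4) by (simp add: q_def)
  qed
  ultimately show ?thesis by simp
qed

section \<open>The gap with values in the extended reals\<close>

lemma has_sum_ereal:
  fixes f :: "'a \<Rightarrow> real"
  assumes "(f has_sum S) A"
  shows "((\<lambda>x. ereal (f x)) has_sum ereal S) A"
proof -
  have "((\<lambda>F. ereal (sum f F)) \<longlongrightarrow> ereal S) (finite_subsets_at_top A)"
    using assms unfolding has_sum_def by (intro tendsto_ereal)
  moreover have "(\<lambda>F. ereal (sum f F)) = sum (\<lambda>x. ereal (f x))"
    by (simp add: fun_eq_iff sum_ereal)
  ultimately show ?thesis unfolding has_sum_def by simp
qed

lemma infsum_ereal:
  fixes f :: "'a \<Rightarrow> real"
  assumes "f summable_on A"
  shows "(\<Sum>\<^sub>\<infinity>x\<in>A. ereal (f x)) = ereal (infsum f A)"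
  by (rule infsumI, rule has_sum_ereal) (use assms in simp)

lemma log_gap_pos: "x > 0 \<Longrightarrow> y > 0 \<Longrightarrow> log_gap x y = ereal (gap x y)"
  by (simp add: log_gap_def gap_def ln_div)

lemma log_gap_nonneg: "x \<ge> 0 \<Longrightarrow> y \<ge> 0 \<Longrightarrow> log_gap x y \<ge> 0"
  using gap_nonneg[of x y] log_gap_pos[of x y] by (cases "x = 0 \<or> y = 0") (auto simp: log_gap_def)

lemma log_gap_scale:
  assumes "c > 0" "x \<ge> 0" "y \<ge> 0"
  shows "ereal c * log_gap x y = log_gap (c * x) (c * y)"
proof (cases "x = 0 \<or> y = 0")
  case False
  then have "x > 0" "y > 0" using assms by auto
  then show ?thesis using assms by (simp add: log_gap_pos gap_def ln_mult algebra_simps)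
qed (use assms in \<open>auto simp: log_gap_def\<close>)

text \<open>If exactly one limit is 0, the logarithm diverges while the difference stays away from
  0. Two zero limits are excluded because the gap may then tend to anything.\<close>

lemma tendsto_log_gap:
  assumes x: "(x \<longlongrightarrow> x0) F" and y: "(y \<longlongrightarrow> y0) F"
    and pos: "eventually (\<lambda>s. x s > 0 \<and> y s > 0) F"
    and nn: "x0 \<ge> 0" "y0 \<ge> 0" "x0 > 0 \<or> y0 > 0"
  shows "((\<lambda>s. log_gap (x s) (y s)) \<longlongrightarrow> log_gap x0 y0) F"
proof -
  have ev: "eventually (\<lambda>s. log_gap (x s) (y s) = ereal (gap (x s) (y s))) F"
    using pos by eventually_elim (simp add: log_gap_pos)
  have inf: "filterlim (\<lambda>s. gap (u s) (v s)) at_top F"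
    if u: "(u \<longlongrightarrow> 0) F" and v: "(v \<longlongrightarrow> v0) F" and v0: "v0 > 0"
      and up: "eventually (\<lambda>s. u s > 0) F" for u v :: "'a \<Rightarrow> real" and v0
  proof -
    have "filterlim (\<lambda>s. ln (u s)) at_bot F"
      by (rule filterlim_compose[OF ln_at_0 tendsto_imp_filterlim_at_right[OF u up]])
    then have "filterlim (\<lambda>s. - ln (u s)) at_top F" by (simp add: filterlim_uminus_at_bot)
    then have "filterlim (\<lambda>s. ln (v s) + - ln (u s)) at_top F"
      using v v0 by (intro filterlim_tendsto_add_at_top[OF tendsto_ln[OF v]]) auto
    then have "filterlim (\<lambda>s. (v s - u s) * (ln (v s) + - ln (u s))) at_top F"
      using tendsto_diff[OF v u] v0 by (intro filterlim_tendsto_pos_mult_at_top[where c = "v0 - 0"]) auto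
    then show ?thesis by (simp add: gap_def algebra_simps)
  qed
  show ?thesis
  proof (cases "x0 > 0 \<and> y0 > 0")
    case True
    have "((\<lambda>s. gap (x s) (y s)) \<longlongrightarrow> gap x0 y0) F"
      unfolding gap_def using True by (intro tendsto_intros x y) auto
    then show ?thesis using ev True by (simp add: tendsto_cong log_gap_pos)
  next
    case False
    then have inf0: "log_gap x0 y0 = \<infinity>" using nn by (auto simp: log_gap_def)
    have "filterlim (\<lambda>s. gap (x s) (y s)) at_top F"
    proof (cases "x0 = 0")
      case True
      then show ?thesis using inf[of x y y0] x y nn eventually_mono[OF pos] by auto
    next
      case 2: False
      then have "filterlim (\<lambda>s. gap (y s) (x s)) at_top F"
        using inf[of y x x0] x y nn eventually_mono[OF pos] False by auto
      then show ?thesis by (simp add: gap_commute)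
    qed
    then have "((\<lambda>s. ereal (gap (x s) (y s))) \<longlongrightarrow> \<infinity>) F" by (simp add: tendsto_PInfty_eq_at_top)
    then show ?thesis using ev inf0 by (simp add: tendsto_cong)
  qed
qed

text \<open>Expanding \<open>ln (c * y)\<close> leaves multiples of
  \<open>y * \<bar>ln x - ln y\<bar>\<close> and of \<open>x + c * y\<close>, both under control.
  The purpose is to strip the jump rates from the arguments of a gap.\<close>

lemma gap_rescale_le:
  assumes "c > 0"
  shows "\<exists>K\<ge>0. \<forall>x y. x > 0 \<longrightarrow> y > 0 \<longrightarrow> gap x (c * y) \<le> K * (gap x y + x + y)"
proof -
  define K where "K = 1 + 2 * \<bar>1 - c\<bar> + \<bar>ln c\<bar> * (1 + c)"
  have "gap x (c * y) \<le> K * (gap x y + x + y)" if xy: "x > 0" "y > 0" for x y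
  proof -
    define l where "l = ln x - ln y"
    have "gap x (c * y) = (x - y) * l + (1 - c) * (y * l) - ln c * (x - c * y)"
      using assms xy by (simp add: gap_def l_def ln_mult algebra_simps)
    also have "\<dots> = gap x y + (1 - c) * (y * l) - ln c * (x - c * y)"
      by (simp add: gap_def l_def)
    also have "\<dots> \<le> gap x y + \<bar>1 - c\<bar> * (y * \<bar>l\<bar>) + \<bar>ln c\<bar> * (x + c * y)"
    proof -
      have "(1 - c) * (y * l) \<le> \<bar>1 - c\<bar> * (y * \<bar>l\<bar>)"
        using xy abs_ge_self[of "(1 - c) * (y * l)"] by (simp add: abs_mult)
      moreover have "- (ln c * (x - c * y)) \<le> \<bar>ln c\<bar> * (x + c * y)"
      proof -
        have "- (ln c * (x - c * y)) \<le> \<bar>ln c\<bar> * \<bar>x - c * y\<bar>"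
          using abs_ge_minus_self[of "ln c * (x - c * y)"] by (simp add: abs_mult)
        also have "\<dots> \<le> \<bar>ln c\<bar> * (x + c * y)"
        proof (intro mult_left_mono)
          have "0 \<le> c * y" using xy assms by simp
          then show "\<bar>x - c * y\<bar> \<le> x + c * y" using xy by linarith
        qed simp
        finally show ?thesis .
      qed
      ultimately show ?thesis by linarith
    qed
    also have "\<dots> \<le> gap x y + \<bar>1 - c\<bar> * (2 * (gap x y + x + y)) + \<bar>ln c\<bar> * ((1 + c) * (gap x y + x + y))"
    proof (intro add_mono mult_left_mono order_refl)
      have g: "gap x y \<ge> 0" by (rule gap_nonneg[OF xy])
      show "y * \<bar>l\<bar> \<le> 2 * (gap x y + x + y)"
        using mult_ln_diff_le'[OF xy] xy by (simp add: l_def)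
      have "x + c * y \<le> (x + y + gap x y) + c * (gap x y + x + y)"
        using xy g assms by (intro add_mono mult_left_mono) auto
      then show "x + c * y \<le> (1 + c) * (gap x y + x + y)" by (simp add: algebra_simps)
    qed auto
    also have "\<dots> \<le> K * (gap x y + x + y)"
      using xy by (simp add: K_def algebra_simps)
    finally show ?thesis .
  qed
  moreover have "K \<ge> 0" using assms by (auto simp: K_def)
  ultimately show ?thesis by blast
qed

section \<open>Entropy dissipation\<close>

lemma finite_sum_le_infsum_ereal:
  fixes f :: "'a \<Rightarrow> ereal"
  assumes "\<And>x. x \<in> A \<Longrightarrow> f x \<ge> 0" "finite F" "F \<subseteq> A"
  shows "sum f F \<le> infsum f A"
  by (subst nonneg_infsum_complete) (use assms in \<open>auto intro!: SUP_upper\<close>)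

section \<open>Relative entropy and its derivative\<close>

context phase2
begin

abbreviation ps :: "int \<Rightarrow> real" where "ps \<equiv> p_star \<mu> \<nu>"

definition L :: "int \<Rightarrow> real" where "L n = ln (ps n)"

definition LK :: real where
  "LK = \<bar>ln (rho_star \<mu> \<nu>)\<bar> + \<bar>ln (delta_star \<mu> \<nu>)\<bar> + \<bar>ln (p0_star \<mu> \<nu>)\<bar>"

lemma L_bound: "\<bar>L n\<bar> \<le> LK * (1 + real_of_int \<bar>n\<bar>)"
proof -
  have "\<bar>L n\<bar> \<le> \<bar>of_int (max n 0) * ln (rho_star \<mu> \<nu>)\<bar> + \<bar>of_int (max (- n) 0) * ln (delta_star \<mu> \<nu>)\<bar>
      + \<bar>ln (p0_star \<mu> \<nu>)\<bar>"
    unfolding L_def ln_p_star[OF mu_pos nu_pos]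
    by (rule order_trans[OF abs_triangle_ineq add_right_mono[OF abs_triangle_ineq]])
  also have "\<dots> \<le> (1 + real_of_int \<bar>n\<bar>) * \<bar>ln (rho_star \<mu> \<nu>)\<bar> + (1 + real_of_int \<bar>n\<bar>) * \<bar>ln (delta_star \<mu> \<nu>)\<bar>
      + (1 + real_of_int \<bar>n\<bar>) * \<bar>ln (p0_star \<mu> \<nu>)\<bar>"
  proof (intro add_mono)
    show "\<bar>real_of_int (max n 0) * ln (rho_star \<mu> \<nu>)\<bar> \<le> (1 + real_of_int \<bar>n\<bar>) * \<bar>ln (rho_star \<mu> \<nu>)\<bar>"
      "\<bar>real_of_int (max (- n) 0) * ln (delta_star \<mu> \<nu>)\<bar> \<le> (1 + real_of_int \<bar>n\<bar>) * \<bar>ln (delta_star \<mu> \<nu>)\<bar>"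
      unfolding abs_mult by (rule mult_right_mono; auto)+
    have "1 * \<bar>ln (p0_star \<mu> \<nu>)\<bar> \<le> (1 + real_of_int \<bar>n\<bar>) * \<bar>ln (p0_star \<mu> \<nu>)\<bar>"
      by (rule mult_right_mono) auto
    then show "\<bar>ln (p0_star \<mu> \<nu>)\<bar> \<le> (1 + real_of_int \<bar>n\<bar>) * \<bar>ln (p0_star \<mu> \<nu>)\<bar>" by simp
  qed
  also have "\<dots> = LK * (1 + real_of_int \<bar>n\<bar>)" by (simp add: LK_def algebra_simps)
  finally show ?thesis .
qed

lemma L_step: "n \<ge> 0 \<Longrightarrow> L (n + 1) - L n = ln (rho_star \<mu> \<nu>)"
  "n < 0 \<Longrightarrow> L (n + 1) - L n = - ln (delta_star \<mu> \<nu>)"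
proof -
  assume "n \<ge> 0"
  then have "max (n + 1) 0 = n + 1" "max n 0 = n" "max (- (n + 1)) 0 = 0" "max (- n) 0 = 0" by auto
  then show "L (n + 1) - L n = ln (rho_star \<mu> \<nu>)"
    unfolding L_def ln_p_star[OF mu_pos nu_pos] by (simp add: algebra_simps)
next
  assume "n < 0"
  then have "max (n + 1) 0 = 0" "max n 0 = 0" "max (- (n + 1)) 0 = - n - 1" "max (- n) 0 = - n" by auto
  then show "L (n + 1) - L n = - ln (delta_star \<mu> \<nu>)"
    unfolding L_def ln_p_star[OF mu_pos nu_pos] by (simp add: algebra_simps)
qed

lemma entropy_term: "t \<ge> t0 \<Longrightarrow> rel_entropy_term (p t) ps n = xlnx (p t n) - L n * p t n"
  using p_nonneg[of t n] p_star_pos[OF mu_pos nu_pos, of n]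
  by (cases "p t n = 0") (auto simp: rel_entropy_term_def xlnx_def L_def ln_div algebra_simps)

lemma entropy_summable: assumes t: "t \<ge> t0" shows "rel_entropy_term (p t) ps summable_on UNIV"
proof -
  have "(\<lambda>n. LK * (1 + real_of_int \<bar>n\<bar>) * p t n) summable_on UNIV"
    using summable_on_cmult_right[OF first_moment[OF t], of LK] by (simp add: mult.assoc)
  from weighted_summable[OF L_bound t this]
  have "(\<lambda>n. xlnx (p t n) - L n * p t n) summable_on UNIV"
    by (intro summable_on_real_diff xlnx_summable t)
  then show ?thesis by (simp add: entropy_term[OF t] cong: summable_on_cong)
qed

definition H :: "real \<Rightarrow> real" where "H t = rel_entropy (p t) ps"

lemma H_altdef: "t \<ge> t0 \<Longrightarrow> H t = (\<Sum>\<^sub>\<infinity>n. xlnx (p t n) - L n * p t n)"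
  by (simp add: H_def rel_entropy_def entropy_term)

text \<open>By homogeneity, the prefactors of the two dissipation series can be moved into the arguments,
  which then are the two one-way fluxes across an edge.\<close>

definition Tm :: "real \<Rightarrow> int \<Rightarrow> ereal" where
  "Tm t n = log_gap (dr t (n + 1) * p t (n + 1)) (b t * p t n)"

lemma Tm_nonneg: "t \<ge> t0 \<Longrightarrow> Tm t n \<ge> 0"
  unfolding Tm_def by (intro log_gap_nonneg rate_bounds)

lemma dissipation_eq:
  assumes t: "t \<ge> t0"
  shows "dissipation (p t) = infsum (Tm t) {0..} + infsum (Tm t) {..-1}"
proof -
  note rd = r_pos[OF t] d_pos[OF t] R_pos[OF t] D_pos[OF t] p_nonneg[OF t]
  have "(\<Sum>\<^sub>\<infinity>n\<in>{0..}. ereal (r t) * log_gap (p t (n + 1) / r t) (p t n / (r t + p t 0))) = infsum (Tm t) {0..}"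
  proof (rule infsum_cong)
    fix n :: int assume "n \<in> {0..}"
    then have "dr t (n + 1) = 1" by (simp add: dr_def)
    then show "ereal (r t) * log_gap (p t (n + 1) / r t) (p t n / (r t + p t 0)) = Tm t n"
      using rd by (subst log_gap_scale) (auto simp: Tm_def b_def)
  qed
  moreover have "(\<Sum>\<^sub>\<infinity>n\<in>{..-1}. ereal (r t * d t / (r t + p t 0)) *
      log_gap (p t (n + 1) / (d t + p t 0)) (p t n / d t)) = infsum (Tm t) {..-1}"
  proof (rule infsum_cong)
    fix n :: int assume "n \<in> {..-1}"
    then have "dr t (n + 1) = a t" by (simp add: dr_def)
    then show "ereal (r t * d t / (r t + p t 0)) * log_gap (p t (n + 1) / (d t + p t 0)) (p t n / d t) = Tm t n"
      using rd by (subst log_gap_scale) (auto simp: Tm_def b_def a_def)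
  qed
  ultimately show ?thesis
    by (simp add: dissipation_def Let_def r_def[symmetric] d_def[symmetric])
qed

lemma dissipation_nonneg: "t \<ge> t0 \<Longrightarrow> dissipation (p t) \<ge> 0"
  unfolding dissipation_eq by (intro add_nonneg_nonneg infsum_nonneg Tm_nonneg)

lemma flux_log_summable:
  assumes t: "t \<ge> t0" and pos: "\<And>n. p t n > 0" and sm: "G 0 t summable_on UNIV"
  shows "(\<lambda>n. (ln (p t (n + 1)) - ln (p t n)) * J t n) summable_on A"
proof -
  have "(\<lambda>n. (ln (p t (n + 1)) - ln (p t n)) * J t n) summable_on UNIV"
  proof (rule summable_on_dominated)
    show "(\<lambda>n. 4 * G 0 t n + p t (n + 1) + p t n) summable_on UNIV"
      using t by (intro summable_on_add summable_on_cmult_right sm p_summable summable_on_int_shift(1)) auto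
    fix n
    let ?l = "\<bar>ln (p t (n + 1)) - ln (p t n)\<bar>"
    have "\<bar>(ln (p t (n + 1)) - ln (p t n)) * J t n\<bar> \<le> ?l * (p t n + p t (n + 1))"
      unfolding abs_mult by (intro mult_left_mono J_abs t) auto
    also have "\<dots> \<le> 4 * G 0 t n + p t (n + 1) + p t n"
      using mult_ln_diff_le[OF pos pos, of "n + 1" n] mult_ln_diff_le'[OF pos pos, of n "n + 1"]
      by (simp add: G_def algebra_simps)
    finally show "\<bar>(ln (p t (n + 1)) - ln (p t n)) * J t n\<bar> \<le> 4 * G 0 t n + p t (n + 1) + p t n" .
  qed
  then show ?thesis by (rule summable_on_subset) simp
qed

text \<open>The logarithms of the rates enter through \<open>c\<close>, which is constant on each
  half line and is annihilated by the vanishing flux sums. What remains is the plain pairing of the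
  flux with the increments of \<open>ln p\<close>. As all terms are nonnegative, each one is below
  the total.\<close>

lemma dissipation_finite:
  assumes t: "t \<ge> t0" and pos: "\<And>n. p t n > 0" and sm: "G 0 t summable_on UNIV"
  shows "dissipation (p t) = ereal (- (\<Sum>\<^sub>\<infinity>n. (ln (p t (n + 1)) - ln (p t n)) * J t n))"
    and "\<And>n. gap (dr t (n + 1) * p t (n + 1)) (b t * p t n) \<le> real_of_ereal (dissipation (p t))"
proof -
  define f where "f n = (ln (p t (n + 1)) - ln (p t n)) * J t n" for n
  define c where "c n = ln (dr t (n + 1)) - ln (b t)" for n
  define T where "T n = gap (dr t (n + 1) * p t (n + 1)) (b t * p t n)" for n
  have f: "f summable_on A" for A unfolding f_def by (rule flux_log_summable[OF t pos sm])
  have T: "T n = - f n - c n * J t n" for n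
    using b_pos[OF t] dr_pos[OF t, of "n + 1"] pos[of n] pos[of "n + 1"]
    by (simp add: T_def gap_def f_def c_def J_def ln_mult algebra_simps)
  have T0: "T n \<ge> 0" for n unfolding T_def
    using b_pos[OF t] dr_pos[OF t] pos by (intro gap_nonneg) auto
  have Tm: "Tm t n = ereal (T n)" for n
    unfolding Tm_def T_def using b_pos[OF t] dr_pos[OF t] pos by (intro log_gap_pos) auto
  have cJ: "((\<lambda>n. c n * J t n) has_sum 0) {0..}" "((\<lambda>n. c n * J t n) has_sum 0) {..-1}"
  proof -
    have J1: "(J t has_sum 0) {0..}" "(J t has_sum 0) {..-1}"
      using J_summable[OF t] J_sum_pos[OF t] J_sum_neg[OF t] by (simp_all add: has_sum_iff)
    have "((\<lambda>n. (- ln (b t)) * J t n) has_sum (- ln (b t)) * 0) {0..}"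
      by (rule has_sum_cmult_right[OF J1(1)])
    then show "((\<lambda>n. c n * J t n) has_sum 0) {0..}"
      by (subst has_sum_cong[where g = "\<lambda>n. (- ln (b t)) * J t n"]) (auto simp: c_def dr_def)
    have "((\<lambda>n. (ln (a t) - ln (b t)) * J t n) has_sum (ln (a t) - ln (b t)) * 0) {..-1}"
      by (rule has_sum_cmult_right[OF J1(2)])
    then show "((\<lambda>n. c n * J t n) has_sum 0) {..-1}"
      by (subst has_sum_cong[where g = "\<lambda>n. (ln (a t) - ln (b t)) * J t n"]) (auto simp: c_def dr_def)
  qed
  have sT: "(T has_sum (- infsum f A)) A" if "((\<lambda>n. c n * J t n) has_sum 0) A" for A
  proof -
    have "((\<lambda>n. - f n + - (c n * J t n)) has_sum (- infsum f A + - 0)) A"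
      using f by (intro has_sum_add has_sum_uminusI that) simp
    then show ?thesis by (simp add: T[abs_def])
  qed
  note sT1 = sT[OF cJ(1)] sT[OF cJ(2)]
  have "infsum (Tm t) A = ereal (infsum T A)" if "T summable_on A" for A
    unfolding Tm[abs_def] by (rule infsum_ereal[OF that])
  then have D: "dissipation (p t) = ereal (infsum T {0..} + infsum T {..-1})"
    using sT1 by (simp add: dissipation_eq[OF t] has_sum_iff)
  have "UNIV = {0..} \<union> {..-1::int}" by auto
  moreover have "{0..} \<inter> {..-1::int} = {}" by auto
  ultimately have "infsum f UNIV = infsum f {0..} + infsum f {..-1}"
    using infsum_Un_disjoint[OF f f, of "{0..}" "{..-1}"] by metis
  then show "dissipation (p t) = ereal (- (\<Sum>\<^sub>\<infinity>n. (ln (p t (n + 1)) - ln (p t n)) * J t n))"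
    using D sT1 by (simp add: has_sum_iff flip: f_def)
  fix n
  have "T n \<le> infsum T A" if "n \<in> A" "T summable_on A" for A
    using finite_sum_le_infsum[OF that(2), of "{n}"] that(1) T0 by auto
  moreover have "infsum T A \<ge> 0" for A by (intro infsum_nonneg T0)
  moreover have "n \<in> {0..} \<or> n \<in> {..-1}" by auto
  ultimately have "T n \<le> infsum T {0..} + infsum T {..-1}"
    using sT1 by (metis add_increasing add_increasing2 has_sum_imp_summable)
  then show "gap (dr t (n + 1) * p t (n + 1)) (b t * p t n) \<le> real_of_ereal (dissipation (p t))"
    using D by (simp add: T_def)
qed

text \<open>In a product such as \<open>p (n + 1) * ln (p n)\<close> the logarithm is first
  exchanged for \<open>ln (p (n + 1))\<close>, at the cost of a gap; then Young's bound and the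
  first moment apply. The gap majorant makes this uniform in time.\<close>

lemma log_flux_majorant:
  assumes s: "t0 \<le> s" "s < T" and pos: "\<And>n. p s n > 0" and sm: "G 0 s summable_on UNIV"
  shows "\<exists>M. M summable_on UNIV \<and> (\<forall>u n. s \<le> u \<longrightarrow> u \<le> T \<longrightarrow>
     \<bar>ln (p u n) + 1 - L n\<bar> * (p u (n - 1) + 2 * p u n + p u (n + 1)) \<le> M n)"
proof -
  obtain Mg where Mg: "Mg summable_on UNIV" "\<And>t n. s \<le> t \<Longrightarrow> t \<le> T \<Longrightarrow> G 0 t n \<le> Mg n"
    using gap_majorant[OF s pos sm] by blast
  have T: "t0 \<le> T" using s by simp
  define q where "q n = exp (2 * (T - t0)) * p T n" for n
  have q0: "q n \<ge> 0" for n using p_nonneg[OF T] by (simp add: q_def)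
  define W where "W n = (1 + LK) * (1 + real_of_int \<bar>n\<bar>)" for n :: int
  have LK: "LK \<ge> 0" by (simp add: LK_def)
  have W: "tame 2 W" unfolding W_def by (rule tame_scale[OF tame_linear]) (use LK in simp)
  have q1: "(\<lambda>n. (1 + real_of_int \<bar>n\<bar>) * q n) summable_on UNIV"
    using summable_on_cmult_right[OF first_moment[OF T], of "exp (2 * (T - t0))"]
    by (simp add: q_def mult.left_commute)
  have Wq: "(\<lambda>n. W n * q n) summable_on UNIV"
    using summable_on_cmult_right[OF q1, of "1 + LK"] by (simp add: W_def mult.assoc)
  have qs: "q summable_on UNIV" unfolding q_def by (intro summable_on_cmult_right p_summable T)
  define X where "X n = (1 + real_of_int \<bar>n\<bar>) * q n + exp (- real_of_int \<bar>n\<bar>)" for n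
  have X: "X summable_on UNIV" unfolding X_def by (intro summable_on_add q1 summable_exp_abs)
  define M where "M n = (X (n - 1) + 2 * Mg (n - 1) + q (n - 1)) + 2 * X n + (X (n + 1) + 2 * Mg n + q (n + 1))
     + (W n * q (n - 1) + 2 * (W n * q n) + W n * q (n + 1))" for n
  have "M summable_on UNIV" unfolding M_def
    by (intro summable_on_add summable_on_cmult_right X Mg(1) qs Wq summable_on_int_shift
        shifted_weight_summable(1,2)[OF W q0 Wq])
  moreover have "\<bar>ln (p u n) + 1 - L n\<bar> * (p u (n - 1) + 2 * p u n + p u (n + 1)) \<le> M n"
    if u: "s \<le> u" "u \<le> T" for u n
  proof -
    have u0: "t0 \<le> u" using u s by simp
    have pu: "p u k > 0" for k using p_pos[of u k] pos[of k] u s by (cases "u = s") auto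
    have pq: "p u k \<le> q k" for k using p_majorant[OF u0 u(2)] by (simp add: q_def)
    have xX: "p u k * \<bar>ln (p u k)\<bar> \<le> X k" for k
    proof -
      have "p u k * \<bar>ln (p u k)\<bar> = \<bar>xlnx (p u k)\<bar>" using pu[of k] by (simp add: xlnx_def abs_mult)
      also have "\<dots> \<le> real_of_int \<bar>k\<bar> * p u k + exp (- real_of_int \<bar>k\<bar>)"
        by (rule xlnx_abs_bound[OF p_nonneg[OF u0] p_le_1[OF u0]])
      also have "\<dots> \<le> (1 + real_of_int \<bar>k\<bar>) * q k + exp (- real_of_int \<bar>k\<bar>)"
        using pq[of k] pu[of k] by (intro add_mono mult_mono) auto
      finally show ?thesis by (simp add: X_def)
    qed
    have step: "p u k * \<bar>ln (p u n)\<bar> \<le> X k + (2 * g + q k)"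
      if g: "p u k * \<bar>ln (p u n) - ln (p u k)\<bar> \<le> 2 * g + p u k" for k g
    proof -
      have "p u k * \<bar>ln (p u n)\<bar> \<le> p u k * (\<bar>ln (p u k)\<bar> + \<bar>ln (p u n) - ln (p u k)\<bar>)"
        using pu[of k] by (intro mult_left_mono) auto
      then show ?thesis using xX[of k] g pq[of k] by (simp add: distrib_left)
    qed
    have "p u (n - 1) * \<bar>ln (p u n) - ln (p u (n - 1))\<bar> \<le> 2 * Mg (n - 1) + p u (n - 1)"
      using mult_ln_diff_le'[OF pu pu, of "n - 1" n] Mg(2)[OF u, of "n - 1"] by (simp add: G_def)
    from step[OF this] have 1: "p u (n - 1) * \<bar>ln (p u n)\<bar> \<le> X (n - 1) + (2 * Mg (n - 1) + q (n - 1))" .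
    have "p u (n + 1) * \<bar>ln (p u n) - ln (p u (n + 1))\<bar> \<le> 2 * Mg n + p u (n + 1)"
      using mult_ln_diff_le[OF pu pu, of "n + 1" n] Mg(2)[OF u, of n]
      by (simp add: G_def abs_minus_commute)
    from step[OF this] have 2: "p u (n + 1) * \<bar>ln (p u n)\<bar> \<le> X (n + 1) + (2 * Mg n + q (n + 1))" .
    have 3: "\<bar>1 - L n\<bar> \<le> W n"
    proof -
      have "0 \<le> real_of_int \<bar>n\<bar>" by simp
      then show ?thesis using L_bound[of n] LK by (simp add: W_def algebra_simps)
    qed
    have W0: "W n \<ge> 0" using LK by (simp add: W_def)
    have "\<bar>ln (p u n) + 1 - L n\<bar> * (p u (n - 1) + 2 * p u n + p u (n + 1))
      \<le> (\<bar>ln (p u n)\<bar> + W n) * (p u (n - 1) + 2 * p u n + p u (n + 1))"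
      using 3 pu[of "n - 1"] pu[of n] pu[of "n + 1"] by (intro mult_right_mono) auto
    also have "\<dots> = p u (n - 1) * \<bar>ln (p u n)\<bar> + 2 * (p u n * \<bar>ln (p u n)\<bar>) + p u (n + 1) * \<bar>ln (p u n)\<bar>
        + (W n * p u (n - 1) + 2 * (W n * p u n) + W n * p u (n + 1))"
      by (simp add: algebra_simps)
    also have "\<dots> \<le> (X (n - 1) + (2 * Mg (n - 1) + q (n - 1))) + 2 * X n + (X (n + 1) + (2 * Mg n + q (n + 1)))
        + (W n * q (n - 1) + 2 * (W n * q n) + W n * q (n + 1))"
      by (intro add_mono 1 2 mult_left_mono xX pq W0) auto
    finally show ?thesis by (simp add: M_def add.assoc)
  qed
  ultimately show ?thesis by blast
qed

text \<open>The starting time \<open>s\<close> is a parameter: interior times use some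
  \<open>s > t0\<close>, where positivity and summable gaps are known, and the initial time uses
  \<open>s = t0\<close> when its dissipation is finite.\<close>

lemma H_deriv:
  assumes s: "t0 \<le> s" "s \<le> t" and pos: "\<And>n. p s n > 0" and sm: "G 0 s summable_on UNIV"
  shows "(H has_real_derivative - real_of_ereal (dissipation (p t))) (at t within {s..})"
    and "\<bar>dissipation (p t)\<bar> \<noteq> \<infinity>"
proof -
  have st: "s < t + 1" using s by simp
  obtain M where M: "M summable_on UNIV" "\<And>u n. s \<le> u \<Longrightarrow> u \<le> t + 1 \<Longrightarrow>
     \<bar>ln (p u n) + 1 - L n\<bar> * (p u (n - 1) + 2 * p u n + p u (n + 1)) \<le> M n"
    using log_flux_majorant[OF s(1) st pos sm] by blast
  have t0: "t0 \<le> t" using s by simp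
  have pu: "p u n > 0" if "s \<le> u" for u n using p_pos[of u n] pos[of n] that s by (cases "u = s") auto
  have smt: "G 0 t summable_on UNIV" using gap_summable[of t] sm s by (cases "s = t") auto
  define w where "w u n = ln (p u n) + 1 - L n" for u n
  have wM: "\<bar>w u n * y\<bar> \<le> M n" if "s \<le> u" "u \<le> t + 1" "\<bar>y\<bar> \<le> p u (n - 1) + 2 * p u n + p u (n + 1)" for u n y
  proof -
    have "\<bar>w u n\<bar> * \<bar>y\<bar> \<le> \<bar>w u n\<bar> * (p u (n - 1) + 2 * p u n + p u (n + 1))"
      using that(3) by (intro mult_left_mono) auto
    then show ?thesis using M(2)[OF that(1,2), of n] by (simp add: w_def abs_mult)
  qed
  have "((\<lambda>u. \<Sum>\<^sub>\<infinity>n. xlnx (p u n) - L n * p u n) has_real_derivative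
      (\<Sum>\<^sub>\<infinity>n. w t n * (J t (n - 1) - J t n))) (at t within {s..})"
  proof (rule has_real_derivative_infsum[where M = M and \<beta> = "t + 1", OF _ _ M(1) _ s(2)])
    fix u n assume u: "s \<le> u"
    have u0: "t0 \<le> u" using u s by simp
    have P: "((\<lambda>u. p u n) has_real_derivative J u (n - 1) - J u n) (at u within {s..})"
      by (rule DERIV_subset[OF p_deriv[OF u0]]) (use s in auto)
    have lnP: "((\<lambda>u. ln (p u n)) has_real_derivative (J u (n - 1) - J u n) / p u n) (at u within {s..})"
      by (rule derivative_eq_intros P pu[OF u] refl | simp)+
    have "((\<lambda>u. xlnx (p u n) - L n * p u n) has_real_derivative
        (J u (n - 1) - J u n) * ln (p u n) + (J u (n - 1) - J u n) / p u n * p u n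
        - L n * (J u (n - 1) - J u n)) (at u within {s..})"
      unfolding xlnx_def by (intro DERIV_diff DERIV_cmult DERIV_mult P lnP)
    also have "(J u (n - 1) - J u n) * ln (p u n) + (J u (n - 1) - J u n) / p u n * p u n
        - L n * (J u (n - 1) - J u n) = w u n * (J u (n - 1) - J u n)"
    proof -
      have "(J u (n - 1) - J u n) / p u n * p u n = J u (n - 1) - J u n" using pu[OF u, of n] by simp
      then show ?thesis by (simp add: w_def algebra_simps)
    qed
    finally show "((\<lambda>u. xlnx (p u n) - L n * p u n) has_real_derivative w u n * (J u (n - 1) - J u n))
      (at u within {s..})" .
  next
    fix u n assume u: "s \<le> u" "u \<le> t + 1"
    show "\<bar>w u n * (J u (n - 1) - J u n)\<bar> \<le> M n"
      by (rule wM[OF u Q_bounds(3)]) (use u s in auto)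
  next
    fix u assume u: "s \<le> u" "u \<le> t + 1"
    then have u0: "t0 \<le> u" using s by simp
    show "(\<lambda>n. xlnx (p u n) - L n * p u n) summable_on UNIV"
      using entropy_summable[OF u0] by (simp add: entropy_term[OF u0] cong: summable_on_cong)
  qed simp
  moreover have "(\<Sum>\<^sub>\<infinity>n. w t n * (J t (n - 1) - J t n)) = (\<Sum>\<^sub>\<infinity>n. (ln (p t (n + 1)) - ln (p t n)) * J t n)"
  proof -
    have 1: "(\<lambda>n. w t n * J t n) summable_on UNIV"
      by (rule summable_on_dominated[OF M(1) wM])
        (use s t0 in \<open>auto intro!: order_trans[OF J_abs] p_nonneg add_nonneg_nonneg\<close>)
    have 2: "(\<lambda>n. w t n * J t (n - 1)) summable_on UNIV"
    proof (rule summable_on_dominated[OF M(1) wM])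
      show "\<bar>J t (n - 1)\<bar> \<le> p t (n - 1) + 2 * p t n + p t (n + 1)" for n
        using J_abs[OF t0, of "n - 1"] p_nonneg[OF t0, of n] p_nonneg[OF t0, of "n + 1"] by simp
    qed (use s in auto)
    have 3: "(\<lambda>n. w t (n + 1) * J t n) summable_on UNIV"
      using summable_on_int_shift(1)[OF 2, of 1] by simp
    have eq: "(\<Sum>\<^sub>\<infinity>n. w t (n + 1) * J t n) = (\<Sum>\<^sub>\<infinity>n. w t n * J t (n - 1))"
      using infsum_int_shift[of "\<lambda>n. w t n * J t (n - 1)" 1] by simp
    have "(\<Sum>\<^sub>\<infinity>n. w t n * (J t (n - 1) - J t n)) = (\<Sum>\<^sub>\<infinity>n. w t n * J t (n - 1)) - (\<Sum>\<^sub>\<infinity>n. w t n * J t n)"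
      using infsum_real_diff[OF 2 1] by (simp add: right_diff_distrib)
    also have "\<dots> = (\<Sum>\<^sub>\<infinity>n. (w t (n + 1) - w t n) * J t n)"
      using infsum_real_diff[OF 3 1] eq by (simp add: left_diff_distrib)
    also have "\<dots> = (\<Sum>\<^sub>\<infinity>n. (ln (p t (n + 1)) - ln (p t n)) * J t n - (L (n + 1) - L n) * J t n)"
      by (rule infsum_cong) (simp add: w_def algebra_simps)
    also have "\<dots> = (\<Sum>\<^sub>\<infinity>n. (ln (p t (n + 1)) - ln (p t n)) * J t n) - (\<Sum>\<^sub>\<infinity>n. (L (n + 1) - L n) * J t n)"
    proof (rule infsum_real_diff)
      show f: "(\<lambda>n. (ln (p t (n + 1)) - ln (p t n)) * J t n) summable_on UNIV"
        by (rule flux_log_summable[OF t0 pu[OF s(2)] smt])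
      have "(\<lambda>n. (ln (p t (n + 1)) - ln (p t n)) * J t n - (w t (n + 1) * J t n - w t n * J t n)) summable_on UNIV"
        by (intro summable_on_real_diff f 1 3)
      then show "(\<lambda>n. (L (n + 1) - L n) * J t n) summable_on UNIV"
        by (simp add: w_def algebra_simps)
    qed
    also have "(\<Sum>\<^sub>\<infinity>n. (L (n + 1) - L n) * J t n) = 0"
      by (rule flux_weight_split[OF t0 L_step])
    finally show ?thesis by simp
  qed
  moreover note dissipation_finite(1)[OF t0 pu[OF s(2)] smt]
  ultimately have "((\<lambda>u. \<Sum>\<^sub>\<infinity>n. xlnx (p u n) - L n * p u n) has_real_derivative
      - real_of_ereal (dissipation (p t))) (at t within {s..})" by simp
  then show "(H has_real_derivative - real_of_ereal (dissipation (p t))) (at t within {s..})"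
    by (rule has_field_derivative_transform_within[where d = 1]) (use s H_altdef in auto)
  show "\<bar>dissipation (p t)\<bar> \<noteq> \<infinity>" using dissipation_finite(1)[OF t0 pu[OF s(2)] smt] by simp
qed

lemma H_deriv_interior:
  assumes t: "t > t0"
  shows "(H has_real_derivative - real_of_ereal (dissipation (p t))) (at t)"
    and "\<bar>dissipation (p t)\<bar> \<noteq> \<infinity>"
proof -
  define s where "s = (t0 + t) / 2"
  have s: "t0 < s" "s < t" using t by (auto simp: s_def)
  have "t \<in> interior {s..}" using s by (simp add: interior_Ici[of "s - 1"])
  then have "at t within {s..} = at t" by (rule at_within_interior)
  then show "(H has_real_derivative - real_of_ereal (dissipation (p t))) (at t)"
    "\<bar>dissipation (p t)\<bar> \<noteq> \<infinity>"
    using H_deriv[of s t] p_pos[OF s(1)] gap_summable[OF s(1)] s by auto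
qed

text \<open>Continuity up to \<open>t0\<close> is what the mean value theorem asks for when the
  initial dissipation is infinite. The majorant therefore rests on first moments and Young's bound,
  not on the gaps.\<close>

lemma H_continuous:
  assumes "T > t0"
  shows "continuous_on {t0..T} H"
proof -
  define q where "q n = exp (2 * (T - t0)) * p T n" for n
  have q0: "q n \<ge> 0" for n using p_nonneg[of T] assms by (simp add: q_def)
  define M where "M n = (1 + real_of_int \<bar>n\<bar>) * q n + exp (- real_of_int \<bar>n\<bar>) + LK * (1 + real_of_int \<bar>n\<bar>) * q n" for n
  have q1: "(\<lambda>n. (1 + real_of_int \<bar>n\<bar>) * q n) summable_on UNIV"
    using summable_on_cmult_right[OF first_moment[of T], of "exp (2 * (T - t0))"] assms
    by (simp add: q_def mult.left_commute)
  have M: "M summable_on UNIV"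
    using summable_on_cmult_right[OF q1, of LK]
    unfolding M_def by (intro summable_on_add q1 summable_exp_abs) (simp add: mult.assoc)
  have LK: "LK \<ge> 0" by (simp add: LK_def)
  have "continuous_on {t0..T} (\<lambda>t. \<Sum>\<^sub>\<infinity>n. xlnx (p t n) - L n * p t n)"
    unfolding continuous_on_def
  proof
    fix t assume t: "t \<in> {t0..T}"
    show "((\<lambda>t. \<Sum>\<^sub>\<infinity>n. xlnx (p t n) - L n * p t n) \<longlongrightarrow> (\<Sum>\<^sub>\<infinity>n. xlnx (p t n) - L n * p t n))
      (at t within {t0..T})"
    proof (rule tendsto_infsum_dominated[OF _ _ M])
      fix n
      have pc: "((\<lambda>s. p s n) \<longlongrightarrow> p t n) (at t within {t0..T})"
        using DERIV_continuous[OF DERIV_subset[OF p_deriv[of t n], of "{t0..T}"]] t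
        by (auto simp: continuous_within)
      have nn: "\<forall>\<^sub>F s in at t within {t0..T}. p s n \<ge> 0"
        unfolding eventually_at_filter using p_nonneg by (auto intro!: always_eventually)
      have "((\<lambda>s. xlnx (p s n)) \<longlongrightarrow> xlnx (p t n)) (at t within {t0..T})"
      proof (cases "p t n = 0")
        case False
        then show ?thesis unfolding xlnx_def by (intro tendsto_intros pc)
      next
        case True
        \<comment> \<open>The lower barrier comes from \<open>- (2 * sqrt x) \<le> x * ln x\<close>
          on \<open>[0, 1]\<close>, which makes \<open>xlnx\<close> continuous at 0.\<close>
        have "((\<lambda>s. - (2 * sqrt (p s n))) \<longlongrightarrow> - (2 * sqrt (p t n))) (at t within {t0..T})"
          by (intro tendsto_intros pc)
        then have l: "((\<lambda>s. - (2 * sqrt (p s n))) \<longlongrightarrow> 0) (at t within {t0..T})" using True by simp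
        have "\<forall>\<^sub>F s in at t within {t0..T}. s \<in> {t0..T}"
          by (simp add: eventually_at_filter)
        then have ev: "\<forall>\<^sub>F s in at t within {t0..T}. - (2 * sqrt (p s n)) \<le> xlnx (p s n) \<and> xlnx (p s n) \<le> 0"
        proof eventually_elim
          case (elim s)
          then have s: "s \<ge> t0" by simp
          show ?case
          proof (cases "p s n = 0")
            case False
            then have x: "p s n > 0" "p s n \<le> 1" using p_nonneg[OF s, of n] p_le_1[OF s, of n] by auto
            define y where "y = sqrt (p s n)"
            have y: "y > 0" "p s n = y * y" using x by (auto simp: y_def)
            have "ln 1 - ln y \<le> (1 - y) / y" by (rule ln_diff_le) (use y in auto)
            then have "- ln y * (y * y) \<le> (1 - y) / y * (y * y)"
              using y by (intro mult_right_mono) auto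
            also have "(1 - y) / y * (y * y) = y - y * y" using y by (simp add: field_simps)
            finally have "- (2 * y) \<le> 2 * (y * y * ln y)"
              using y by (simp add: algebra_simps) (smt (verit) mult_pos_pos)
            then have "- (2 * sqrt (p s n)) \<le> xlnx (p s n)"
              using y by (simp add: xlnx_def ln_mult y_def[symmetric])
            moreover have "xlnx (p s n) \<le> 0" using x by (simp add: xlnx_def mult_le_0_iff)
            ultimately show ?thesis by simp
          qed (simp add: xlnx_def)
        qed
        have "((\<lambda>s. xlnx (p s n)) \<longlongrightarrow> 0) (at t within {t0..T})"
          by (rule tendsto_sandwich[OF _ _ l tendsto_const]) (use ev in \<open>auto elim: eventually_mono\<close>)
        then show ?thesis using True by (simp add: xlnx_def)
      qed
      then show "((\<lambda>s. xlnx (p s n) - L n * p s n) \<longlongrightarrow> xlnx (p t n) - L n * p t n) (at t within {t0..T})"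
        by (intro tendsto_intros pc)
    next
      have "\<forall>\<^sub>F s in at t within {t0..T}. s \<in> {t0..T}"
        by (simp add: eventually_at_filter)
      then show "\<forall>\<^sub>F s in at t within {t0..T}. \<forall>n\<in>UNIV. \<bar>xlnx (p s n) - L n * p s n\<bar> \<le> M n"
      proof eventually_elim
        case (elim s)
        then have s: "t0 \<le> s" "s \<le> T" by auto
        show ?case
        proof
          fix n
          have pq: "0 \<le> p s n" "p s n \<le> q n" using p_majorant[OF s] p_nonneg[OF s(1)] by (auto simp: q_def)
          have "\<bar>xlnx (p s n)\<bar> \<le> real_of_int \<bar>n\<bar> * p s n + exp (- real_of_int \<bar>n\<bar>)"
            by (rule xlnx_abs_bound[OF p_nonneg[OF s(1)] p_le_1[OF s(1)]])
          also have "\<dots> \<le> (1 + real_of_int \<bar>n\<bar>) * q n + exp (- real_of_int \<bar>n\<bar>)"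
            using pq by (intro add_mono mult_mono) auto
          finally have 1: "\<bar>xlnx (p s n)\<bar> \<le> (1 + real_of_int \<bar>n\<bar>) * q n + exp (- real_of_int \<bar>n\<bar>)" .
          have "\<bar>L n * p s n\<bar> \<le> LK * (1 + real_of_int \<bar>n\<bar>) * q n"
            unfolding abs_mult using pq LK by (intro mult_mono L_bound) auto
          with 1 show "\<bar>xlnx (p s n) - L n * p s n\<bar> \<le> M n" unfolding M_def by linarith
        qed
      qed
    qed
  qed
  then show ?thesis
    by (rule continuous_on_eq) (simp add: H_altdef)
qed

text \<open>A finite total has finite terms, so \<open>p t0\<close> vanishes at both ends of an edge
  or at neither; one occupied site then makes all of them occupied. On each half line the rates are
  constant and \<open>gap_rescale_le\<close> removes them.\<close>

lemma dissipation_finite_init: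
  assumes "dissipation (p t0) \<noteq> \<infinity>"
  shows "p t0 n > 0" "G 0 t0 summable_on UNIV"
proof -
  have t: "t0 \<le> t0" by simp
  define S where "S A = infsum (Tm t0) A" for A
  have S0: "S A \<ge> 0" for A unfolding S_def by (intro infsum_nonneg Tm_nonneg t)
  have Sfin: "S {0..} \<noteq> \<infinity>" "S {..-1} \<noteq> \<infinity>"
    using assms S0[of "{0..}"] S0[of "{..-1}"] unfolding dissipation_eq[OF t] S_def[symmetric] by auto
  have part: "sum (Tm t0) F \<le> S A" if "finite F" "F \<subseteq> A" for F A
    unfolding S_def by (rule finite_sum_le_infsum_ereal) (use that Tm_nonneg in auto)
  have Tfin: "Tm t0 n \<noteq> \<infinity>" for n
    using part[of "{n}" "{0..}"] part[of "{n}" "{..-1}"] Sfin by (cases "n \<ge> 0") auto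
  have iff: "p t0 (n + 1) > 0 \<longleftrightarrow> p t0 n > 0" for n
  proof -
    have "dr t0 (n + 1) * p t0 (n + 1) = 0 \<longleftrightarrow> b t0 * p t0 n = 0"
      using Tfin[of n] by (auto simp: Tm_def log_gap_def split: if_splits)
    then have "p t0 (n + 1) = 0 \<longleftrightarrow> p t0 n = 0" using b_pos[OF t] dr_pos[OF t, of "n + 1"] by auto
    then show ?thesis using p_nonneg[OF t, of n] p_nonneg[OF t, of "n + 1"] by auto
  qed
  obtain m where m: "p t0 m > 0" using ex_rich by blast
  have pos: "p t0 n > 0" for n
  proof (induction n rule: int_induct[where k = m])
    case (step2 i)
    then show ?case using iff[of "i - 1"] by simp
  qed (use m iff in auto)
  then show "p t0 n > 0" .
  define g where "g n = gap (dr t0 (n + 1) * p t0 (n + 1)) (b t0 * p t0 n)" for n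
  have Tg: "Tm t0 n = ereal (g n)" for n
    unfolding Tm_def g_def using b_pos[OF t] dr_pos[OF t] pos by (intro log_gap_pos) auto
  have g0: "g n \<ge> 0" for n unfolding g_def
    using b_pos[OF t] dr_pos[OF t] pos by (intro gap_nonneg) auto
  have gs: "g summable_on A" if "S A \<noteq> \<infinity>" for A
  proof (rule nonneg_bdd_above_summable_on)
    show "bdd_above (sum g ` {F. F \<subseteq> A \<and> finite F})"
    proof (rule bdd_aboveI2)
      fix F assume "F \<in> {F. F \<subseteq> A \<and> finite F}"
      then have "ereal (sum g F) \<le> S A" using part[of F A] by (simp add: Tg[abs_def] sum_ereal)
      then show "sum g F \<le> real_of_ereal (S A)" using that S0[of A] by (cases "S A") auto
    qed
  qed (rule g0)
  have half: "G 0 t0 summable_on A" if A: "g summable_on A" "\<And>n. n \<in> A \<Longrightarrow> dr t0 (n + 1) = \<delta>" and d: "\<delta> > 0" for A \<delta>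
  proof -
    \<comment> \<open>Turns the upward rate into \<delta>, so that homogeneity gives
      \<open>\<delta> * G 0 t0 n\<close>.\<close>
    define c where "c = \<delta> / b t0"
    have c: "c > 0" using d b_pos[OF t] by (simp add: c_def)
    obtain K where K: "K \<ge> 0" "\<And>x y. x > 0 \<Longrightarrow> y > 0 \<Longrightarrow> gap x (c * y) \<le> K * (gap x y + x + y)"
      using gap_rescale_le[OF c] by blast
    show ?thesis
    proof (rule summable_on_dominated)
      have "(\<lambda>n. inverse \<delta> * (K * (g n + \<delta> * p t0 (n + 1) + b t0 * p t0 n))) summable_on A"
        by (intro summable_on_cmult_right summable_on_add A(1) p_summable t
            summable_on_subset[OF summable_on_int_shift(1)[OF p_summable[OF t]]]) auto
      then show "(\<lambda>n. inverse \<delta> * (K * (g n + \<delta> * p t0 (n + 1) + b t0 * p t0 n))) summable_on A" .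
      fix n assume n: "n \<in> A"
      have "\<delta> * G 0 t0 n = gap (\<delta> * p t0 (n + 1)) (c * (b t0 * p t0 n))"
        using d b_pos[OF t] pos[of n] pos[of "n + 1"] by (simp add: G_def gap_def c_def ln_mult algebra_simps)
      also have "\<dots> \<le> K * (gap (\<delta> * p t0 (n + 1)) (b t0 * p t0 n) + \<delta> * p t0 (n + 1) + b t0 * p t0 n)"
        by (rule K(2)) (use d b_pos[OF t] pos in auto)
      also have "gap (\<delta> * p t0 (n + 1)) (b t0 * p t0 n) = g n" using A(2)[OF n] by (simp add: g_def)
      finally have "inverse \<delta> * (\<delta> * G 0 t0 n) \<le> inverse \<delta> * (K * (g n + \<delta> * p t0 (n + 1) + b t0 * p t0 n))"
        using d by (intro mult_left_mono) auto
      moreover have "inverse \<delta> * (\<delta> * G 0 t0 n) = G 0 t0 n" using d by simp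
      moreover have "G 0 t0 n \<ge> 0" by (rule G_nonneg) (use pos in auto)
      ultimately show "\<bar>G 0 t0 n\<bar> \<le> inverse \<delta> * (K * (g n + \<delta> * p t0 (n + 1) + b t0 * p t0 n))" by simp
    qed
  qed
  have 1: "G 0 t0 summable_on {0..}"
    by (rule half[OF gs[OF Sfin(1)], of 1]) (auto simp: dr_def)
  have 2: "G 0 t0 summable_on {..-1}"
    by (rule half[OF gs[OF Sfin(2)], of "a t0"]) (use a_pos[OF t] in \<open>auto simp: dr_def\<close>)
  have "{0..} \<union> {..-1} = (UNIV :: int set)" by auto
  then show "G 0 t0 summable_on UNIV" using summable_on_union[OF 1 2] by simp
qed

section \<open>The right derivative at the initial time\<close>

lemma rates_continuous:
  assumes t: "t \<ge> t0"
  shows "((\<lambda>s. p s n) \<longlongrightarrow> p t n) (at t within {t0..})"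
    and "(b \<longlongrightarrow> b t) (at t within {t0..})"
    and "((\<lambda>s. dr s n) \<longlongrightarrow> dr t n) (at t within {t0..})"
proof -
  have pc: "((\<lambda>s. p s n) \<longlongrightarrow> p t n) (at t within {t0..})" for n
    using DERIV_continuous[OF p_deriv[OF t]] by (simp add: continuous_within)
  then show "((\<lambda>s. p s n) \<longlongrightarrow> p t n) (at t within {t0..})" .
  have rc: "(r \<longlongrightarrow> r t) (at t within {t0..})" and dc: "(d \<longlongrightarrow> d t) (at t within {t0..})"
    using DERIV_continuous[OF r_deriv[OF t]] DERIV_continuous[OF d_deriv[OF t]]
    by (simp_all add: continuous_within)
  show bc: "(b \<longlongrightarrow> b t) (at t within {t0..})"
    unfolding b_def[abs_def] by (intro tendsto_intros rc pc) (use R_pos[OF t] in simp)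
  have "(a \<longlongrightarrow> a t) (at t within {t0..})"
    unfolding a_def[abs_def] by (intro tendsto_intros bc dc pc) (use D_pos[OF t] in simp)
  then show "((\<lambda>s. dr s n) \<longlongrightarrow> dr t n) (at t within {t0..})"
    by (simp add: dr_def)
qed

text \<open>Finitely many terms exceed \<open>K\<close> already at \<open>t0\<close>, and right
  after \<open>t0\<close> they stay above it by continuity; the other terms are nonnegative.\<close>

lemma dissipation_blowup:
  assumes "dissipation (p t0) = \<infinity>"
  shows "\<forall>\<^sub>F s in at_right t0. ereal K < dissipation (p s)"
proof -
  have t: "t0 \<le> t0" by simp
  have S0: "infsum (Tm s) A \<ge> 0" if "s \<ge> t0" for A s by (intro infsum_nonneg Tm_nonneg that)
  have "infsum (Tm t0) {0..} = \<infinity> \<or> infsum (Tm t0) {..-1} = \<infinity>"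
    using assms S0[OF t] unfolding dissipation_eq[OF t] by (simp add: ereal_plus_eq_PInfty)
  then obtain A where A: "A = {0..} \<or> A = {..-1}" "infsum (Tm t0) A = \<infinity>" by blast
  have "infsum (Tm t0) A = (SUP F\<in>{F. finite F \<and> F \<subseteq> A}. sum (Tm t0) F)"
    by (rule nonneg_infsum_complete) (rule Tm_nonneg[OF t])
  then have "ereal K < (SUP F\<in>{F. finite F \<and> F \<subseteq> A}. sum (Tm t0) F)" using A(2) by simp
  then obtain F where F: "finite F" "F \<subseteq> A" "ereal K < sum (Tm t0) F"
    by (auto simp: less_SUP_iff)
  \<comment> \<open>A term with both arguments zero at the initial time need not converge; it is replaced by its lower bound zero.\<close>
  define z where "z n \<longleftrightarrow> p t0 (n + 1) = 0 \<and> p t0 n = 0" for n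
  define V where "V s n = (if z n then 0 else Tm s n)" for s n
  have ev: "\<forall>\<^sub>F s in at_right t0. s > t0" by (simp add: eventually_at_filter)
  have rates: "((\<lambda>s. p s n) \<longlongrightarrow> p t0 n) (at_right t0)" "(b \<longlongrightarrow> b t0) (at_right t0)"
    "((\<lambda>s. dr s n) \<longlongrightarrow> dr t0 n) (at_right t0)" for n
    using rates_continuous(1,3)[OF t, of n] rates_continuous(2)[OF t] by (auto intro: tendsto_within_subset)
  have V0: "V t0 n = Tm t0 n" for n
    by (simp add: V_def z_def Tm_def log_gap_def)
  have lim: "((\<lambda>s. V s n) \<longlongrightarrow> V t0 n) (at_right t0)" for n
  proof (cases "z n")
    case False
    have "((\<lambda>s. Tm s n) \<longlongrightarrow> Tm t0 n) (at_right t0)"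
      unfolding Tm_def
    proof (rule tendsto_log_gap)
      show "((\<lambda>s. dr s (n + 1) * p s (n + 1)) \<longlongrightarrow> dr t0 (n + 1) * p t0 (n + 1)) (at_right t0)"
        "((\<lambda>s. b s * p s n) \<longlongrightarrow> b t0 * p t0 n) (at_right t0)"
        by (intro tendsto_mult rates)+
      show "\<forall>\<^sub>F s in at_right t0. 0 < dr s (n + 1) * p s (n + 1) \<and> 0 < b s * p s n"
        using ev by eventually_elim (simp add: p_pos dr_pos b_pos)
      show "0 < dr t0 (n + 1) * p t0 (n + 1) \<or> 0 < b t0 * p t0 n"
        using False p_nonneg[OF t, of n] p_nonneg[OF t, of "n + 1"] dr_pos[OF t, of "n + 1"] b_pos[OF t]
        by (auto simp: z_def zero_less_mult_iff less_eq_real_def)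
    qed (rule rate_bounds[OF t])+
    then show ?thesis using False by (simp add: V_def)
  qed (simp add: V_def)
  have Vnn: "V s n \<ge> 0" if "s \<ge> t0" for s n using Tm_nonneg[OF that] by (simp add: V_def)
  have "((\<lambda>s. sum (V s) F) \<longlongrightarrow> sum (V t0) F) (at_right t0)"
    using F(1)
  proof (induction F rule: finite_induct)
    case (insert x F)
    have "((\<lambda>s. V s x + sum (V s) F) \<longlongrightarrow> V t0 x + sum (V t0) F) (at_right t0)"
      by (rule tendsto_add_ereal_nonneg[OF _ _ lim insert.IH])
        (use Vnn[OF t, of x] sum_nonneg[of F "V t0"] Vnn[OF t] in auto)
    then show ?case using insert by simp
  qed simp
  then have "\<forall>\<^sub>F s in at_right t0. ereal K < sum (V s) F"
    by (rule order_tendstoD(1)) (use F(3) V0 in simp)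
  then show ?thesis using ev
  proof eventually_elim
    case (elim s)
    then have s: "t0 \<le> s" by simp
    have "sum (V s) F \<le> sum (Tm s) F"
      by (rule sum_mono) (use Tm_nonneg[OF s] in \<open>auto simp: V_def\<close>)
    also have "\<dots> \<le> infsum (Tm s) A"
      by (rule finite_sum_le_infsum_ereal) (use F Tm_nonneg[OF s] in auto)
    also have "\<dots> \<le> dissipation (p s)"
      unfolding dissipation_eq[OF s] using A(1) S0[OF s] by (auto intro: add_increasing add_increasing2)
    finally show ?case using elim(1) by simp
  qed
qed

text \<open>In the infinite case each difference quotient equals minus the dissipation at an
  interior time between \<open>t0\<close> and \<open>s\<close>, where it is finite but, by
  \<open>dissipation_blowup\<close>, arbitrarily large.\<close>

lemma H_right_derivative:
  "((\<lambda>s. ereal ((H s - H t0) / (s - t0))) \<longlongrightarrow> - dissipation (p t0)) (at_right t0)"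
proof (cases "dissipation (p t0) = \<infinity>")
  case False
  note init = dissipation_finite_init[OF False]
  have "(H has_real_derivative - real_of_ereal (dissipation (p t0))) (at t0 within {t0..})"
    and fin: "\<bar>dissipation (p t0)\<bar> \<noteq> \<infinity>"
    using H_deriv[of t0 t0] init by auto
  then have "((\<lambda>s. (H s - H t0) / (s - t0)) \<longlongrightarrow> - real_of_ereal (dissipation (p t0))) (at t0 within {t0..})"
    by (simp add: has_field_derivative_iff)
  then have "((\<lambda>s. (H s - H t0) / (s - t0)) \<longlongrightarrow> - real_of_ereal (dissipation (p t0))) (at_right t0)"
    by (rule tendsto_within_subset) auto
  then have "((\<lambda>s. ereal ((H s - H t0) / (s - t0))) \<longlongrightarrow> ereal (- real_of_ereal (dissipation (p t0)))) (at_right t0)"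
    by (rule tendsto_ereal)
  then show ?thesis using fin by (simp add: ereal_real flip: uminus_ereal.simps)
next
  case True
  have "((\<lambda>s. ereal ((H s - H t0) / (s - t0))) \<longlongrightarrow> - \<infinity>) (at_right t0)"
    unfolding tendsto_MInfty
  proof
    fix K :: real
    obtain u where u: "u > t0" "\<And>s. t0 < s \<Longrightarrow> s < u \<Longrightarrow> ereal (- K) < dissipation (p s)"
      using dissipation_blowup[OF True, of "- K"] by (auto simp: eventually_at_right_field)
    have "(H s - H t0) / (s - t0) < K" if s: "t0 < s" "s < u" for s
    proof -
      obtain x where x: "t0 < x" "x < s" "H s - H t0 = (s - t0) * - real_of_ereal (dissipation (p x))"
      proof (rule MVT[OF s(1) H_continuous[OF s(1)], THEN exE])
        show "\<And>x. t0 < x \<Longrightarrow> x < s \<Longrightarrow> H differentiable (at x)"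
          using H_deriv_interior(1) real_differentiable_def by blast
        fix l assume "\<exists>z>t0. z < s \<and> (H has_real_derivative l) (at z) \<and> H s - H t0 = (s - t0) * l"
        then obtain z where "t0 < z" "z < s" "(H has_real_derivative l) (at z)" "H s - H t0 = (s - t0) * l"
          by blast
        then show thesis using that[of z] DERIV_unique[OF _ H_deriv_interior(1)[of z]] by blast
      qed
      have "ereal (- K) < dissipation (p x)" using u(2)[of x] x s by simp
      then have "- K < real_of_ereal (dissipation (p x))"
        using H_deriv_interior(2)[OF x(1)] by (cases "dissipation (p x)") auto
      then show ?thesis using x s by simp
    qed
    then show "\<forall>\<^sub>F s in at_right t0. ereal ((H s - H t0) / (s - t0)) < ereal K"
      using u(1) by (auto simp: eventually_at_right_field)
  qed
  then show ?thesis using True by simp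
qed

lemma H_antimono:
  assumes "t0 < s" "s \<le> t"
  shows "H t \<le> H s"
proof (rule has_derivative_within_antimono[OF assms(2), where S = UNIV and f' = "\<lambda>t. - real_of_ereal (dissipation (p t))"])
  fix x assume "s \<le> x" "x \<le> t"
  then show "(H has_real_derivative - real_of_ereal (dissipation (p x))) (at x)"
    "- real_of_ereal (dissipation (p x)) \<le> 0"
    using H_deriv_interior[of x] dissipation_nonneg[of x] assms by (auto intro: real_of_ereal_pos)
qed simp

end

section \<open>Uniform exponential moments\<close>

text \<open>Let \<open>s\<close> be the last time at which \<open>Z\<close> is at or above the
  level; it exists by compactness. Afterwards \<open>Z\<close> is below \<open>z0\<close> and so
  cannot decrease.\<close>

lemma barrier_below:
  fixes Z :: "real \<Rightarrow> real"
  assumes der: "\<And>t. t \<ge> t0 \<Longrightarrow> (Z has_real_derivative Z' t) (at t within {t0..})"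
    and bar: "\<And>t. t \<ge> t0 \<Longrightarrow> Z t < z0 \<Longrightarrow> Z' t \<ge> 0" and t: "t \<ge> t0"
  shows "Z t \<ge> min (Z t0) z0"
proof (rule ccontr)
  define m where "m = min (Z t0) z0"
  assume "\<not> ?thesis"
  then have lt: "Z t < m" by (simp only: m_def not_le)
  have cont: "continuous_on {t0..t} Z"
    by (rule DERIV_continuous_on[where D = Z'], rule DERIV_subset[OF der]) auto
  define S where "S = {s \<in> {t0..t}. m \<le> Z s}"
  have "S = {t0..t} \<inter> Z -` {m..}" by (auto simp: S_def)
  then have "closed S" using continuous_closed_preimage[OF cont] by simp
  moreover have "bounded S"
    by (rule bounded_subset[OF compact_imp_bounded[OF compact_Icc[of t0 t]]]) (auto simp: S_def)
  ultimately have "compact S" by (simp add: compact_eq_bounded_closed)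
  moreover have "t0 \<in> S" using t by (simp add: S_def m_def)
  ultimately obtain s where s: "s \<in> S" "\<And>u. u \<in> S \<Longrightarrow> u \<le> s"
    using compact_attains_sup[of S] by blast
  have st: "t0 \<le> s" "s < t" "m \<le> Z s" using s(1) lt by (auto simp: S_def less_eq_real_def)
  have "\<exists>x\<in>{s<..<t}. Z t - Z s = (*) (Z' x) (t - s)"
  proof (rule mvt_simple[OF st(2)])
    fix x assume "s \<le> x" "x \<le> t"
    then have "(Z has_real_derivative Z' x) (at x within {s..t})"
      using st by (intro DERIV_subset[OF der]) auto
    then show "(Z has_derivative (*) (Z' x)) (at x within {s..t})" by (simp add: has_field_derivative_def)
  qed
  then obtain x where x: "s < x" "x < t" "Z t - Z s = Z' x * (t - s)" by auto
  then have "Z x < m" using s(2)[of x] st by (force simp: S_def)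
  then have "Z' x \<ge> 0" using bar[of x] x st by (simp add: m_def)
  then have "Z t \<ge> Z s" using x st by (smt (verit) mult_nonneg_nonneg)
  then show False using lt st by simp
qed

text \<open>In the product \<open>R * exp (X / c)\<close> the loss rate \<kappa> of \<open>R\<close>
  is compensated by the growth of \<open>X\<close> as long as \<open>R\<close> is below \<epsilon>.
  Since \<open>X\<close> is bounded, the product is comparable to \<open>R\<close>.\<close>

lemma lower_bound_barrier:
  fixes R X \<kappa> :: "real \<Rightarrow> real"
  assumes dR: "\<And>t. t \<ge> t0 \<Longrightarrow> (R has_real_derivative R' t) (at t within {t0..})"
    and dX: "\<And>t. t \<ge> t0 \<Longrightarrow> (X has_real_derivative X' t) (at t within {t0..})"
    and R0: "\<And>t. t \<ge> t0 \<Longrightarrow> R t > 0" and X1: "\<And>t. t \<ge> t0 \<Longrightarrow> \<bar>X t\<bar> \<le> 1"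
    and R': "\<And>t. t \<ge> t0 \<Longrightarrow> R' t \<ge> - \<kappa> t * R t"
    and X': "\<And>t. t \<ge> t0 \<Longrightarrow> R t < \<epsilon> \<Longrightarrow> X' t \<ge> \<kappa> t * c"
    and pos: "\<epsilon> > 0" "c > 0"
  shows "\<exists>\<rho>>0. \<forall>t\<ge>t0. R t \<ge> \<rho>"
proof -
  define Z where "Z t = R t * exp (X t / c)" for t
  have eb: "exp (- 1 / c) \<le> exp (X t / c)" "exp (X t / c) \<le> exp (1 / c)" if "t \<ge> t0" for t
  proof -
    have "-1 \<le> X t" "X t \<le> 1" using X1[OF that] by linarith+
    then show "exp (- 1 / c) \<le> exp (X t / c)" "exp (X t / c) \<le> exp (1 / c)"
      unfolding exp_le_cancel_iff using pos(2) divide_right_mono[of _ _ c] less_imp_le by blast+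
  qed
  \<comment> \<open>Because \<open>X \<ge> -1\<close>, being below this level forces
    \<open>R t < \<epsilon>\<close>, so the growth condition on \<open>X\<close> is in
    force.\<close>
  have "Z t \<ge> min (Z t0) (\<epsilon> * exp (- 1 / c))" if t: "t \<ge> t0" for t
  proof (rule barrier_below[OF _ _ t])
    fix t assume t: "t \<ge> t0"
    have "((\<lambda>t. X t / c) has_real_derivative X' t / c) (at t within {t0..})"
      by (rule DERIV_cdivide[OF dX[OF t]])
    from DERIV_mult[OF dR[OF t] DERIV_chain2[OF DERIV_exp this]]
    show "(Z has_real_derivative exp (X t / c) * (R' t + R t * (X' t / c))) (at t within {t0..})"
      unfolding Z_def[abs_def] by (simp add: algebra_simps)
    assume "Z t < \<epsilon> * exp (- 1 / c)"
    then have "R t * exp (X t / c) < \<epsilon> * exp (- 1 / c)" by (simp only: Z_def)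
    moreover have "R t * exp (- 1 / c) \<le> R t * exp (X t / c)"
      using R0[OF t] by (intro mult_left_mono eb(1) t) simp
    ultimately have "R t * exp (- 1 / c) < \<epsilon> * exp (- 1 / c)" by linarith
    then have Rl: "R t < \<epsilon>" by simp
    have "R t * (X' t / c) \<ge> R t * (\<kappa> t * c / c)"
      using X'[OF t Rl] R0[OF t] pos(2) by (intro mult_left_mono divide_right_mono) auto
    then have "R' t + R t * (X' t / c) \<ge> 0" using R'[OF t] pos(2) by (simp add: mult.commute)
    then show "0 \<le> exp (X t / c) * (R' t + R t * (X' t / c))" by simp
  qed
  moreover define m where "m = min (Z t0) (\<epsilon> * exp (- 1 / c))"
  ultimately have Zm: "Z t \<ge> m" if "t \<ge> t0" for t using that by blast
  have m: "m > 0" unfolding m_def Z_def using R0[of t0] pos by simp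
  have "R t \<ge> m * exp (- 1 / c)" if t: "t \<ge> t0" for t
  proof -
    have "m \<le> R t * exp (X t / c)" using Zm[OF t] by (simp add: Z_def)
    also have "\<dots> \<le> R t * exp (1 / c)" using R0[OF t] by (intro mult_left_mono eb(2) t) simp
    finally have "m \<le> R t * exp (1 / c)" .
    then have "m * exp (- 1 / c) \<le> R t * exp (1 / c) * exp (- 1 / c)"
      by (intro mult_right_mono) auto
    also have "\<dots> = R t" by (simp add: mult.assoc flip: exp_add)
    finally show ?thesis .
  qed
  then show ?thesis using m by (intro exI[of _ "m * exp (- 1 / c)"]) auto
qed

text \<open>In \<open>F * exp (- (z - 1) * X)\<close> the terms with \<open>y\<close> cancel,
  leaving the source \<open>z\<close> against the decay \<open>(z - 1) * \<kappa> * c * F\<close>.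
  The function is negated so that \<open>barrier_below\<close> applies.\<close>

lemma upper_bound_barrier:
  fixes F X \<kappa> y :: "real \<Rightarrow> real"
  assumes dF: "\<And>t. t \<ge> t0 \<Longrightarrow> (F has_real_derivative F' t) (at t within {t0..})"
    and dX: "\<And>t. t \<ge> t0 \<Longrightarrow> (X has_real_derivative X' t) (at t within {t0..})"
    and F0: "\<And>t. t \<ge> t0 \<Longrightarrow> F t \<ge> 0" and X1: "\<And>t. t \<ge> t0 \<Longrightarrow> \<bar>X t\<bar> \<le> 1"
    and F': "\<And>t. t \<ge> t0 \<Longrightarrow> F' t \<le> z + (z - 1) * \<kappa> t * F t * (c - y t)"
    and X': "\<And>t. t \<ge> t0 \<Longrightarrow> X' t \<ge> \<kappa> t * (2 * c - y t)"
    and pos: "z > 1" "c > 0" "kmin > 0" and \<kappa>: "\<And>t. t \<ge> t0 \<Longrightarrow> kmin \<le> \<kappa> t"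
  shows "\<exists>B. \<forall>t\<ge>t0. F t \<le> B"
proof -
  define k where "k = z - 1"
  have k: "k > 0" using pos by (simp add: k_def)
  define Y where "Y t = - (F t * exp (- (k * X t)))" for t
  \<comment> \<open>Once \<open>F\<close> exceeds this value, the decay
    \<open>k * F * c * kmin\<close> beats the source \<open>z\<close>.\<close>
  define F0 where "F0 = z / (k * kmin * c)"
  have F0pos: "F0 > 0" using pos k by (simp add: F0_def)
  have eb: "exp (- k) \<le> exp (- (k * X t))" "exp (- (k * X t)) \<le> exp k" if "t \<ge> t0" for t
  proof -
    have "-1 \<le> X t" "X t \<le> 1" using X1[OF that] by linarith+
    then have "k * X t \<le> k * 1" "k * (-1) \<le> k * X t" using k by (intro mult_left_mono; simp)+
    then show "exp (- k) \<le> exp (- (k * X t))" "exp (- (k * X t)) \<le> exp k" by auto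
  qed
  have Yb: "Y t \<ge> min (Y t0) (- (F0 * exp k))" if t: "t \<ge> t0" for t
  proof (rule barrier_below[OF _ _ t])
    fix t assume t: "t \<ge> t0"
    have "((\<lambda>t. - (k * X t)) has_real_derivative - (k * X' t)) (at t within {t0..})"
      by (intro DERIV_minus DERIV_cmult dX[OF t])
    from DERIV_minus[OF DERIV_mult[OF dF[OF t] DERIV_chain2[OF DERIV_exp this]]]
    show "(Y has_real_derivative exp (- (k * X t)) * (k * F t * X' t - F' t)) (at t within {t0..})"
      unfolding Y_def[abs_def] by (simp add: algebra_simps)
    assume "Y t < - (F0 * exp k)"
    then have "F0 * exp k < F t * exp (- (k * X t))" by (simp add: Y_def)
    also have "\<dots> \<le> F t * exp k" by (intro mult_left_mono eb(2) F0 t)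
    finally have F: "F0 < F t" by simp
    have "k * F t * X' t \<ge> k * F t * (\<kappa> t * (2 * c - y t))"
      using k F0[OF t] by (intro mult_left_mono X' t) auto
    moreover have "k * F t * (\<kappa> t * (2 * c - y t)) - (z + k * \<kappa> t * F t * (c - y t)) = k * F t * c * \<kappa> t - z"
      by (simp add: algebra_simps)
    moreover have "k * F t * c * \<kappa> t \<ge> k * F t * c * kmin"
      using k F0[OF t] pos by (intro mult_left_mono \<kappa> t) auto
    moreover have "k * F t * c * kmin \<ge> z"
      using F pos k by (simp add: F0_def divide_less_eq mult.commute mult.left_commute)
    ultimately have "k * F t * X' t - F' t \<ge> 0" using F'[OF t] by (simp add: k_def)
    then show "0 \<le> exp (- (k * X t)) * (k * F t * X' t - F' t)" by simp
  qed
  define m where "m = - min (Y t0) (- (F0 * exp k))"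
  have "F t \<le> exp k * m" if t: "t \<ge> t0" for t
  proof -
    have "F t * exp (- k) \<le> F t * exp (- (k * X t))" by (intro mult_left_mono eb(1) F0 t)
    also have "\<dots> \<le> m" using Yb[OF t] by (simp add: Y_def m_def)
    finally have "exp k * (F t * exp (- k)) \<le> exp k * m" by simp
    moreover have "exp k * (F t * exp (- k)) = F t" by (simp add: exp_minus)
    ultimately show ?thesis by simp
  qed
  then show ?thesis by blast
qed

text \<open>A linear minorant that is nonpositive beyond \<open>N\<close>. It converts the conserved
  mass and first moment into lower bounds for Laplace transforms.\<close>

lemma half_power_ge_linear: "(1 / 2) ^ k \<ge> (1 / 2) ^ N * (1 - real k / real N)" if "N > 0" for k N :: nat
proof (cases "k \<le> N")
  case True
  have "(1 / 2) ^ N * (1 - real k / real N) \<le> (1 / 2 :: real) ^ N * 1"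
    by (intro mult_left_mono) auto
  also have "\<dots> \<le> (1 / 2) ^ k" using True by (simp add: power_decreasing)
  finally show ?thesis .
next
  case False
  then have "1 - real k / real N \<le> 0" using that by simp
  then have "(1 / 2) ^ N * (1 - real k / real N) \<le> 0" by (simp add: mult_le_0_iff)
  then show ?thesis by (rule order_trans) simp
qed

text \<open>For \<open>z < 1\<close> these weights give Laplace transforms of the two half lines,
  for \<open>z > 1\<close> exponential moments. Both half lines contain the site 0.\<close>

definition wp :: "real \<Rightarrow> int \<Rightarrow> real" where "wp z n = (if n \<ge> 0 then z ^ nat n else 0)"

definition wm :: "real \<Rightarrow> int \<Rightarrow> real" where "wm z n = (if n \<le> 0 then z ^ nat (- n) else 0)"

lemma w_bounds: "z > 0 \<Longrightarrow> \<bar>wp z n\<bar> \<le> max 1 z ^ nat \<bar>n\<bar>" "z > 0 \<Longrightarrow> \<bar>wm z n\<bar> \<le> max 1 z ^ nat \<bar>n\<bar>"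
  unfolding wp_def wm_def by (auto simp: abs_of_nonpos intro!: power_mono)

lemma tame_max: "tame (max 1 z) (\<lambda>n. max 1 z ^ nat \<bar>n\<bar>)"
  by (rule tame_exp) simp

lemma infsum_point: "(\<Sum>\<^sub>\<infinity>n::int. if n = k then c n else 0) = (c k :: real)"
  "(\<lambda>n::int. if n = k then c n else 0 :: real) summable_on UNIV"
proof -
  show "(\<Sum>\<^sub>\<infinity>n::int. if n = k then c n else 0) = (c k :: real)"
    by (subst infsum_single[where k = k]) auto
  show "(\<lambda>n::int. if n = k then c n else 0 :: real) summable_on UNIV"
    by (rule finite_nonzero_values_imp_summable_on) (rule finite_subset[of _ "{k}"]; auto)
qed

section \<open>Exponential weights on the two half lines\<close>

context phase2
begin

definition Fp :: "real \<Rightarrow> real \<Rightarrow> real" where "Fp z t = (\<Sum>\<^sub>\<infinity>n. wp z n * p t n)"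
definition Fm :: "real \<Rightarrow> real \<Rightarrow> real" where "Fm z t = (\<Sum>\<^sub>\<infinity>n. wm z n * p t n)"

text \<open>Taking \<open>max 1 z\<close> keeps the weight tame when \<open>z < 1\<close>, in which
  case the condition is just summability of \<open>p t0\<close>.\<close>

definition expmoment :: "real \<Rightarrow> bool" where
  "expmoment z \<longleftrightarrow> 0 < z \<and> (\<lambda>n. max 1 z ^ nat \<bar>n\<bar> * p t0 n) summable_on UNIV"

lemma expmoment_le_1: "0 < z \<Longrightarrow> z \<le> 1 \<Longrightarrow> expmoment z"
  using p_summable[of t0 UNIV] by (simp add: expmoment_def max_def)

lemma w_summable:
  assumes "expmoment z" "t \<ge> t0"
  shows "(\<lambda>n. wp z n * p t n) summable_on UNIV" "(\<lambda>n. wm z n * p t n) summable_on UNIV"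
proof -
  have z: "0 < z" and s: "(\<lambda>n. max 1 z ^ nat \<bar>n\<bar> * p t0 n) summable_on UNIV"
    using assms(1) by (auto simp: expmoment_def)
  note m = moment_propagation[OF tame_max s assms(2)]
  show "(\<lambda>n. wp z n * p t n) summable_on UNIV" "(\<lambda>n. wm z n * p t n) summable_on UNIV"
    by (rule weighted_summable[OF _ assms(2) m], rule w_bounds[OF z])+
qed

lemma J_weight_summable:
  assumes "expmoment z" "t \<ge> t0"
  shows "(\<lambda>n. wp z n * J t n) summable_on UNIV" "(\<lambda>n. wm z (n + 1) * J t n) summable_on UNIV"
proof -
  have z: "0 < z" and s: "(\<lambda>n. max 1 z ^ nat \<bar>n\<bar> * p t0 n) summable_on UNIV"
    using assms(1) by (auto simp: expmoment_def)
  note m = moment_propagation[OF tame_max s assms(2)]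
  show "(\<lambda>n. wp z n * J t n) summable_on UNIV"
    by (rule weighted_sum_by_parts(3)[OF tame_max w_bounds(1)[OF z] assms(2) m])
  show "(\<lambda>n. wm z (n + 1) * J t n) summable_on UNIV"
    by (rule weighted_sum_by_parts(4)[OF tame_max w_bounds(2)[OF z] assms(2) m])
qed

text \<open>\<open>J t (-1)\<close> is the inflow into the half line. On its inner edges the
  increment of the weight is \<open>(z - 1) * wp z n\<close>, and the sum over the downward jumps
  misses the site 0, hence \<open>Fp z t - p t 0\<close>.\<close>

lemma Fp_deriv:
  assumes z: "expmoment z" and t: "t \<ge> t0"
  shows "(Fp z has_real_derivative J t (-1) + (z - 1) * (b t * Fp z t - (Fp z t - p t 0) / z))
    (at t within {t0..})"
proof -
  have z0: "0 < z" and s: "(\<lambda>n. max 1 z ^ nat \<bar>n\<bar> * p t0 n) summable_on UNIV"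
    using z by (auto simp: expmoment_def)
  have der: "(Fp z has_real_derivative (\<Sum>\<^sub>\<infinity>n. (wp z (n + 1) - wp z n) * J t n)) (at t within {t0..})"
    unfolding Fp_def by (rule weighted_sum_deriv[OF tame_max w_bounds(1)[OF z0] t s])
  have split: "(wp z (n + 1) - wp z n) * J t n = (if n = -1 then J t n else 0) + (z - 1) * (wp z n * J t n)" for n
  proof -
    have "n \<ge> 0 \<or> n = -1 \<or> n < -1" by linarith
    then show ?thesis by (auto simp: wp_def nat_add_distrib algebra_simps)
  qed
  have "(\<Sum>\<^sub>\<infinity>n. (wp z (n + 1) - wp z n) * J t n) = J t (-1) + (z - 1) * (\<Sum>\<^sub>\<infinity>n. wp z n * J t n)"
    unfolding split
    by (subst infsum_add[OF infsum_point(2) summable_on_cmult_right[OF J_weight_summable(1)[OF z t]]])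
      (simp only: infsum_point(1) infsum_cmult_right')
  also have "(\<Sum>\<^sub>\<infinity>n. wp z n * J t n) = b t * Fp z t - (Fp z t - p t 0) / z"
  proof -
    have e: "wp z n * J t n = b t * (wp z n * p t n)
        - (wp z (n + 1) * p t (n + 1) - (if n = -1 then p t 0 else 0)) * inverse z" for n
    proof -
      have "n \<ge> 0 \<or> n = -1 \<or> n < -1" by linarith
      then show ?thesis using z0 by (auto simp: wp_def J_def dr_def nat_add_distrib field_simps)
    qed
    note ws = w_summable(1)[OF z t]
    note ws1 = summable_on_int_shift(1)[OF ws, of 1]
    have "(\<Sum>\<^sub>\<infinity>n. wp z n * J t n) = (\<Sum>\<^sub>\<infinity>n. b t * (wp z n * p t n))
        - (\<Sum>\<^sub>\<infinity>n. (wp z (n + 1) * p t (n + 1) - (if n = -1 then p t 0 else 0)) * inverse z)"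
      unfolding e
      by (rule infsum_real_diff) (intro summable_on_cmult_right summable_on_cmult_left summable_on_real_diff ws ws1 infsum_point(2))+
    also have "(\<Sum>\<^sub>\<infinity>n. (wp z (n + 1) * p t (n + 1) - (if n = -1 then p t 0 else 0)) * inverse z)
        = ((\<Sum>\<^sub>\<infinity>n. wp z (n + 1) * p t (n + 1)) - p t 0) * inverse z"
      unfolding infsum_cmult_left' infsum_real_diff[OF ws1 infsum_point(2)] infsum_point(1) ..
    also have "(\<Sum>\<^sub>\<infinity>n. wp z (n + 1) * p t (n + 1)) = Fp z t"
      unfolding Fp_def by (rule infsum_int_shift)
    finally show ?thesis by (simp add: Fp_def infsum_cmult_right' divide_inverse)
  qed
  finally show ?thesis using der by simp
qed

text \<open>Mirror image of \<open>Fp_deriv\<close>: the inflow is now \<open>- J t 0\<close>, the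
  jumps away from the origin have rate \<open>a\<close>, and those towards it rate
  \<open>b\<close>.\<close>

lemma Fm_deriv:
  assumes z: "expmoment z" and t: "t \<ge> t0"
  shows "(Fm z has_real_derivative - J t 0 + (z - 1) * (a t * Fm z t - b t * (Fm z t - p t 0) / z))
    (at t within {t0..})"
proof -
  have z0: "0 < z" and s: "(\<lambda>n. max 1 z ^ nat \<bar>n\<bar> * p t0 n) summable_on UNIV"
    using z by (auto simp: expmoment_def)
  have der: "(Fm z has_real_derivative (\<Sum>\<^sub>\<infinity>n. (wm z (n + 1) - wm z n) * J t n)) (at t within {t0..})"
    unfolding Fm_def by (rule weighted_sum_deriv[OF tame_max w_bounds(2)[OF z0] t s])
  have pw: "z ^ nat (- n) = z * z ^ nat (- 1 - n)" if "n \<le> -1" for n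
  proof -
    have "nat (- n) = Suc (nat (- 1 - n))" using that by linarith
    then show ?thesis by simp
  qed
  have split: "(wm z (n + 1) - wm z n) * J t n = (if n = 0 then - J t n else 0) + (1 - z) * (wm z (n + 1) * J t n)" for n
  proof -
    have "n \<ge> 1 \<or> n = 0 \<or> n \<le> -1" by linarith
    then show ?thesis using pw[of n] by (auto simp: wm_def algebra_simps)
  qed
  have "(\<Sum>\<^sub>\<infinity>n. (wm z (n + 1) - wm z n) * J t n) = - J t 0 + (1 - z) * (\<Sum>\<^sub>\<infinity>n. wm z (n + 1) * J t n)"
    unfolding split
    by (subst infsum_add[OF infsum_point(2) summable_on_cmult_right[OF J_weight_summable(2)[OF z t]]])
      (simp only: infsum_point(1) infsum_cmult_right')
  also have "(\<Sum>\<^sub>\<infinity>n. wm z (n + 1) * J t n) = b t * (Fm z t - p t 0) / z - a t * Fm z t"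
  proof -
    have e: "wm z (n + 1) * J t n = (wm z n * p t n - (if n = 0 then p t 0 else 0)) * (b t * inverse z)
        - a t * (wm z (n + 1) * p t (n + 1))" for n
    proof -
      have "n \<ge> 1 \<or> n = 0 \<or> n \<le> -1" by linarith
      then show ?thesis using z0 pw[of n] by (auto simp: wm_def J_def dr_def field_simps)
    qed
    note ws = w_summable(2)[OF z t]
    note ws1 = summable_on_int_shift(1)[OF ws, of 1]
    have "(\<Sum>\<^sub>\<infinity>n. wm z (n + 1) * J t n) =
        (\<Sum>\<^sub>\<infinity>n. (wm z n * p t n - (if n = 0 then p t 0 else 0)) * (b t * inverse z))
        - (\<Sum>\<^sub>\<infinity>n. a t * (wm z (n + 1) * p t (n + 1)))"
      unfolding e
      by (rule infsum_real_diff) (intro summable_on_cmult_right summable_on_cmult_left summable_on_real_diff ws ws1 infsum_point(2))+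
    also have "(\<Sum>\<^sub>\<infinity>n. (wm z n * p t n - (if n = 0 then p t 0 else 0)) * (b t * inverse z))
        = (Fm z t - p t 0) * (b t * inverse z)"
      unfolding infsum_cmult_left' infsum_real_diff[OF ws infsum_point(2)] infsum_point(1) Fm_def ..
    also have "(\<Sum>\<^sub>\<infinity>n. a t * (wm z (n + 1) * p t (n + 1))) = a t * Fm z t"
      unfolding Fm_def infsum_cmult_right' infsum_int_shift[of "\<lambda>n. wm z n * p t n" 1] ..
    finally show ?thesis by (simp add: divide_inverse)
  qed
  also have "- J t 0 + (1 - z) * (b t * (Fm z t - p t 0) / z - a t * Fm z t)
      = - J t 0 + (z - 1) * (a t * Fm z t - b t * (Fm z t - p t 0) / z)"
  proof -
    have "(1 - z) * (u - v) = (z - 1) * (v - u)" for u v :: real by (simp add: algebra_simps)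
    then show ?thesis by simp
  qed
  finally show ?thesis using der by simp
qed

lemma R_deriv: "t \<ge> t0 \<Longrightarrow> ((\<lambda>t. r t + p t 0) has_real_derivative J t (-1)) (at t within {t0..})"
  and D_deriv: "t \<ge> t0 \<Longrightarrow> ((\<lambda>t. d t + p t 0) has_real_derivative - J t 0) (at t within {t0..})"
  using DERIV_add[OF r_deriv p_deriv[of t 0]] DERIV_add[OF d_deriv p_deriv[of t 0]] by simp_all

lemma R_weight: "t \<ge> t0 \<Longrightarrow> (\<Sum>\<^sub>\<infinity>n. (if n \<in> {0..} then 1 else 0) * p t n) = r t + p t 0"
  and D_weight: "t \<ge> t0 \<Longrightarrow> (\<Sum>\<^sub>\<infinity>n. (if n \<in> {..0} then 1 else 0) * p t n) = d t + p t 0"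
  unfolding infsum_indicator_mult using R_infsum D_infsum by auto

lemma F_half_bounds:
  assumes t: "t \<ge> t0"
  shows "0 \<le> Fp (1/2) t" "Fp (1/2) t \<le> r t + p t 0" "0 \<le> Fm (1/2) t" "Fm (1/2) t \<le> d t + p t 0"
proof -
  have h: "expmoment (1/2)" by (rule expmoment_le_1) auto
  show "0 \<le> Fp (1/2) t" "0 \<le> Fm (1/2) t"
    unfolding Fp_def Fm_def using p_nonneg[OF t] by (auto intro!: infsum_nonneg simp: wp_def wm_def)
  show "Fp (1/2) t \<le> r t + p t 0" unfolding Fp_def R_weight[OF t, symmetric]
    by (intro infsum_mono w_summable[OF h t] infsum_indicator_mult(2)[THEN iffD2] p_summable t mult_right_mono p_nonneg)
      (auto simp: wp_def power_le_one)
  show "Fm (1/2) t \<le> d t + p t 0" unfolding Fm_def D_weight[OF t, symmetric]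
    by (intro infsum_mono w_summable[OF h t] infsum_indicator_mult(2)[THEN iffD2] p_summable t mult_right_mono p_nonneg)
      (auto simp: wm_def power_le_one)
qed

lemma F_half_lower:
  assumes t: "t \<ge> t0" and N: "N > 0"
  shows "Fp (1/2) t \<ge> (1/2) ^ N * ((r t + p t 0) - mplus / real N)"
    and "Fm (1/2) t \<ge> (1/2) ^ N * ((d t + p t 0) - mminus / real N)"
proof -
  have h: "expmoment (1/2)" by (rule expmoment_le_1) auto
  define e where "e = (1/2::real) ^ N"
  have lin: "(\<lambda>n. of_int (max n 0) * p t n) summable_on UNIV" "(\<lambda>n. of_int (max (- n) 0) * p t n) summable_on UNIV"
    by (rule weighted_summable[OF _ t first_moment[OF t]]; auto simp: max_def)+
  have ind: "(\<lambda>n. (if n \<in> A then 1 else 0) * p t n) summable_on UNIV" for A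
    unfolding infsum_indicator_mult by (rule p_summable[OF t])
  have sm1: "(\<lambda>n. e * ((if n \<in> {0..} then 1 else 0) * p t n - inverse (real N) * (of_int (max n 0) * p t n))) summable_on UNIV"
    by (rule summable_on_cmult_right[OF summable_on_real_diff[OF ind summable_on_cmult_right[OF lin(1)]]])
  have sm2: "(\<lambda>n. e * ((if n \<in> {..0} then 1 else 0) * p t n - inverse (real N) * (of_int (max (- n) 0) * p t n))) summable_on UNIV"
    by (rule summable_on_cmult_right[OF summable_on_real_diff[OF ind summable_on_cmult_right[OF lin(2)]]])
  have half: "e * (1 - inverse (real N) * real k) \<le> (1 / 2) ^ k" for k
  proof -
    have "real k / real N = inverse (real N) * real k" by (rule trans[OF divide_inverse mult.commute])
    then show ?thesis using half_power_ge_linear[OF N, of k] unfolding e_def by (simp only:)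
  qed
  have "e * ((r t + p t 0) - mplus / real N)
      = (\<Sum>\<^sub>\<infinity>n. e * ((if n \<in> {0..} then 1 else 0) * p t n - inverse (real N) * (of_int (max n 0) * p t n)))"
    unfolding infsum_cmult_right' infsum_real_diff[OF ind summable_on_cmult_right[OF lin(1)]] R_weight[OF t] moments(1)[OF t]
    by (simp add: divide_inverse mult.commute)
  also have "\<dots> \<le> Fp (1/2) t" unfolding Fp_def
  proof (rule infsum_mono)
    show "(\<lambda>n. e * ((if n \<in> {0..} then 1 else 0) * p t n - inverse (real N) * (of_int (max n 0) * p t n))) summable_on UNIV"
      by (rule sm1)
    fix n
    have "e * ((if n \<in> {0..} then 1 else 0) - inverse (real N) * of_int (max n 0)) \<le> wp (1/2) n"
    proof (cases "n \<ge> 0")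
      case True
      then have "of_int (max n 0) = real (nat n)" by simp
      then show ?thesis using half[of "nat n"] True by (simp only: wp_def) simp
    qed (simp add: wp_def)
    then have "e * ((if n \<in> {0..} then 1 else 0) - inverse (real N) * of_int (max n 0)) * p t n \<le> wp (1/2) n * p t n"
      by (rule mult_right_mono[OF _ p_nonneg[OF t]])
    then show "e * ((if n \<in> {0..} then 1 else 0) * p t n - inverse (real N) * (of_int (max n 0) * p t n)) \<le> wp (1/2) n * p t n"
      by (simp only: left_diff_distrib mult.assoc)
  qed (rule w_summable[OF h t])
  finally show "Fp (1/2) t \<ge> (1/2) ^ N * ((r t + p t 0) - mplus / real N)" by (simp add: e_def)
  have "e * ((d t + p t 0) - mminus / real N)
      = (\<Sum>\<^sub>\<infinity>n. e * ((if n \<in> {..0} then 1 else 0) * p t n - inverse (real N) * (of_int (max (- n) 0) * p t n)))"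
    unfolding infsum_cmult_right' infsum_real_diff[OF ind summable_on_cmult_right[OF lin(2)]] D_weight[OF t] moments(2)[OF t]
    by (simp add: divide_inverse mult.commute)
  also have "\<dots> \<le> Fm (1/2) t" unfolding Fm_def
  proof (rule infsum_mono)
    show "(\<lambda>n. e * ((if n \<in> {..0} then 1 else 0) * p t n - inverse (real N) * (of_int (max (- n) 0) * p t n))) summable_on UNIV"
      by (rule sm2)
    fix n
    have "e * ((if n \<in> {..0} then 1 else 0) - inverse (real N) * of_int (max (- n) 0)) \<le> wm (1/2) n"
    proof (cases "n \<le> 0")
      case True
      then have "of_int (max (- n) 0) = real (nat (- n))" by simp
      then show ?thesis using half[of "nat (- n)"] True by (simp only: wm_def) simp
    qed (simp add: wm_def)
    then have "e * ((if n \<in> {..0} then 1 else 0) - inverse (real N) * of_int (max (- n) 0)) * p t n \<le> wm (1/2) n * p t n"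
      by (rule mult_right_mono[OF _ p_nonneg[OF t]])
    then show "e * ((if n \<in> {..0} then 1 else 0) * p t n - inverse (real N) * (of_int (max (- n) 0) * p t n)) \<le> wm (1/2) n * p t n"
      by (simp only: left_diff_distrib mult.assoc)
  qed (rule w_summable[OF h t])
  finally show "Fm (1/2) t \<ge> (1/2) ^ N * ((d t + p t 0) - mminus / real N)" by (simp add: e_def)
qed

lemma F_half_uniform:
  assumes "\<rho> > 0"
  shows "\<exists>\<psi>>0. \<forall>t\<ge>t0. (r t + p t 0 \<ge> \<rho> \<longrightarrow> Fp (1/2) t \<ge> \<psi>) \<and> (d t + p t 0 \<ge> \<rho> \<longrightarrow> Fm (1/2) t \<ge> \<psi>)"
proof -
  \<comment> \<open>With this \<open>N\<close> the moment terms \<open>mplus / N\<close> and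
    \<open>mminus / N\<close> use up at most half of \<rho>.\<close>
  obtain N :: nat where N: "N > 2 * (mplus + mminus) / \<rho>" using reals_Archimedean2 by blast
  have m: "mplus > 0" "mminus > 0" using mu_pos nu_pos by (simp_all add: mplus_def mminus_def)
  have "2 * (mplus + mminus) / \<rho> > 0" using m assms by simp
  then have N0: "real N > 0" using N by linarith
  have "2 * (mplus + mminus) < real N * \<rho>" using N assms by (simp add: divide_less_eq)
  then have q: "mplus / real N \<le> \<rho> / 2" "mminus / real N \<le> \<rho> / 2"
    using N0 m by (simp_all add: divide_le_eq algebra_simps)
  define \<psi> where "\<psi> = (1/2) ^ N * (\<rho> / 2)"
  have aux: "\<psi> \<le> (1/2) ^ N * (x - y)" if "x \<ge> \<rho>" "y \<le> \<rho> / 2" for x y :: real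
    unfolding \<psi>_def using that by (intro mult_left_mono) auto
  have "(r t + p t 0 \<ge> \<rho> \<longrightarrow> Fp (1/2) t \<ge> \<psi>) \<and> (d t + p t 0 \<ge> \<rho> \<longrightarrow> Fm (1/2) t \<ge> \<psi>)" if t: "t \<ge> t0" for t
    using F_half_lower[OF t, of N] N0 aux[OF _ q(1)] aux[OF _ q(2)] by (auto intro: order_trans)
  moreover have "\<psi> > 0" using assms by (simp add: \<psi>_def)
  ultimately show ?thesis by blast
qed

text \<open>Subtracting the mass of the half line cancels the boundary inflow in the derivative, so
  the growth of \<open>Xp\<close> and \<open>Xm\<close> depends on the interior of the half line and
  on \<open>p 0\<close> only.\<close>

definition Xp :: "real \<Rightarrow> real" where "Xp t = Fp (1/2) t - (r t + p t 0)"
definition Xm :: "real \<Rightarrow> real" where "Xm t = Fm (1/2) t - (d t + p t 0)"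

lemma X_bounds: assumes "t \<ge> t0" shows "\<bar>Xp t\<bar> \<le> 1" "\<bar>Xm t\<bar> \<le> 1"
  using F_half_bounds[OF assms] total[OF assms] r_pos[OF assms] d_pos[OF assms] p_nonneg[OF assms, of 0]
  by (auto simp: Xp_def Xm_def)

text \<open>At \<open>z = 1/2\<close> the derivative equals \<open>Fp - b * Fp / 2 - p 0\<close>,
  and \<open>b \<le> 1\<close>. For \<open>Xm\<close> the same computation uses
  \<open>a \<le> b\<close>.\<close>

lemma Xp_deriv:
  assumes t: "t \<ge> t0"
  shows "\<exists>X'. (Xp has_real_derivative X') (at t within {t0..}) \<and> X' \<ge> Fp (1/2) t / 2 - p t 0"
proof -
  have h: "expmoment (1/2)" by (rule expmoment_le_1) auto
  note DERIV_diff[OF Fp_deriv[OF h t] R_deriv[OF t]]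
  moreover have "b t * Fp (1/2) t \<le> 1 * Fp (1/2) t"
    using b_bounds[OF t] F_half_bounds[OF t] by (intro mult_right_mono) auto
  ultimately show ?thesis unfolding Xp_def[abs_def] by (intro exI conjI) (auto simp: field_simps)
qed

lemma Xm_deriv:
  assumes t: "t \<ge> t0"
  shows "\<exists>X'. (Xm has_real_derivative X') (at t within {t0..}) \<and> X' \<ge> b t * (Fm (1/2) t / 2 - p t 0)"
proof -
  have h: "expmoment (1/2)" by (rule expmoment_le_1) auto
  note DERIV_diff[OF Fm_deriv[OF h t] D_deriv[OF t]]
  moreover have "a t * Fm (1/2) t \<le> b t * Fm (1/2) t"
    using a_bounds[OF t] F_half_bounds[OF t] by (intro mult_right_mono) auto
  ultimately show ?thesis unfolding Xm_def[abs_def] by (intro exI conjI) (auto simp: field_simps)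
qed

text \<open>Selects the derivatives as functions of time, the form in which the barrier lemmas take
  them.\<close>

definition Xp' :: "real \<Rightarrow> real" where
  "Xp' t = (SOME X'. (Xp has_real_derivative X') (at t within {t0..}) \<and> X' \<ge> Fp (1/2) t / 2 - p t 0)"
definition Xm' :: "real \<Rightarrow> real" where
  "Xm' t = (SOME X'. (Xm has_real_derivative X') (at t within {t0..}) \<and> X' \<ge> b t * (Fm (1/2) t / 2 - p t 0))"

lemma X'_props:
  assumes "t \<ge> t0"
  shows "(Xp has_real_derivative Xp' t) (at t within {t0..})" "Xp' t \<ge> Fp (1/2) t / 2 - p t 0"
    "(Xm has_real_derivative Xm' t) (at t within {t0..})" "Xm' t \<ge> b t * (Fm (1/2) t / 2 - p t 0)"
  using someI_ex[OF Xp_deriv[OF assms]] someI_ex[OF Xm_deriv[OF assms]]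
  unfolding Xp'_def Xm'_def by blast+

text \<open>While \<open>r + p 0\<close> is small, almost all mass sits at or below the origin, and the Laplace transform
  \<open>Fm (1/2)\<close> grows at a rate proportional to \<open>b\<close>. As it is bounded, the integral of \<open>b\<close> over such
  a period is bounded, and \<open>r + p 0\<close> loses at most a fixed factor.\<close>

lemma R_uniform: "\<exists>\<rho>>0. \<forall>t\<ge>t0. r t + p t 0 \<ge> \<rho>"
proof -
  obtain \<psi> where \<psi>: "\<psi> > 0" "\<And>t. t \<ge> t0 \<Longrightarrow> d t + p t 0 \<ge> 1/2 \<Longrightarrow> Fm (1/2) t \<ge> \<psi>"
    using F_half_uniform[of "1/2"] by auto
  show ?thesis
  \<comment> \<open>The threshold 1/2 puts at least half of the mass at or below the origin, and
    \<psi>/4 leaves \<open>Fm / 2 - p 0\<close> at least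
    \<open>\<psi> / 2 - \<psi> / 4\<close>.\<close>
  proof (rule lower_bound_barrier[OF R_deriv X'_props(3) R_pos X_bounds(2), where \<kappa> = b and \<epsilon> = "min (1/2) (\<psi>/4)" and c = "\<psi>/4"])
    fix t assume t: "t \<ge> t0"
    have "a t * p t 0 \<le> b t * (r t + p t 0)"
      using a_bounds[OF t] p_nonneg[OF t, of 0] b_bounds[OF t] r_pos[OF t] by (intro mult_mono) auto
    then show "- b t * (r t + p t 0) \<le> J t (-1)"
      using rate_bounds(1)[OF t, of "-1"] by (simp add: J_def dr_def)
    assume R: "r t + p t 0 < min (1/2) (\<psi>/4)"
    then have "d t + p t 0 \<ge> 1/2" using total[OF t] p_nonneg[OF t, of 0] by auto
    then have "Fm (1/2) t \<ge> \<psi>" by (rule \<psi>(2)[OF t])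
    then have "b t * (\<psi>/4) \<le> b t * (Fm (1/2) t / 2 - p t 0)"
      using R r_pos[OF t] b_bounds[OF t] by (intro mult_left_mono) auto
    then show "b t * (\<psi>/4) \<le> Xm' t" using X'_props(4)[OF t] by simp
  qed (use \<psi> in auto)
qed

text \<open>Mirror image of \<open>R_uniform\<close>. The mass \<open>d + p 0\<close> is lost
  through upward jumps from 0 at a rate of at most 1, and \<open>Xp\<close> grows at a rate free of
  \<open>b\<close>, so \<kappa> is constant.\<close>

lemma D_uniform: "\<exists>\<rho>>0. \<forall>t\<ge>t0. d t + p t 0 \<ge> \<rho>"
proof -
  obtain \<psi> where \<psi>: "\<psi> > 0" "\<And>t. t \<ge> t0 \<Longrightarrow> r t + p t 0 \<ge> 1/2 \<Longrightarrow> Fp (1/2) t \<ge> \<psi>"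
    using F_half_uniform[of "1/2"] by auto
  show ?thesis
  proof (rule lower_bound_barrier[OF D_deriv X'_props(1) D_pos X_bounds(1), where \<kappa> = "\<lambda>_. 1" and \<epsilon> = "min (1/2) (\<psi>/4)" and c = "\<psi>/4"])
    fix t assume t: "t \<ge> t0"
    show "- 1 * (d t + p t 0) \<le> - J t 0"
      using rate_bounds(2)[OF t, of 0] rate_bounds(3)[OF t, of 1 1] d_pos[OF t] by (simp add: J_def)
    assume D: "d t + p t 0 < min (1/2) (\<psi>/4)"
    then have "r t + p t 0 \<ge> 1/2" using total[OF t] p_nonneg[OF t, of 0] by auto
    then have "Fp (1/2) t \<ge> \<psi>" by (rule \<psi>(2)[OF t])
    then show "1 * (\<psi>/4) \<le> Xp' t" using X'_props(2)[OF t] D d_pos[OF t] by simp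
  qed (use \<psi> in auto)
qed

lemma J_le: assumes "t \<ge> t0" shows "J t n \<le> 1" "- J t n \<le> 1"
  using rate_bounds(1,2)[OF assms, of n] rate_bounds(3,4)[OF assms, of "n + 1" "n + 1"]
    p_le_1[OF assms, of n] p_le_1[OF assms, of "n + 1"] by (auto simp: J_def)

lemma F_nonneg: assumes "z > 0" "t \<ge> t0" shows "Fp z t \<ge> 0" "Fm z t \<ge> 0"
  unfolding Fp_def Fm_def using assms p_nonneg by (auto intro!: infsum_nonneg simp: wp_def wm_def)

text \<open>A half line has mass at most 1, so the fraction of its mass that sits at the origin is
  at least \<open>p 0\<close>.\<close>

lemma one_minus_b: assumes "t \<ge> t0" shows "b t \<le> 1 - p t 0" "a t \<le> b t * (1 - p t 0)"
proof -
  have le: "x / (x + y) \<le> 1 - y" if "x > 0" "y \<ge> 0" "x + y \<le> 1" for x y :: real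
  proof -
    have "(x + y) * y \<le> 1 * y" using that by (intro mult_right_mono) auto
    then have "x \<le> (1 - y) * (x + y)" by (simp add: algebra_simps)
    then show ?thesis using that by (subst pos_divide_le_eq) auto
  qed
  show "b t \<le> 1 - p t 0" unfolding b_def
    by (rule le) (use r_pos[OF assms] p_nonneg[OF assms, of 0] total[OF assms] d_pos[OF assms] in auto)
  have "d t / (d t + p t 0) \<le> 1 - p t 0"
    by (rule le) (use r_pos[OF assms] p_nonneg[OF assms, of 0] total[OF assms] d_pos[OF assms] in auto)
  then show "a t \<le> b t * (1 - p t 0)" unfolding a_def
    using b_bounds[OF assms] by (intro mult_left_mono) auto
qed

text \<open>A bounded exponential moment makes the positive first moment uniformly integrable; a
  vanishing \<open>r\<close> could then not carry the conserved value \<open>mplus\<close>.\<close>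

lemma rich_uniform:
  assumes z: "z > 1" "\<And>t. t \<ge> t0 \<Longrightarrow> (\<lambda>n. wp z n * p t n) summable_on UNIV"
    and B: "\<And>t. t \<ge> t0 \<Longrightarrow> Fp z t \<le> B"
  shows "\<exists>\<rho>>0. \<forall>t\<ge>t0. r t \<ge> \<rho>"
proof -
  have m: "mplus > 0" using mu_pos nu_pos by (simp add: mplus_def)
  define B' where "B' = max B 1"
  \<comment> \<open>With this factor the exponential term absorbs at most half of
    \<open>mplus\<close>, which leaves the other half to the mass \<open>r\<close>.\<close>
  define \<delta> where "\<delta> = mplus / (2 * B')"
  have d: "\<delta> > 0" using m by (simp add: \<delta>_def B'_def)
  have "(\<lambda>n. real n * (1 / z) ^ n) \<longlonglongrightarrow> 0"
    by (rule powser_times_n_limit_0) (use z in simp)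
  then obtain N where N: "\<And>n. n \<ge> N \<Longrightarrow> real n * (1 / z) ^ n < \<delta>"
    using order_tendstoD(2)[OF _ d] by (force simp: eventually_sequentially)
  have lin: "real n \<le> real N + \<delta> * z ^ n" for n
  proof (cases "n \<ge> N")
    case True
    then have "real n * (1 / z) ^ n * z ^ n \<le> \<delta> * z ^ n" using z by (intro mult_right_mono less_imp_le[OF N[OF True]]) auto
    then show ?thesis using z by (simp add: power_one_over add_increasing)
  next
    case False
    then show ?thesis using d z by (simp add: add_increasing2)
  qed
  have "r t \<ge> mplus / (2 * (real N + 1))" if t: "t \<ge> t0" for t
  proof -
    have ind: "(\<lambda>n. (if n \<in> {1..} then 1 else 0) * p t n) summable_on UNIV"
      unfolding infsum_indicator_mult by (rule p_summable[OF t])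
    have "mplus \<le> (\<Sum>\<^sub>\<infinity>n. real N * ((if n \<in> {1..} then 1 else 0) * p t n) + \<delta> * (wp z n * p t n))"
      unfolding moments(1)[OF t, symmetric]
    proof (rule infsum_mono)
      show "(\<lambda>n. of_int (max n 0) * p t n) summable_on UNIV"
        by (rule weighted_summable[OF _ t first_moment[OF t]]) (auto simp: max_def)
      show "(\<lambda>n. real N * ((if n \<in> {1..} then 1 else 0) * p t n) + \<delta> * (wp z n * p t n)) summable_on UNIV"
        by (intro summable_on_add summable_on_cmult_right ind z(2) t)
      fix n :: int
      have "of_int (max n 0) \<le> real N * (if n \<in> {1..} then 1 else 0) + \<delta> * wp z n"
        using lin[of "nat n"] d z by (auto simp: wp_def max_def)
      then have "of_int (max n 0) * p t n \<le> (real N * (if n \<in> {1..} then 1 else 0) + \<delta> * wp z n) * p t n"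
        by (rule mult_right_mono[OF _ p_nonneg[OF t]])
      then show "of_int (max n 0) * p t n \<le> real N * ((if n \<in> {1..} then 1 else 0) * p t n) + \<delta> * (wp z n * p t n)"
        by (simp only: distrib_right mult.assoc)
    qed
    also have "\<dots> = real N * r t + \<delta> * Fp z t"
      unfolding infsum_add[OF summable_on_cmult_right[OF ind] summable_on_cmult_right[OF z(2)[OF t]]]
        infsum_cmult_right' infsum_indicator_mult by (simp add: Fp_def r_def rich_def)
    also have "\<dots> \<le> (real N + 1) * r t + \<delta> * B'"
      using B[OF t] d r_pos[OF t] by (intro add_mono mult_left_mono mult_right_mono) (auto simp: B'_def)
    also have "\<delta> * B' = mplus / 2" by (simp add: \<delta>_def B'_def)
    finally show ?thesis by (simp add: divide_le_eq algebra_simps)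
  qed
  then show ?thesis using m by (intro exI[of _ "mplus / (2 * (real N + 1))"]) auto
qed

text \<open>The exponential moment \<open>Fp z\<close> can grow only while \<open>p 0\<close> is small, but then \<open>Xp\<close> grows. Since
  \<open>Xp\<close> is bounded, \<open>Fp z t * exp (- (z - 1) * Xp t)\<close> is a Lyapunov function for \<open>z\<close> close to 1.\<close>

lemma exp_tail_bound:
  assumes c: "c > 1" "expmoment c"
  shows "\<exists>x B \<rho>. 0 < x \<and> x < 1 \<and> 0 \<le> B \<and> 0 < \<rho> \<and> (\<forall>t\<ge>t0. b t \<ge> \<rho> \<and> (\<forall>n. p t n \<le> B * x ^ nat \<bar>n\<bar>))"
proof -
  obtain \<rho>R \<rho>D where \<rho>: "\<rho>R > 0" "\<And>t. t \<ge> t0 \<Longrightarrow> r t + p t 0 \<ge> \<rho>R" "\<rho>D > 0" "\<And>t. t \<ge> t0 \<Longrightarrow> d t + p t 0 \<ge> \<rho>D"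
    using R_uniform D_uniform by blast
  obtain \<psi> where \<psi>: "\<psi> > 0" "\<And>t. t \<ge> t0 \<Longrightarrow> Fp (1/2) t \<ge> \<psi> \<and> Fm (1/2) t \<ge> \<psi>"
  proof -
    have "min \<rho>R \<rho>D > 0" using \<rho> by simp
    from F_half_uniform[OF this] obtain \<psi> where "\<psi> > 0"
      "\<forall>t\<ge>t0. (r t + p t 0 \<ge> min \<rho>R \<rho>D \<longrightarrow> Fp (1/2) t \<ge> \<psi>) \<and> (d t + p t 0 \<ge> min \<rho>R \<rho>D \<longrightarrow> Fm (1/2) t \<ge> \<psi>)"
      by blast
    then show thesis using that[of \<psi>] \<rho> by (metis min.coboundedI1 min.coboundedI2)
  qed
  \<comment> \<open>\<psi>/4 makes \<open>2 * k - p 0\<close> a lower bound for the growth of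
    \<open>Xp\<close>; 1/2 keeps \<open>1 - k\<close> positive.\<close>
  define k where "k = min (\<psi> / 4) (1/2)"
  have k: "k > 0" "k < 1" "2 * k \<le> \<psi> / 2" using \<psi> by (auto simp: k_def)
  \<comment> \<open>\<open>z \<le> c\<close> inherits the exponential moment from the initial datum;
    \<open>z \<le> 1 / (1 - k)\<close> means \<open>1 - 1 / z \<le> k\<close>.\<close>
  define z where "z = min c (1 / (1 - k))"
  have z1: "z > 1" using k c by (simp add: z_def)
  then have z0: "z > 0" by simp
  have zk: "1 - 1 / z \<le> k"
  proof -
    have "z * (1 - k) \<le> 1 / (1 - k) * (1 - k)" using k by (intro mult_right_mono) (auto simp: z_def)
    then show ?thesis using k z1 by (simp add: field_simps)
  qed
  have ez: "expmoment z"
    unfolding expmoment_def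
  proof
    show "(\<lambda>n. max 1 z ^ nat \<bar>n\<bar> * p t0 n) summable_on UNIV"
    proof (rule summable_on_dominated)
      show "(\<lambda>n. max 1 c ^ nat \<bar>n\<bar> * p t0 n) summable_on UNIV" using c by (simp add: expmoment_def)
      have "max 1 z ^ m \<le> max 1 c ^ m" for m by (intro power_mono) (auto simp: z_def)
      then show "\<bar>max 1 z ^ nat \<bar>n\<bar> * p t0 n\<bar> \<le> max 1 c ^ nat \<bar>n\<bar> * p t0 n" for n
        using p_nonneg[of t0 n] by (simp add: abs_mult mult_right_mono)
    qed
  qed (use z1 in simp)
  have drop: "u / z \<le> u" if "u \<ge> 0" for u :: real
    using z1 that mult_left_mono[of 1 z u] by (simp add: divide_le_eq)
  have "\<exists>B. \<forall>t\<ge>t0. Fp z t \<le> B"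
  proof (rule upper_bound_barrier[OF Fp_deriv[OF ez] X'_props(1) F_nonneg(1)[OF z0] X_bounds(1),
        where z = z and \<kappa> = "\<lambda>_. 1" and c = k and y = "\<lambda>t. p t 0" and kmin = 1])
    fix t assume t: "t \<ge> t0"
    have F0: "Fp z t \<ge> 0" by (rule F_nonneg) (use z1 t in auto)
    have "b t * Fp z t - (Fp z t - p t 0) / z = Fp z t * (b t - 1 / z) + p t 0 / z"
      by (simp add: algebra_simps diff_divide_distrib)
    also have "\<dots> \<le> Fp z t * (k - p t 0) + 1"
      using one_minus_b(1)[OF t] zk F0 drop[OF p_nonneg[OF t, of 0]] p_le_1[OF t, of 0]
      by (intro add_mono mult_left_mono) auto
    finally have "(z - 1) * (b t * Fp z t - (Fp z t - p t 0) / z) \<le> (z - 1) * (Fp z t * (k - p t 0) + 1)"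
      using z1 by (intro mult_left_mono) auto
    then show "J t (-1) + (z - 1) * (b t * Fp z t - (Fp z t - p t 0) / z) \<le> z + (z - 1) * 1 * Fp z t * (k - p t 0)"
      using J_le(1)[OF t, of "-1"] by (simp add: distrib_left mult.assoc)
    show "1 * (2 * k - p t 0) \<le> Xp' t" using X'_props(2)[OF t] \<psi>(2)[OF t] k by simp
  qed (use z1 k in auto)
  then obtain Bp where Bp: "\<And>t. t \<ge> t0 \<Longrightarrow> Fp z t \<le> Bp" by blast
  \<comment> \<open>\<open>Fp\<close> has to be bounded before \<open>Fm\<close>, because that bound
    yields the lower bound on \<open>b\<close> which serves as \<open>kmin\<close> for
    \<open>Fm\<close>.\<close>
  obtain \<rho> where r: "\<rho> > 0" "\<And>t. t \<ge> t0 \<Longrightarrow> r t \<ge> \<rho>"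
    using rich_uniform[OF z1 w_summable(1)[OF ez] Bp] by blast
  have b: "b t \<ge> \<rho>" if "t \<ge> t0" for t using r(2)[OF that] b_ge_r[OF that] by simp
  have "\<exists>B. \<forall>t\<ge>t0. Fm z t \<le> B"
  proof (rule upper_bound_barrier[OF Fm_deriv[OF ez] X'_props(3) F_nonneg(2)[OF z0] X_bounds(2),
        where z = z and \<kappa> = b and c = k and y = "\<lambda>t. p t 0" and kmin = \<rho>])
    fix t assume t: "t \<ge> t0"
    have F0: "Fm z t \<ge> 0" by (rule F_nonneg) (use z1 t in auto)
    have bp: "b t * (p t 0 / z) \<le> 1 * 1"
      using b_bounds[OF t] drop[OF p_nonneg[OF t, of 0]] p_le_1[OF t, of 0] p_nonneg[OF t, of 0] z1
      by (intro mult_mono) auto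
    have "a t * Fm z t \<le> b t * (1 - p t 0) * Fm z t"
      by (intro mult_right_mono one_minus_b(2) t F0)
    then have "a t * Fm z t - b t * (Fm z t - p t 0) / z
        \<le> b t * (1 - p t 0) * Fm z t - b t * (Fm z t - p t 0) / z" by simp
    also have "\<dots> = b t * (Fm z t * (1 - 1 / z - p t 0)) + b t * (p t 0 / z)"
      by (simp add: algebra_simps diff_divide_distrib)
    also have "\<dots> \<le> b t * (Fm z t * (k - p t 0)) + 1"
      using bp zk F0 b_bounds[OF t] by (intro add_mono mult_left_mono) auto
    finally have "(z - 1) * (a t * Fm z t - b t * (Fm z t - p t 0) / z) \<le> (z - 1) * (b t * (Fm z t * (k - p t 0)) + 1)"
      using z1 by (intro mult_left_mono) auto
    then show "- J t 0 + (z - 1) * (a t * Fm z t - b t * (Fm z t - p t 0) / z) \<le> z + (z - 1) * b t * Fm z t * (k - p t 0)"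
      using J_le(2)[OF t, of 0] by (simp add: distrib_left mult.assoc)
    have "b t * (2 * k - p t 0) \<le> b t * (Fm (1/2) t / 2 - p t 0)"
      using \<psi>(2)[OF t] k b_bounds[OF t] by (intro mult_left_mono) auto
    then show "b t * (2 * k - p t 0) \<le> Xm' t" using X'_props(4)[OF t] by simp
  qed (use z1 k r b in auto)
  then obtain Bm where Bm: "\<And>t. t \<ge> t0 \<Longrightarrow> Fm z t \<le> Bm" by blast
  define B where "B = max 0 (max Bp Bm)"
  have "p t n \<le> B * (1 / z) ^ nat \<bar>n\<bar>" if t: "t \<ge> t0" for t n
  proof -
    have w0: "wp z k * p t k \<ge> 0" "wm z k * p t k \<ge> 0" for k
      using z1 p_nonneg[OF t, of k] by (auto simp: wp_def wm_def)
    have "z ^ nat \<bar>n\<bar> * p t n \<le> B"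
    proof (cases "n \<ge> 0")
      case True
      have "wp z n * p t n \<le> Fp z t" unfolding Fp_def
        using finite_sum_le_infsum[OF w_summable(1)[OF ez t], of "{n}"] w0 by auto
      then show ?thesis using True Bp[OF t] by (simp add: wp_def B_def)
    next
      case False
      have "wm z n * p t n \<le> Fm z t" unfolding Fm_def
        using finite_sum_le_infsum[OF w_summable(2)[OF ez t], of "{n}"] w0 by auto
      then show ?thesis using False Bm[OF t] by (simp add: wm_def B_def abs_of_nonpos)
    qed
    then have "z ^ nat \<bar>n\<bar> * p t n * (1 / z) ^ nat \<bar>n\<bar> \<le> B * (1 / z) ^ nat \<bar>n\<bar>"
      using z1 by (intro mult_right_mono) auto
    then show ?thesis using z1 by (simp add: power_one_over)
  qed
  moreover have "0 < 1 / z" "1 / z < 1" "0 \<le> B" using z1 by (auto simp: B_def)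
  ultimately show ?thesis using r(1) b by blast
qed

end

section \<open>Convergence to equilibrium\<close>

text \<open>This is \<open>ln s \<le> s - 1\<close> at \<open>s = sqrt (y / x)\<close>. The linear
  correction \<open>x - y\<close> cancels when two probability sequences are summed.\<close>

lemma entropy_ge_hellinger:
  fixes x y :: real
  assumes "x \<ge> 0" "y > 0"
  shows "(sqrt x - sqrt y)\<^sup>2 + x - y \<le> x * ln (x / y)"
proof (cases "x = 0")
  case False
  then have x: "x > 0" using assms by simp
  define u v where "u = sqrt x" and "v = sqrt y"
  have uv: "u > 0" "v > 0" "x = u * u" "y = v * v" using x assms by (auto simp: u_def v_def)
  have "ln v - ln u \<le> (v - u) / u" by (rule ln_diff_le) (use uv in auto)
  then have "(ln v - ln u) * (u * u) \<le> (v - u) / u * (u * u)" by (rule mult_right_mono) simp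
  also have "(v - u) / u * (u * u) = (v - u) * u" using uv by simp
  finally have "x * ln (x / y) \<ge> 2 * (u * u - v * u)"
    using uv by (simp add: ln_div ln_mult algebra_simps)
  moreover have "(sqrt x - sqrt y)\<^sup>2 + x - y = 2 * (u * u - v * u)"
    unfolding u_def[symmetric] v_def[symmetric] unfolding uv(3,4) by (simp add: power2_eq_square algebra_simps)
  ultimately show ?thesis by simp
qed (use assms in simp)

lemma powr_le_mult:
  fixes x K s :: real
  assumes "0 \<le> x" "x \<le> K" "s > 1"
  shows "x powr s \<le> K powr (s - 1) * x"
proof (cases "x = 0")
  case False
  then have x: "x > 0" using assms by simp
  have "x powr s = x powr (s - 1) * x" using powr_add[of x "s - 1" 1] x by simp
  also have "\<dots> \<le> K powr (s - 1) * x"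
    using assms x by (intro mult_right_mono powr_mono2) auto
  finally show ?thesis .
qed simp

lemma tail_summable:
  assumes "0 < x" "x < 1"
  shows "(\<lambda>n. (1 + real_of_int \<bar>n\<bar>) * (B * x ^ nat \<bar>n\<bar> + B * x ^ nat \<bar>n + 1\<bar>)) summable_on UNIV"
    and "(\<lambda>n. (1 + real_of_int \<bar>n\<bar>) * (B * x ^ nat \<bar>n\<bar>)) summable_on UNIV"
proof -
  have 1: "(\<lambda>n. (1 + real_of_int \<bar>n\<bar>) * x ^ nat \<bar>n\<bar>) summable_on UNIV"
    by (rule summable_on_int_geometric) (use assms in auto)
  have 2: "(\<lambda>n. (1 + real_of_int \<bar>n\<bar>) * x ^ nat \<bar>n + 1\<bar>) summable_on UNIV"
    by (rule shifted_weight_summable(2)[OF tame_linear _ 1]) (use assms in auto)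
  show "(\<lambda>n. (1 + real_of_int \<bar>n\<bar>) * (B * x ^ nat \<bar>n\<bar> + B * x ^ nat \<bar>n + 1\<bar>)) summable_on UNIV"
    using summable_on_add[OF summable_on_cmult_right[OF 1, of B] summable_on_cmult_right[OF 2, of B]]
    by (simp add: distrib_left mult.left_commute)
  show "(\<lambda>n. (1 + real_of_int \<bar>n\<bar>) * (B * x ^ nat \<bar>n\<bar>)) summable_on UNIV"
    using summable_on_cmult_right[OF 1, of B] by (simp add: mult.left_commute)
qed

lemma lp_space_prob:
  assumes "\<And>n. 0 \<le> u n" "u summable_on UNIV" "\<And>n. u n \<le> 1" "s > 1"
  shows "u \<in> lp_space s"
  unfolding lp_space_def
proof
  show "(\<lambda>n. \<bar>u n\<bar> powr s) summable_on UNIV"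
  proof (rule summable_on_dominated[OF assms(2)])
    fix n
    show "\<bar>\<bar>u n\<bar> powr s\<bar> \<le> u n"
      using powr_le_mult[of "u n" 1 s] assms by simp
  qed
qed

context phase2
begin

lemma ps_nonneg: "ps n \<ge> 0" using p_star_pos[OF mu_pos nu_pos, of n] by simp

lemma ps_summable: "ps summable_on UNIV" and ps_infsum: "infsum ps UNIV = 1"
  using p_star_has_sum[OF mu_pos nu_pos] by (auto simp: has_sum_iff)

lemma H_ge_hellinger:
  assumes t: "t \<ge> t0"
  shows "(sqrt (p t n) - sqrt (ps n))\<^sup>2 \<le> H t"
proof -
  define h where "h n = (sqrt (p t n) - sqrt (ps n))\<^sup>2" for n
  have le: "h n + (p t n - ps n) \<le> rel_entropy_term (p t) ps n" for n
    using entropy_ge_hellinger[OF p_nonneg[OF t] p_star_pos[OF mu_pos nu_pos], of n n]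
    by (simp add: h_def rel_entropy_term_def)
  have pd: "(\<lambda>n. p t n - ps n) summable_on UNIV"
    by (intro summable_on_real_diff p_summable t ps_summable)
  have hs: "h summable_on UNIV"
  proof (rule summable_on_dominated)
    show "(\<lambda>n. rel_entropy_term (p t) ps n - (p t n - ps n)) summable_on UNIV"
      by (rule summable_on_real_diff[OF entropy_summable[OF t] pd])
    show "\<bar>h n\<bar> \<le> rel_entropy_term (p t) ps n - (p t n - ps n)" for n
      using le[of n] by (simp add: h_def)
  qed
  have "h n \<le> infsum h UNIV"
    using finite_sum_le_infsum[OF hs, of "{n}"] by (simp add: h_def)
  also have "\<dots> = (\<Sum>\<^sub>\<infinity>n. h n + (p t n - ps n))"
    using infsum_add[OF hs pd] infsum_real_diff[OF p_summable[OF t] ps_summable] p_infsum[OF t] ps_infsum by simp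
  also have "\<dots> \<le> H t" unfolding H_def rel_entropy_def
    by (intro infsum_mono summable_on_add hs pd entropy_summable t le)
  finally show ?thesis by (simp add: h_def)
qed

lemma H_nonneg: "t \<ge> t0 \<Longrightarrow> H t \<ge> 0"
  using H_ge_hellinger[of t 0] by (smt (verit) zero_le_power2)

text \<open>Otherwise \<open>H\<close> would fall at least linearly and become negative by the time
  \<open>S\<close>.\<close>

lemma small_dissipation:
  assumes e: "e > 0" and T: "T > t0"
  shows "\<exists>t\<ge>T. real_of_ereal (dissipation (p t)) < e"
proof (rule ccontr)
  assume "\<not> ?thesis"
  then have big: "real_of_ereal (dissipation (p t)) \<ge> e" if "t \<ge> T" for t using that by force
  define S where "S = T + (H T + 1) / e"
  have TS: "T \<le> S" using H_nonneg[of T] T e by (simp add: S_def)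
  have "H S + e * S \<le> H T + e * T"
  proof (rule has_derivative_within_antimono[OF TS, where S = UNIV
        and f = "\<lambda>t. H t + e * t" and f' = "\<lambda>t. - real_of_ereal (dissipation (p t)) + e"])
    fix x assume x: "T \<le> x" "x \<le> S"
    show "((\<lambda>t. H t + e * t) has_real_derivative - real_of_ereal (dissipation (p x)) + e) (at x)"
      using x T by (intro DERIV_add H_deriv_interior DERIV_cmult_Id) auto
    show "- real_of_ereal (dissipation (p x)) + e \<le> 0" using big[OF x(1)] by simp
  qed simp
  moreover have "e * S = e * T + H T + 1"
  proof -
    have "e * ((H T + 1) / e) = H T + 1" using e by simp
    then show ?thesis by (simp only: S_def distrib_left add.assoc)
  qed
  ultimately have "H S < 0" by simp
  then show False using H_nonneg[of S] TS T by simp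
qed

lemma flux_le_dissipation:
  assumes t: "t > t0"
  shows "(J t n)\<^sup>2 \<le> real_of_ereal (dissipation (p t))"
proof -
  have t': "t0 \<le> t" using t by simp
  define u v where "u = dr t (n + 1) * p t (n + 1)" and "v = b t * p t n"
  have "u > 0" "v > 0" using p_pos[OF t] dr_pos[OF t'] b_pos[OF t'] by (auto simp: u_def v_def)
  moreover have "u \<le> 1" "v \<le> 1"
    using rate_bounds(4)[OF t', of "n + 1" "n + 1"] rate_bounds(2)[OF t', of n] p_le_1[OF t', of n] p_le_1[OF t', of "n + 1"]
    by (auto simp: u_def v_def)
  ultimately have "(u - v)\<^sup>2 \<le> gap u v" by (intro gap_ge_square) auto
  also have "\<dots> \<le> real_of_ereal (dissipation (p t))"
    unfolding u_def v_def by (rule dissipation_finite(2)[OF t' p_pos[OF t] gap_summable[OF t]])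
  finally show ?thesis by (simp add: J_def u_def v_def power2_commute)
qed

text \<open>Each edge is weighted by the distance of its far end from the origin. The conserved
  moments then evaluate the sums, so vanishing fluxes give two equations for \<open>r\<close>,
  \<open>d\<close> and \<open>p 0\<close>.\<close>

lemma flux_moments:
  assumes t: "t \<ge> t0"
  shows "(\<Sum>\<^sub>\<infinity>n\<in>{0..}. (1 + of_int n) * J t n) = b t * (mplus + (r t + p t 0)) - mplus"
    and "(\<Sum>\<^sub>\<infinity>n\<in>{..-1}. of_int (- n) * J t n) = b t * mminus - a t * (mminus + (d t + p t 0))"
proof -
  have s1: "(\<lambda>n. of_int (max n 0) * p t n) summable_on A"
    and s2: "(\<lambda>n. of_int (max (- n) 0) * p t n) summable_on A" for A
    by (rule summable_on_subset[OF weighted_summable[OF _ t first_moment[OF t]]]; auto simp: max_def)+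
  note ps = p_summable[OF t]
  have m1: "(\<Sum>\<^sub>\<infinity>n\<in>{0..}. of_int n * p t n) = mplus" "(\<lambda>n. of_int n * p t n) summable_on {0..}"
    "(\<Sum>\<^sub>\<infinity>n\<in>{1..}. of_int n * p t n) = mplus" "(\<lambda>n. of_int n * p t n) summable_on {1..}"
  proof -
    show "(\<Sum>\<^sub>\<infinity>n\<in>{0..}. of_int n * p t n) = mplus" "(\<Sum>\<^sub>\<infinity>n\<in>{1..}. of_int n * p t n) = mplus"
      unfolding moments(1)[OF t, symmetric] by (rule infsum_cong_neutral; auto simp: max_def)+
    show "(\<lambda>n. of_int n * p t n) summable_on {0..}" "(\<lambda>n. of_int n * p t n) summable_on {1..}"
      by (rule summable_on_cong[THEN iffD1, OF _ s1]; simp)+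
  qed
  have m2: "(\<Sum>\<^sub>\<infinity>n\<in>{..-1}. of_int (- n) * p t n) = mminus" "(\<lambda>n. of_int (- n) * p t n) summable_on {..-1}"
    "(\<Sum>\<^sub>\<infinity>n\<in>{..0}. of_int (- n) * p t n) = mminus" "(\<lambda>n. of_int (- n) * p t n) summable_on {..0}"
  proof -
    show "(\<Sum>\<^sub>\<infinity>n\<in>{..-1}. of_int (- n) * p t n) = mminus" "(\<Sum>\<^sub>\<infinity>n\<in>{..0}. of_int (- n) * p t n) = mminus"
      unfolding moments(2)[OF t, symmetric] by (rule infsum_cong_neutral; auto simp: max_def)+
    show "(\<lambda>n. of_int (- n) * p t n) summable_on {..-1}" "(\<lambda>n. of_int (- n) * p t n) summable_on {..0}"
      by (rule summable_on_cong[THEN iffD1, OF _ s2]; simp)+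
  qed
  have sh1: "(\<Sum>\<^sub>\<infinity>n\<in>{0..}. of_int (n + 1) * p t (n + 1)) = mplus"
    unfolding m1(3)[symmetric]
    by (rule infsum_reindex_bij_witness[where i = "\<lambda>n. n - 1" and j = "\<lambda>n. n + 1"]) auto
  have sh1s: "(\<lambda>n. of_int (n + 1) * p t (n + 1)) summable_on {0..}"
    by (rule summable_on_reindex_bij_witness[where i = "\<lambda>n. n - 1" and j = "\<lambda>n. n + 1" and S = "{0..}" and T = "{1..}",
          THEN iffD2, OF _ _ _ _ _ m1(4)]) auto
  have "(\<Sum>\<^sub>\<infinity>n\<in>{0..}. (1 + of_int n) * J t n)
      = (\<Sum>\<^sub>\<infinity>n\<in>{0..}. b t * (of_int n * p t n + p t n) - of_int (n + 1) * p t (n + 1))"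
    by (rule infsum_cong) (auto simp: J_def dr_def algebra_simps)
  also have "\<dots> = b t * (mplus + (r t + p t 0)) - mplus"
    unfolding infsum_real_diff[OF summable_on_cmult_right[OF summable_on_add[OF m1(2) ps]] sh1s] infsum_cmult_right'
      infsum_add[OF m1(2) ps] sh1 m1(1) R_infsum[OF t] ..
  finally show "(\<Sum>\<^sub>\<infinity>n\<in>{0..}. (1 + of_int n) * J t n) = b t * (mplus + (r t + p t 0)) - mplus" .
  have sh2: "(\<Sum>\<^sub>\<infinity>n\<in>{..-1}. of_int (- (n + 1)) * p t (n + 1) + p t (n + 1)) = mminus + (d t + p t 0)"
    unfolding m2(3)[symmetric] D_infsum[OF t, symmetric] infsum_add[OF m2(4) ps, symmetric]
    by (rule infsum_reindex_bij_witness[where i = "\<lambda>n. n - 1" and j = "\<lambda>n. n + 1"]) auto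
  have sh2s: "(\<lambda>n. of_int (- (n + 1)) * p t (n + 1) + p t (n + 1)) summable_on {..-1}"
    by (rule summable_on_reindex_bij_witness[where i = "\<lambda>n. n - 1" and j = "\<lambda>n. n + 1" and S = "{..-1}" and T = "{..0}",
          THEN iffD2, OF _ _ _ _ _ summable_on_add[OF m2(4) ps]]) auto
  have "(\<Sum>\<^sub>\<infinity>n\<in>{..-1}. of_int (- n) * J t n)
      = (\<Sum>\<^sub>\<infinity>n\<in>{..-1}. b t * (of_int (- n) * p t n) - a t * (of_int (- (n + 1)) * p t (n + 1) + p t (n + 1)))"
    by (rule infsum_cong) (auto simp: J_def dr_def algebra_simps)
  also have "\<dots> = b t * mminus - a t * (mminus + (d t + p t 0))"
    unfolding infsum_real_diff[OF summable_on_cmult_right[OF m2(2)] summable_on_cmult_right[OF sh2s]] infsum_cmult_right'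
      sh2 m2(1) ..
  finally show "(\<Sum>\<^sub>\<infinity>n\<in>{..-1}. of_int (- n) * J t n) = b t * mminus - a t * (mminus + (d t + p t 0))" .
qed

text \<open>Clearing denominators shows the equilibrium relations: if the flux sums vanish, then
  \<open>r * (r + p 0) = mplus * p 0\<close> and
  \<open>d * (d + p 0) = mminus * p 0\<close>.\<close>

lemma flux_moments_scaled:
  assumes t: "t \<ge> t0"
  shows "(r t + p t 0) * (b t * (mplus + (r t + p t 0)) - mplus) = r t * (r t + p t 0) - mplus * p t 0"
    and "(d t + p t 0) * ((b t * mminus - a t * (mminus + (d t + p t 0))) / b t) = mminus * p t 0 - d t * (d t + p t 0)"
proof -
  have "(r t + p t 0) * b t = r t" using R_pos[OF t] by (simp add: b_def)
  then have "(r t + p t 0) * (b t * (mplus + (r t + p t 0)) - mplus)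
      = r t * (mplus + (r t + p t 0)) - (r t + p t 0) * mplus"
    by (simp add: right_diff_distrib flip: mult.assoc)
  then show "(r t + p t 0) * (b t * (mplus + (r t + p t 0)) - mplus) = r t * (r t + p t 0) - mplus * p t 0"
    by (simp add: algebra_simps)
  define q where "q = d t / (d t + p t 0)"
  have a: "a t = b t * q" by (simp add: a_def q_def)
  have q: "(d t + p t 0) * q = d t" using D_pos[OF t] by (simp add: q_def)
  have "(b t * mminus - a t * (mminus + (d t + p t 0))) / b t = mminus - q * (mminus + (d t + p t 0))"
    using b_pos[OF t] by (simp add: a diff_divide_distrib)
  then have "(d t + p t 0) * ((b t * mminus - a t * (mminus + (d t + p t 0))) / b t)
      = (d t + p t 0) * mminus - ((d t + p t 0) * q) * (mminus + (d t + p t 0))"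
    by (simp add: right_diff_distrib mult.assoc)
  then show "(d t + p t 0) * ((b t * mminus - a t * (mminus + (d t + p t 0))) / b t) = mminus * p t 0 - d t * (d t + p t 0)"
    unfolding q by (simp add: algebra_simps)
qed

text \<open>Along the times \<open>\<tau> k\<close> the defects \<open>e1\<close> and
  \<open>e2\<close> of the two equilibrium relations tend to 0. They determine \<open>p 0\<close>
  through a quadratic and with it \<open>r\<close> and \<open>d\<close>; the vanishing fluxes carry
  this to every site. The geometric tail dominates both the flux sums and the entropy terms.\<close>

lemma H_tendsto_0:
  assumes c: "c > 1" "expmoment c"
  shows "(H \<longlongrightarrow> 0) at_top"
proof -
  obtain x B \<rho> where x: "0 < x" "x < 1" and B: "0 \<le> B" and \<rho>: "0 < \<rho>"
    and b: "\<And>t. t \<ge> t0 \<Longrightarrow> b t \<ge> \<rho>" and tail: "\<And>t n. t \<ge> t0 \<Longrightarrow> p t n \<le> B * x ^ nat \<bar>n\<bar>"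
    using exp_tail_bound[OF c] by blast
  define \<tau> where "\<tau> k = (SOME t. t \<ge> t0 + 1 \<and> real_of_ereal (dissipation (p t)) < 1 / real (Suc k))" for k
  have \<tau>: "\<tau> k \<ge> t0 + 1" "real_of_ereal (dissipation (p (\<tau> k))) < 1 / real (Suc k)" for k
  proof -
    have "\<exists>t. t \<ge> t0 + 1 \<and> real_of_ereal (dissipation (p t)) < 1 / real (Suc k)"
      using small_dissipation[of "1 / real (Suc k)" "t0 + 1"] by auto
    from someI_ex[OF this] show "\<tau> k \<ge> t0 + 1" "real_of_ereal (dissipation (p (\<tau> k))) < 1 / real (Suc k)"
      unfolding \<tau>_def by auto
  qed
  have \<tau>0: "\<tau> k \<ge> t0" "\<tau> k > t0" for k using \<tau>(1)[of k] by auto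
  define q r' d' where "q k = p (\<tau> k) 0" and "r' k = r (\<tau> k)" and "d' k = d (\<tau> k)" for k
  define R D where "R k = r' k + q k" and "D k = d' k + q k" for k
  have pos: "0 \<le> q k" "q k \<le> 1" "0 < r' k" "0 < d' k" "r' k + q k + d' k = 1" for k
    using p_nonneg[OF \<tau>0(1)[of k], of 0] p_le_1[OF \<tau>0(1)[of k], of 0] r_pos[OF \<tau>0(1)] d_pos[OF \<tau>0(1)] total[OF \<tau>0(1)]
    by (auto simp: q_def r'_def d'_def)
  have RD: "0 < R k" "R k \<le> 1" "0 < D k" "D k \<le> 1" for k using pos[of k] unfolding R_def D_def by linarith+
  have inv: "(\<lambda>k. 1 / real (Suc k)) \<longlonglongrightarrow> 0" using LIMSEQ_inverse_real_of_nat by (simp only: inverse_eq_divide)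
  have Jlim: "(\<lambda>k. J (\<tau> k) n) \<longlonglongrightarrow> 0" for n
  proof -
    have "(J (\<tau> k) n)\<^sup>2 \<le> 1 / real (Suc k)" for k
      using flux_le_dissipation[OF \<tau>0(2)[of k], of n] \<tau>(2)[of k] by linarith
    then have "(\<lambda>k. (J (\<tau> k) n)\<^sup>2) \<longlonglongrightarrow> 0"
      by (intro tendsto_sandwich[OF _ _ tendsto_const inv] always_eventually allI) (rule zero_le_power2)
    then have "(\<lambda>k. sqrt ((J (\<tau> k) n)\<^sup>2)) \<longlonglongrightarrow> sqrt 0" by (rule tendsto_real_sqrt)
    then show ?thesis by (simp add: tendsto_rabs_zero_iff)
  qed
  have Jtail: "\<bar>J t n\<bar> \<le> B * x ^ nat \<bar>n\<bar> + B * x ^ nat \<bar>n + 1\<bar>" if "t \<ge> t0" for t n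
    using J_abs[OF that, of n] tail[OF that, of n] tail[OF that, of "n + 1"] by linarith
  have momlim: "(\<lambda>k. \<Sum>\<^sub>\<infinity>n\<in>A. w n * J (\<tau> k) n) \<longlonglongrightarrow> 0" if w: "\<And>n. n \<in> A \<Longrightarrow> \<bar>w n\<bar> \<le> 1 + real_of_int \<bar>n\<bar>" for A w
  proof -
    have "(\<lambda>k. \<Sum>\<^sub>\<infinity>n\<in>A. w n * J (\<tau> k) n) \<longlonglongrightarrow> (\<Sum>\<^sub>\<infinity>n\<in>A. w n * 0)"
    proof (rule tendsto_infsum_dominated[where M = "\<lambda>n. (1 + real_of_int \<bar>n\<bar>) * (B * x ^ nat \<bar>n\<bar> + B * x ^ nat \<bar>n + 1\<bar>)"])
      show "(\<lambda>k. w n * J (\<tau> k) n) \<longlonglongrightarrow> w n * 0" for n by (intro tendsto_intros Jlim)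
      show "\<forall>\<^sub>F k in sequentially. \<forall>n\<in>A. \<bar>w n * J (\<tau> k) n\<bar>
          \<le> (1 + real_of_int \<bar>n\<bar>) * (B * x ^ nat \<bar>n\<bar> + B * x ^ nat \<bar>n + 1\<bar>)"
        unfolding abs_mult by (intro always_eventually allI ballI mult_mono w Jtail \<tau>0) auto
      show "(\<lambda>n. (1 + real_of_int \<bar>n\<bar>) * (B * x ^ nat \<bar>n\<bar> + B * x ^ nat \<bar>n + 1\<bar>)) summable_on A"
        by (rule summable_on_subset[OF tail_summable(1)[OF x]]) simp
    qed
    then show ?thesis by simp
  qed
  define e1 e2 where "e1 k = r' k * R k - mplus * q k" and "e2 k = d' k * D k - mminus * q k" for k
  have e1: "e1 \<longlonglongrightarrow> 0"
  proof -
    have l: "(\<lambda>k. \<Sum>\<^sub>\<infinity>n\<in>{0..}. (1 + of_int n) * J (\<tau> k) n) \<longlonglongrightarrow> 0" by (rule momlim) auto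
    have "e1 k = R k * (\<Sum>\<^sub>\<infinity>n\<in>{0..}. (1 + of_int n) * J (\<tau> k) n)" for k
      unfolding flux_moments(1)[OF \<tau>0(1)]
      using flux_moments_scaled(1)[OF \<tau>0(1), of k] by (simp add: e1_def R_def r'_def q_def)
    then have "\<bar>e1 k\<bar> \<le> \<bar>\<Sum>\<^sub>\<infinity>n\<in>{0..}. (1 + of_int n) * J (\<tau> k) n\<bar>" for k
      using RD[of k] by (simp add: abs_mult mult_left_le_one_le)
    then show ?thesis by (intro Lim_null_comparison[OF _ tendsto_rabs_zero[OF l]]) auto
  qed
  have e2: "e2 \<longlonglongrightarrow> 0"
  proof -
    have l: "(\<lambda>k. \<Sum>\<^sub>\<infinity>n\<in>{..-1}. of_int (- n) * J (\<tau> k) n) \<longlonglongrightarrow> 0" by (rule momlim) auto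
    define S where "S k = (\<Sum>\<^sub>\<infinity>n\<in>{..-1}. of_int (- n) * J (\<tau> k) n)" for k
    have "e2 k = - (D k * (S k / b (\<tau> k)))" for k
      unfolding S_def flux_moments(2)[OF \<tau>0(1)]
      using flux_moments_scaled(2)[OF \<tau>0(1), of k] by (simp add: e2_def D_def d'_def q_def)
    then have "\<bar>e2 k\<bar> \<le> \<bar>S k\<bar> / \<rho>" for k
    proof -
      have "\<bar>D k * Y\<bar> \<le> \<bar>Y\<bar>" for Y
        using mult_right_mono[of "D k" 1 "\<bar>Y\<bar>"] RD[of k] by (simp add: abs_mult)
      then have "\<bar>D k * (S k / b (\<tau> k))\<bar> \<le> \<bar>S k / b (\<tau> k)\<bar>" .
      also have "\<dots> = \<bar>S k\<bar> / b (\<tau> k)" using b[OF \<tau>0(1), of k] \<rho> by (simp add: abs_divide)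
      also have "\<dots> \<le> \<bar>S k\<bar> / \<rho>" using b[OF \<tau>0(1), of k] \<rho> by (intro divide_left_mono) auto
      finally show ?thesis using \<open>e2 k = - (D k * (S k / b (\<tau> k)))\<close> by simp
    qed
    moreover have "(\<lambda>k. \<bar>S k\<bar> / \<rho>) \<longlonglongrightarrow> 0"
      using tendsto_divide_zero[OF tendsto_rabs_zero[OF l], of \<rho>] by (simp add: S_def)
    ultimately show ?thesis by (intro Lim_null_comparison[of e2 "\<lambda>k. \<bar>S k\<bar> / \<rho>"]) auto
  qed
  \<comment> \<open>As \<open>r + q + d = 1\<close> and \<open>mplus - mminus = \<mu>\<close>, the
    difference of the defects is linear: it measures how far \<open>r - d\<close> is from
    \<open>\<mu> * q\<close>, so \<open>r\<close> and \<open>d\<close> become affine in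
    \<open>q\<close> up to \<open>w\<close>.\<close>
  define w where "w k = e1 k - e2 k" for k
  have w: "w \<longlonglongrightarrow> 0" unfolding w_def[abs_def] using tendsto_diff[OF e1 e2] by simp
  have wrd: "w k = r' k - d' k - \<mu> * q k" for k
  proof -
    have "r' k * R k - d' k * D k = (r' k - d' k) * (r' k + q k + d' k)"
      by (simp add: R_def D_def algebra_simps)
    then have "r' k * R k - d' k * D k = r' k - d' k" using pos(5)[of k] by simp
    then show ?thesis by (simp add: w_def e1_def e2_def mplus_def mminus_def algebra_simps)
  qed
  have rw: "r' k = (1 + (\<mu> - 1) * q k + w k) / 2" and dw: "d' k = (1 - (1 + \<mu>) * q k - w k) / 2" for k
    using wrd[of k] pos(5)[of k] by (simp_all add: algebra_simps)
  define Q where "Q = p0_star \<mu> \<nu>"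
  note Qp = p0_star_props[OF mu_pos nu_pos, folded Q_def]
  \<comment> \<open>The quadratic with root \<open>Q\<close>, evaluated at \<open>q k\<close>.
    Inserting the formula for \<open>r' k\<close> into \<open>e1\<close> shows that it differs from
    \<open>4 * e1 k\<close> only by terms containing \<open>w k\<close>.\<close>
  define f where "f k = (\<mu>\<^sup>2 - 1) * (q k)\<^sup>2 - 4 * \<mu> * (\<nu> + 1 / 2) * q k + 1" for k
  have f: "f \<longlonglongrightarrow> 0"
  proof -
    have feq: "f k = 4 * e1 k - w k * (2 + 2 * \<mu> * q k) - w k * w k" for k
    proof -
      have "4 * (r' k * R k) = (2 * r' k) * (2 * r' k + 2 * q k)" by (simp add: R_def algebra_simps)
      also have "\<dots> = (1 + (\<mu> - 1) * q k + w k) * (1 + (\<mu> + 1) * q k + w k)"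
      proof -
        have "2 * r' k = 1 + (\<mu> - 1) * q k + w k" unfolding rw by simp
        moreover from this have "2 * r' k + 2 * q k = 1 + (\<mu> + 1) * q k + w k"
          by (simp add: algebra_simps)
        ultimately show ?thesis by (simp only:)
      qed
      finally show ?thesis
        by (simp add: f_def e1_def mplus_def power2_eq_square algebra_simps)
    qed
    have wq: "(\<lambda>k. w k * (2 + 2 * \<mu> * q k)) \<longlonglongrightarrow> 0"
    proof (rule Lim_null_comparison)
      show "\<forall>\<^sub>F k in sequentially. norm (w k * (2 + 2 * \<mu> * q k)) \<le> \<bar>w k\<bar> * (2 + 2 * \<mu>)"
      proof (intro always_eventually allI)
        fix k
        have "0 \<le> \<mu> * q k" "\<mu> * q k \<le> \<mu> * 1" using pos[of k] mu_pos by (auto intro!: mult_left_mono)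
        then have "\<bar>2 + 2 * \<mu> * q k\<bar> \<le> 2 + 2 * \<mu>" by simp
        then show "norm (w k * (2 + 2 * \<mu> * q k)) \<le> \<bar>w k\<bar> * (2 + 2 * \<mu>)"
          by (simp add: abs_mult mult_left_mono)
      qed
      show "(\<lambda>k. \<bar>w k\<bar> * (2 + 2 * \<mu>)) \<longlonglongrightarrow> 0"
        using tendsto_mult_left_zero[OF tendsto_rabs_zero[OF w]] .
    qed
    have "(\<lambda>k. 4 * e1 k - w k * (2 + 2 * \<mu> * q k) - w k * w k) \<longlonglongrightarrow> 4 * 0 - 0 - 0 * 0"
      by (intro tendsto_intros e1 wq w)
    then show ?thesis by (simp add: feq[abs_def])
  qed
  define \<kappa> where "\<kappa> = min 1 (2 * \<mu>)"
  have \<kappa>: "\<kappa> > 0" using mu_pos by (simp add: \<kappa>_def)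
  have qlim: "q \<longlonglongrightarrow> Q"
  proof -
    have "\<forall>\<^sub>F k in sequentially. \<mu> * \<bar>w k\<bar> < 1"
      using order_tendstoD(2)[OF tendsto_mult_right_zero[OF tendsto_rabs_zero[OF w], of \<mu>], of 1] by simp
    then have "\<forall>\<^sub>F k in sequentially. norm (q k - Q) \<le> \<bar>f k\<bar> / \<kappa>"
    proof eventually_elim
      case (elim k)
      \<comment> \<open>The divided difference of the quadratic between \<open>q k\<close> and
        \<open>Q\<close>. Staying below \<open>- \<kappa>\<close>, it rules out convergence to
        another root.\<close>
      define Br where "Br = (\<mu>\<^sup>2 - 1) * (q k + Q) - 4 * \<mu> * (\<nu> + 1 / 2)"
      have fB: "f k = (q k - Q) * Br"
      proof -
        have "f k = f k - ((\<mu>\<^sup>2 - 1) * Q\<^sup>2 - 4 * \<mu> * (\<nu> + 1 / 2) * Q + 1)" using Qp(3) by simp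
        also have "\<dots> = (q k - Q) * Br" by (simp add: f_def Br_def power2_eq_square algebra_simps)
        finally show ?thesis .
      qed
      have mn: "\<mu> * \<nu> > 0" using mu_pos nu_pos by simp
      have "Br \<le> - \<kappa>"
      proof (cases "\<mu> \<ge> 1")
        case True
        \<comment> \<open>Positivity of \<open>d' k\<close> keeps \<open>q k\<close>, up to
          \<open>w k\<close>, in the interval that contains only one root.\<close>
        have "(1 + \<mu>) * q k \<le> 1 - w k" using dw[of k] pos(4)[of k] by simp
        then have "(\<mu> - 1) * ((1 + \<mu>) * q k + (1 + \<mu>) * Q) \<le> (\<mu> - 1) * ((1 - w k) + 1)"
          using True Qp(2) by (intro mult_left_mono) auto
        moreover have "(\<mu> - 1) * ((1 + \<mu>) * q k + (1 + \<mu>) * Q) = (\<mu>\<^sup>2 - 1) * (q k + Q)"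
          by (simp add: power2_eq_square algebra_simps)
        moreover have "- ((\<mu> - 1) * w k) \<le> \<mu> * \<bar>w k\<bar>"
        proof -
          have "- ((\<mu> - 1) * w k) = (\<mu> - 1) * (- w k)" by simp
          also have "\<dots> \<le> (\<mu> - 1) * \<bar>w k\<bar>" using True by (intro mult_left_mono) auto
          also have "\<dots> \<le> \<mu> * \<bar>w k\<bar>" by (intro mult_right_mono) auto
          finally show ?thesis .
        qed
        ultimately have "Br \<le> -1" using elim mn unfolding Br_def by (simp add: algebra_simps)
        then show ?thesis by (simp add: \<kappa>_def)
      next
        case False
        have "\<mu>\<^sup>2 \<le> 1" using False mu_pos by (simp add: power_le_one)
        then have "(\<mu>\<^sup>2 - 1) * (q k + Q) \<le> 0" using pos(1)[of k] Qp(1) by (intro mult_nonpos_nonneg) auto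
        then have "Br \<le> - (2 * \<mu>)" using mn unfolding Br_def by (simp add: algebra_simps)
        then show ?thesis by (simp add: \<kappa>_def)
      qed
      then have "\<kappa> \<le> \<bar>Br\<bar>" using \<kappa> by simp
      then have "\<bar>q k - Q\<bar> * \<kappa> \<le> \<bar>f k\<bar>" unfolding fB abs_mult by (rule mult_left_mono) simp
      then show ?case using \<kappa> by (simp add: pos_le_divide_eq)
    qed
    moreover have "(\<lambda>k. \<bar>f k\<bar> / \<kappa>) \<longlonglongrightarrow> 0"
      using tendsto_divide_zero[OF tendsto_rabs_zero[OF f]] .
    ultimately have "(\<lambda>k. q k - Q) \<longlonglongrightarrow> 0" by (rule Lim_null_comparison)
    then show ?thesis by (simp add: LIM_zero_iff)
  qed
  note rd = rd_star_props[OF mu_pos nu_pos, folded Q_def]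
  have rlim: "r' \<longlonglongrightarrow> r_star \<mu> \<nu>"
  proof -
    have "(\<lambda>k. (1 + (\<mu> - 1) * q k + w k) / 2) \<longlonglongrightarrow> (1 + (\<mu> - 1) * Q + 0) / 2"
      by (intro tendsto_intros qlim w) simp
    then show ?thesis by (simp add: rw[abs_def] r_star_def Q_def add.commute)
  qed
  have dlim: "d' \<longlonglongrightarrow> d_star \<mu> \<nu>"
  proof -
    have "(\<lambda>k. 1 - q k - r' k) \<longlonglongrightarrow> 1 - Q - r_star \<mu> \<nu>"
      by (intro tendsto_intros qlim rlim)
    moreover have "(\<lambda>k. 1 - q k - r' k) = d'" using pos(5) by (auto simp: fun_eq_iff algebra_simps)
    ultimately show ?thesis by (simp add: d_star_def Q_def)
  qed
  have blim: "(\<lambda>k. b (\<tau> k)) \<longlonglongrightarrow> rho_star \<mu> \<nu>"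
  proof -
    have "(\<lambda>k. r' k / (r' k + q k)) \<longlonglongrightarrow> r_star \<mu> \<nu> / (r_star \<mu> \<nu> + Q)"
      by (intro tendsto_intros rlim qlim) (use rd Qp in auto)
    then show ?thesis by (simp add: b_def r'_def q_def rho_star_def Q_def)
  qed
  have alim: "(\<lambda>k. d' k / (d' k + q k)) \<longlonglongrightarrow> delta_star \<mu> \<nu>"
    unfolding delta_star_def Q_def[symmetric]
    by (intro tendsto_intros dlim qlim) (use rd Qp in auto)
  note rds = rho_delta_star[OF mu_pos nu_pos]
  \<comment> \<open>Vanishing fluxes turn the definition of \<open>J\<close> into a recursion with
    limiting ratio \<open>rho_star\<close>; below the origin it is solved downwards, dividing by
    \<open>b\<close>, whose limit is positive.\<close>
  have up: "(\<lambda>k. p (\<tau> k) (int n)) \<longlonglongrightarrow> ps (int n)" for n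
  proof (induction n)
    case 0
    then show ?case using qlim by (simp add: q_def[abs_def] p_star_altdef Q_def)
  next
    case (Suc n)
    have "(\<lambda>k. b (\<tau> k) * p (\<tau> k) (int n) - J (\<tau> k) (int n)) \<longlonglongrightarrow> rho_star \<mu> \<nu> * ps (int n) - 0"
      by (intro tendsto_intros blim Suc Jlim)
    moreover have "b (\<tau> k) * p (\<tau> k) (int n) - J (\<tau> k) (int n) = p (\<tau> k) (int (Suc n))" for k
      by (simp add: J_def dr_def add.commute)
    moreover have "rho_star \<mu> \<nu> * ps (int n) = ps (int (Suc n))"
      by (simp add: p_star_altdef nat_add_distrib)
    ultimately show ?case by simp
  qed
  have down: "(\<lambda>k. p (\<tau> k) (- int n)) \<longlonglongrightarrow> ps (- int n)" for n
  proof (induction n)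
    case 0
    then show ?case using up[of 0] by simp
  next
    case (Suc n)
    let ?m = "- int (Suc n)"
    have m1: "?m + 1 = - int n" by simp
    have "(\<lambda>k. J (\<tau> k) ?m / b (\<tau> k) + d' k / (d' k + q k) * p (\<tau> k) (- int n))
        \<longlonglongrightarrow> 0 / rho_star \<mu> \<nu> + delta_star \<mu> \<nu> * ps (- int n)"
      by (intro tendsto_intros blim Suc Jlim alim) (use rds in auto)
    moreover have "J (\<tau> k) ?m / b (\<tau> k) + d' k / (d' k + q k) * p (\<tau> k) (- int n) = p (\<tau> k) ?m" for k
    proof -
      have dra: "dr (\<tau> k) (- int n) = b (\<tau> k) * (d' k / (d' k + q k))"
        by (simp add: dr_def a_def d'_def q_def)
      have bp: "b (\<tau> k) > 0" by (rule b_pos[OF \<tau>0(1)])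
      have "J (\<tau> k) ?m = b (\<tau> k) * (p (\<tau> k) ?m - d' k / (d' k + q k) * p (\<tau> k) (- int n))"
        unfolding J_def m1 dra by (simp only: right_diff_distrib mult.assoc)
      then have "J (\<tau> k) ?m / b (\<tau> k) = p (\<tau> k) ?m - d' k / (d' k + q k) * p (\<tau> k) (- int n)"
        using bp by simp
      then show ?thesis by simp
    qed
    moreover have "delta_star \<mu> \<nu> * ps (- int n) = ps ?m"
    proof -
      have "nat (max (- ?m) 0) = Suc n" "nat (max ?m 0) = 0" "nat (max (- (- int n)) 0) = n" "nat (max (- int n) 0) = 0"
        by simp_all
      then show ?thesis unfolding p_star_altdef by simp
    qed
    ultimately show ?case by simp
  qed
  have plim: "(\<lambda>k. p (\<tau> k) n) \<longlonglongrightarrow> ps n" for n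
    using up[of "nat n"] down[of "nat (- n)"] by (cases "n \<ge> 0") auto
  have Hlim: "(\<lambda>k. H (\<tau> k)) \<longlonglongrightarrow> 0"
  proof -
    define M where "M n = ((1 + real_of_int \<bar>n\<bar>) * (B * x ^ nat \<bar>n\<bar>) + exp (- real_of_int \<bar>n\<bar>))
      + LK * ((1 + real_of_int \<bar>n\<bar>) * (B * x ^ nat \<bar>n\<bar>))" for n
    have M: "M summable_on UNIV" unfolding M_def
      by (intro summable_on_add summable_on_cmult_right tail_summable(2)[OF x] summable_exp_abs)
    have LK: "LK \<ge> 0" by (simp add: LK_def)
    have "(\<lambda>k. \<Sum>\<^sub>\<infinity>n. xlnx (p (\<tau> k) n) - L n * p (\<tau> k) n) \<longlonglongrightarrow> (\<Sum>\<^sub>\<infinity>n. xlnx (ps n) - L n * ps n)"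
    proof (rule tendsto_infsum_dominated[OF _ _ M])
      show "(\<lambda>k. xlnx (p (\<tau> k) n) - L n * p (\<tau> k) n) \<longlonglongrightarrow> xlnx (ps n) - L n * ps n" for n
        unfolding xlnx_def using p_star_pos[OF mu_pos nu_pos, of n] by (intro tendsto_intros plim) auto
      show "\<forall>\<^sub>F k in sequentially. \<forall>n\<in>UNIV. \<bar>xlnx (p (\<tau> k) n) - L n * p (\<tau> k) n\<bar> \<le> M n"
      proof (intro always_eventually allI ballI)
        fix k n
        have pq: "0 \<le> p (\<tau> k) n" "p (\<tau> k) n \<le> B * x ^ nat \<bar>n\<bar>"
          using tail[OF \<tau>0(1)] p_nonneg[OF \<tau>0(1)] by auto
        have "\<bar>xlnx (p (\<tau> k) n)\<bar> \<le> real_of_int \<bar>n\<bar> * p (\<tau> k) n + exp (- real_of_int \<bar>n\<bar>)"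
          by (rule xlnx_abs_bound[OF p_nonneg[OF \<tau>0(1)] p_le_1[OF \<tau>0(1)]])
        also have "\<dots> \<le> (1 + real_of_int \<bar>n\<bar>) * (B * x ^ nat \<bar>n\<bar>) + exp (- real_of_int \<bar>n\<bar>)"
          using pq by (intro add_mono mult_mono) auto
        finally have 1: "\<bar>xlnx (p (\<tau> k) n)\<bar> \<le> (1 + real_of_int \<bar>n\<bar>) * (B * x ^ nat \<bar>n\<bar>) + exp (- real_of_int \<bar>n\<bar>)" .
        have "\<bar>L n * p (\<tau> k) n\<bar> \<le> LK * (1 + real_of_int \<bar>n\<bar>) * (B * x ^ nat \<bar>n\<bar>)"
          unfolding abs_mult using pq LK by (intro mult_mono L_bound) auto
        with 1 show "\<bar>xlnx (p (\<tau> k) n) - L n * p (\<tau> k) n\<bar> \<le> M n"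
          unfolding M_def mult.assoc[symmetric] by linarith
      qed
    qed
    moreover have "xlnx (ps n) - L n * ps n = 0" for n by (simp add: xlnx_def L_def)
    ultimately show ?thesis by (simp add: H_altdef[OF \<tau>0(1)])
  qed
  show ?thesis
  proof (rule tendstoI)
    fix e :: real assume "e > 0"
    then have "\<forall>\<^sub>F k in sequentially. H (\<tau> k) < e" using order_tendstoD(2)[OF Hlim] by blast
    then obtain k where k: "H (\<tau> k) < e" by (auto simp: eventually_sequentially)
    have "dist (H t) 0 < e" if "t \<ge> \<tau> k" for t
      using H_antimono[OF \<tau>0(2) that] k H_nonneg[of t] that \<tau>0(1)[of k] by simp
    then show "\<forall>\<^sub>F t in at_top. dist (H t) 0 < e"
      using eventually_at_top_linorder by blast
  qed
qed

text \<open>The Hellinger bound makes the largest deviation at most \<open>2 * sqrt (H t)\<close>.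
  For \<open>s > 1\<close> the power \<open>s - 1\<close> of it is taken out of the sum, and what
  remains is the total deviation, at most 2.\<close>

lemma lp_convergence:
  assumes H: "(H \<longlongrightarrow> 0) at_top" and s: "s > 1"
  shows "((\<lambda>t. lp_norm s (\<lambda>n. p t n - ps n)) \<longlongrightarrow> 0) at_top"
proof -
  have ps1: "ps n \<le> 1" for n
    using finite_sum_le_infsum[OF ps_summable, of "{n}"] ps_nonneg ps_infsum by simp
  have bound: "0 \<le> (\<Sum>\<^sub>\<infinity>n. \<bar>p t n - ps n\<bar> powr s) \<and>
      (\<Sum>\<^sub>\<infinity>n. \<bar>p t n - ps n\<bar> powr s) \<le> (2 * sqrt (H t)) powr (s - 1) * 2" if t: "t \<ge> t0" for t
  proof -
    have sup: "\<bar>p t n - ps n\<bar> \<le> 2 * sqrt (H t)" for n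
    proof -
      define u v where "u = sqrt (p t n)" and "v = sqrt (ps n)"
      have uv: "0 \<le> u" "u \<le> 1" "0 \<le> v" "v \<le> 1" "p t n = u * u" "ps n = v * v"
        using p_nonneg[OF t, of n] p_le_1[OF t, of n] ps_nonneg[of n] ps1[of n] by (auto simp: u_def v_def)
      have "\<bar>u - v\<bar> \<le> sqrt (H t)"
        using real_sqrt_le_mono[OF H_ge_hellinger[OF t, of n]] by (simp add: u_def v_def)
      then have "\<bar>u - v\<bar> * (u + v) \<le> sqrt (H t) * 2" using uv H_nonneg[OF t] by (intro mult_mono) auto
      moreover have "p t n - ps n = (u - v) * (u + v)" using uv by (simp add: algebra_simps)
      ultimately show ?thesis using uv by (simp only: abs_mult)
    qed
    have sm: "(\<lambda>n. (2 * sqrt (H t)) powr (s - 1) * (p t n + ps n)) summable_on UNIV"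
      by (intro summable_on_cmult_right summable_on_add p_summable t ps_summable)
    have le: "\<bar>p t n - ps n\<bar> powr s \<le> (2 * sqrt (H t)) powr (s - 1) * (p t n + ps n)" for n
    proof -
      have "\<bar>p t n - ps n\<bar> powr s \<le> (2 * sqrt (H t)) powr (s - 1) * \<bar>p t n - ps n\<bar>"
        by (rule powr_le_mult[OF _ sup s]) simp
      also have "\<dots> \<le> (2 * sqrt (H t)) powr (s - 1) * (p t n + ps n)"
        using p_nonneg[OF t, of n] ps_nonneg[of n] by (intro mult_left_mono) auto
      finally show ?thesis .
    qed
    have "(\<Sum>\<^sub>\<infinity>n. \<bar>p t n - ps n\<bar> powr s) \<le> (\<Sum>\<^sub>\<infinity>n. (2 * sqrt (H t)) powr (s - 1) * (p t n + ps n))"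
      by (rule infsum_mono[OF summable_on_dominated[OF sm] sm le]) (use le in simp)
    also have "\<dots> = (2 * sqrt (H t)) powr (s - 1) * 2"
      unfolding infsum_cmult_right' infsum_add[OF p_summable[OF t] ps_summable] p_infsum[OF t] ps_infsum by simp
    finally show ?thesis by (auto intro: infsum_nonneg)
  qed
  have Hev: "\<forall>\<^sub>F t in at_top. 0 \<le> H t"
    using eventually_ge_at_top[of t0] by eventually_elim (rule H_nonneg)
  have bev: "\<forall>\<^sub>F t in at_top. 0 \<le> (\<Sum>\<^sub>\<infinity>n. \<bar>p t n - ps n\<bar> powr s) \<and>
      (\<Sum>\<^sub>\<infinity>n. \<bar>p t n - ps n\<bar> powr s) \<le> (2 * sqrt (H t)) powr (s - 1) * 2"
    using eventually_ge_at_top[of t0] by eventually_elim (rule bound)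
  have "((\<lambda>t. (2 * sqrt (H t)) powr (s - 1) * 2) \<longlongrightarrow> (2 * sqrt 0) powr (s - 1) * 2) at_top"
  proof (intro tendsto_intros tendsto_powr' H)
    show "2 * sqrt 0 \<noteq> (0::real) \<or> 0 < s - 1 \<and> (\<forall>\<^sub>F t in at_top. 0 \<le> 2 * sqrt (H t))"
      using s Hev by simp
  qed
  then have l: "((\<lambda>t. (2 * sqrt (H t)) powr (s - 1) * 2) \<longlongrightarrow> 0) at_top" by simp
  have "((\<lambda>t. \<Sum>\<^sub>\<infinity>n. \<bar>p t n - ps n\<bar> powr s) \<longlongrightarrow> 0) at_top"
    by (rule tendsto_sandwich[OF _ _ tendsto_const l])
      (use bev in \<open>auto elim: eventually_mono\<close>)
  then have "((\<lambda>t. (\<Sum>\<^sub>\<infinity>n. \<bar>p t n - ps n\<bar> powr s) powr (1 / s)) \<longlongrightarrow> 0 powr (1 / s)) at_top"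
    by (rule tendsto_powr'[OF _ tendsto_const])
      (use s bev in \<open>auto elim: eventually_mono\<close>)
  then show ?thesis by (simp add: lp_norm_def)
qed

lemma expmoment_init:
  assumes c: "c > 1" "(\<lambda>n. p t0 n * c powi n) summable_on {0..}" "(\<lambda>n. p t0 n * c powi (- n)) summable_on {..0}"
  shows "expmoment c"
proof -
  have m: "max 1 c = c" using c by simp
  have "(\<lambda>n. c ^ nat \<bar>n\<bar> * p t0 n) summable_on {0..}"
    by (rule summable_on_cong[THEN iffD1, OF _ c(2)]) (simp add: power_int_def)
  moreover have "(\<lambda>n. c ^ nat \<bar>n\<bar> * p t0 n) summable_on {..0}"
    by (rule summable_on_cong[THEN iffD1, OF _ c(3)]) (simp add: power_int_def abs_of_nonpos)
  ultimately show ?thesis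
    unfolding expmoment_def m using c(1) by (auto intro: summable_on_int_half)
qed

end

theorem theorem1:
  fixes \<mu> \<nu> t0 :: real and p :: "real \<Rightarrow> int \<Rightarrow> real"
  assumes "\<mu> > 0" and "\<nu> > 0" and "t0 \<ge> 0"
    and "phase2_solution t0 p"
    and "p t0 \<in> wealth_class \<mu> \<nu>"
  shows
    "(\<forall>t\<ge>t0. rel_entropy_term (p t) (p_star \<mu> \<nu>) summable_on UNIV) \<and>
     (\<forall>t>t0. \<exists>D. ((\<lambda>s. rel_entropy (p s) (p_star \<mu> \<nu>)) has_real_derivative D) (at t) \<and>
                 ereal D = - dissipation (p t)) \<and>
     ((\<lambda>s. ereal ((rel_entropy (p s) (p_star \<mu> \<nu>) - rel_entropy (p t0) (p_star \<mu> \<nu>)) / (s - t0)))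
        \<longlongrightarrow> - dissipation (p t0)) (at_right t0) \<and>
     (\<forall>t\<ge>t0. - dissipation (p t) \<le> 0) \<and>
     ((\<exists>c>1. (\<lambda>n. p t0 n * c powi n) summable_on {0..} \<and>
              (\<lambda>n. p t0 n * c powi (- n)) summable_on {..0}) \<longrightarrow>
       (\<forall>s>1. p_star \<mu> \<nu> \<in> lp_space s \<and> (\<forall>t\<ge>t0. p t \<in> lp_space s) \<and>
              ((\<lambda>t. lp_norm s (\<lambda>n. p t n - p_star \<mu> \<nu> n)) \<longlongrightarrow> 0) at_top))"
proof -
  interpret phase2 \<mu> \<nu> t0 p by unfold_locales (fact assms)+
  have ps1: "p_star \<mu> \<nu> n \<le> 1" for n
    using finite_sum_le_infsum[OF ps_summable, of "{n}"] ps_nonneg ps_infsum by simp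
  have H: "H = (\<lambda>s. rel_entropy (p s) (p_star \<mu> \<nu>))" by (simp add: H_def fun_eq_iff)
  show ?thesis
  proof (intro conjI allI impI)
    show "rel_entropy_term (p t) (p_star \<mu> \<nu>) summable_on UNIV" if "t0 \<le> t" for t
      by (rule entropy_summable[OF that])
    show "\<exists>D. ((\<lambda>s. rel_entropy (p s) (p_star \<mu> \<nu>)) has_real_derivative D) (at t) \<and>
        ereal D = - dissipation (p t)" if "t0 < t" for t
    proof (intro exI conjI)
      show "((\<lambda>s. rel_entropy (p s) (p_star \<mu> \<nu>)) has_real_derivative - real_of_ereal (dissipation (p t))) (at t)"
        using H_deriv_interior(1)[OF that] unfolding H .
      show "ereal (- real_of_ereal (dissipation (p t))) = - dissipation (p t)"
        using H_deriv_interior(2)[OF that] by (cases "dissipation (p t)") auto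
    qed
    show "((\<lambda>s. ereal ((rel_entropy (p s) (p_star \<mu> \<nu>) - rel_entropy (p t0) (p_star \<mu> \<nu>)) / (s - t0)))
        \<longlongrightarrow> - dissipation (p t0)) (at_right t0)"
      using H_right_derivative by (simp add: H_def)
    show "- dissipation (p t) \<le> 0" if "t0 \<le> t" for t
      using dissipation_nonneg[OF that] by simp
    fix s :: real assume s: "1 < s"
    show "p_star \<mu> \<nu> \<in> lp_space s"
      by (rule lp_space_prob[OF ps_nonneg ps_summable ps1 s])
    show "p t \<in> lp_space s" if "t0 \<le> t" for t
      by (rule lp_space_prob[OF p_nonneg[OF that] p_summable[OF that] p_le_1[OF that] s])
    assume "\<exists>c>1. (\<lambda>n. p t0 n * c powi n) summable_on {0..} \<and> (\<lambda>n. p t0 n * c powi (- n)) summable_on {..0}"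
    then obtain c where "c > 1" "expmoment c" using expmoment_init by blast
    from lp_convergence[OF H_tendsto_0[OF this] s]
    show "((\<lambda>t. lp_norm s (\<lambda>n. p t n - p_star \<mu> \<nu> n)) \<longlongrightarrow> 0) at_top" .
  qed
qed

end
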